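(* Let $(a,b)\in\mathbb C^2$ be an admissible pair and let $\phi$ be an admissible non-negative potential on $\mathbb R^N$. Let $F\in H^{-1}(\mathbb R^N)$, and let $u\in H^1(\mathbb R^N)\cap L^1(\mathbb R^N)$ be any global weak solution to $$-\Delta u+a\,U+b\,u+\phi\,u=F\quad\text{in }H^{-1}(\mathbb R^N)+L^\infty(\mathbb R^N).$$ There exists $M=M(|a|,|b|)$ such that if there exists a compact subset $K$ of $\mathbb R^N$ such that $F_{|K^{\mathrm c}}\in L^\infty(K^{\mathrm c})$ and $\|F\|_{L^\infty(K^{\mathrm c})}\le\frac1M$, then $\operatorname{supp}u$ is compact.
   Context: All functions are complex-valued unless specified and all spaces are real vector spaces; $X^\star$ is the real topological dual; $\langle f,g\rangle_{L^{p'},L^p}=\mathrm{Re}\int f\,\overline g\,dx$; $K^{\mathrm c}=\mathbb R^N\setminus K$. $M(|a|,|b|)$ denotes a positive constant depending only (and continuously) on $|a|$ and $|b|$. Admissible pair: $a,b\in\mathbb A:=\mathbb C\setminus\{z:\mathrm{Re}(z)\le0,\ \mathrm{Im}(z)=0\}$ and either $\mathrm{Im}(a)\mathrm{Im}(b)\ge0$, or $\mathrm{Im}(a)\mathrm{Im}(b)<0$ and $\mathrm{Re}(b)>\frac{\mathrm{Im}(b)}{\mathrm{Im}(a)}\mathrm{Re}(a)$. Admissible non-negative potential on $\mathbb R^N$: $\phi\in L^\infty(\mathbb R^N)+L^{p_\phi}(\mathbb R^N)$, real-valued, $\phi\ge0$ a.e., where $p_\phi=2$ if $N=1$, $p_\phi=2+\kappa$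 for some $\kappa>0$ if $N=2$, $p_\phi=N$ if $N\ge3$. Saturated section associated to $u$: $U\in L^\infty$ with $\|U\|_{L^\infty}\le1$ and $U=u/|u|$ a.e. where $u\ne0$. Global weak solution: $u\in X:=H^1(\mathbb R^N)\cap L^1(\mathbb R^N)$, $U$ a saturated section associated to $u$, and $$\langle\nabla u,\nabla v\rangle_{L^2,L^2}+\langle aU,v\rangle_{L^\infty,L^1}+\langle bu,v\rangle_{L^2,L^2}+\langle\phi u,v\rangle_{L^2,L^2}=\langle F,v\rangle_{X^\star,X}\quad\forall v\in X.$$ $F_{|K^{\mathrm c}}\in L^\infty(K^{\mathrm c})$ means that $F$ coincides as a distribution on $K^{\mathrm c}$ with an $L^\infty$ function.
   Formalization: The constant M is a positive continuous function of the admissible pair (a,b), not of (|a|,|b|) alone: a constant depending only on the moduli is impossible, e.g. for N=1, b=1, φ=0, |a|=1 with a tending to -1. M remains independent of N, φ, F, u and K. *)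

theory Defs
  imports "HOL-Analysis.Analysis"
begin

text \<open>
  The dimension \<open>n\<close> is a term and not a type, so that a constant can be chosen before \<open>n\<close>:
  Euclidean \<open>n\<close>-space is the carrier of extensional functions \<open>nat \<Rightarrow> real\<close> on \<open>{..<n}\<close>, with the
  topology induced by the product topology on \<open>nat \<Rightarrow> real\<close>, and with product Lebesgue measure.
  Values of functions outside this carrier are irrelevant.
\<close>

abbreviation Rn :: "nat \<Rightarrow> (nat \<Rightarrow> real) set" where
  "Rn n \<equiv> {..<n} \<rightarrow>\<^sub>E UNIV"

abbreviation leb :: "nat \<Rightarrow> (nat \<Rightarrow> real) measure" where
  "leb n \<equiv> PiM {..<n} (\<lambda>_. lborel)"


text \<open>Elements of the function spaces are functions, not classes modulo equality a.e.\<close>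

definition Lp :: "'a measure \<Rightarrow> real \<Rightarrow> ('a \<Rightarrow> 'b::real_normed_vector) set" where
  "Lp M p = {f \<in> borel_measurable M. integrable M (\<lambda>x. norm (f x) powr p)}"

definition Linf :: "'a measure \<Rightarrow> ('a \<Rightarrow> 'b::real_normed_vector) set" where
  "Linf M = {f \<in> borel_measurable M. \<exists>C. AE x in M. norm (f x) \<le> C}"

definition Linf_norm :: "'a measure \<Rightarrow> ('a \<Rightarrow> 'b::real_normed_vector) \<Rightarrow> real" where
  "Linf_norm M f = Inf {C. 0 \<le> C \<and> (AE x in M. norm (f x) \<le> C)}"

definition pairing :: "'a measure \<Rightarrow> ('a \<Rightarrow> complex) \<Rightarrow> ('a \<Rightarrow> complex) \<Rightarrow> real" where
  "pairing M f g = Re (\<integral>x. f x * cnj (g x) \<partial>M)"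


definition partial_deriv ::
    "nat \<Rightarrow> ((nat \<Rightarrow> real) \<Rightarrow> complex) \<Rightarrow> (nat \<Rightarrow> real) \<Rightarrow> complex" where
  "partial_deriv i f x = vector_derivative (\<lambda>t. f (x(i := t))) (at (x i))"

fun Ck :: "nat \<Rightarrow> nat \<Rightarrow> ((nat \<Rightarrow> real) \<Rightarrow> complex) \<Rightarrow> bool" where
  "Ck n 0 f \<longleftrightarrow> continuous_on (Rn n) f"
| "Ck n (Suc k) f \<longleftrightarrow> continuous_on (Rn n) f \<and>
     (\<forall>i<n. (\<forall>x\<in>Rn n. (\<lambda>t. f (x(i := t))) differentiable at (x i)) \<and>
            Ck n k (partial_deriv i f))"

definition test_functions ::
    "nat \<Rightarrow> (nat \<Rightarrow> real) set \<Rightarrow> ((nat \<Rightarrow> real) \<Rightarrow> complex) set" where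
  "test_functions n \<Omega> =
     {\<psi>. (\<forall>k. Ck n k \<psi>) \<and> (\<exists>S. compact S \<and> S \<subseteq> \<Omega> \<and> (\<forall>x\<in>Rn n - S. \<psi> x = 0))}"


definition weak_partial ::
    "nat \<Rightarrow> nat \<Rightarrow> ((nat \<Rightarrow> real) \<Rightarrow> complex) \<Rightarrow> ((nat \<Rightarrow> real) \<Rightarrow> complex) \<Rightarrow> bool" where
  "weak_partial n i u g \<longleftrightarrow>
     (\<forall>\<psi>\<in>test_functions n (Rn n).
        (\<integral>x. u x * partial_deriv i \<psi> x \<partial>leb n) = - (\<integral>x. g x * \<psi> x \<partial>leb n))"

definition H1 :: "nat \<Rightarrow> ((nat \<Rightarrow> real) \<Rightarrow> complex) set" where
  "H1 n = {u \<in> Lp (leb n) 2. \<forall>i<n. \<exists>g\<in>Lp (leb n) 2. weak_partial n i u g}"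

text \<open>On \<open>H1 n\<close> and for \<open>i < n\<close>, the weak derivative is unique up to equality a.e.\<close>

definition weak_grad ::
    "nat \<Rightarrow> ((nat \<Rightarrow> real) \<Rightarrow> complex) \<Rightarrow> nat \<Rightarrow> (nat \<Rightarrow> real) \<Rightarrow> complex" where
  "weak_grad n u i = (SOME g. g \<in> Lp (leb n) 2 \<and> weak_partial n i u g)"

definition H1_norm :: "nat \<Rightarrow> ((nat \<Rightarrow> real) \<Rightarrow> complex) \<Rightarrow> real" where
  "H1_norm n u = sqrt ((\<integral>x. (cmod (u x))\<^sup>2 \<partial>leb n)
                     + (\<Sum>i<n. \<integral>x. (cmod (weak_grad n u i x))\<^sup>2 \<partial>leb n))"

text \<open>
  The real topological dual of \<open>H1 n\<close>. Boundedness forces \<open>F\<close> to agree on functions of \<open>H1 n\<close>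
  that are equal a.e.
\<close>

definition H_minus1 :: "nat \<Rightarrow> (((nat \<Rightarrow> real) \<Rightarrow> complex) \<Rightarrow> real) set" where
  "H_minus1 n = {F.
     (\<forall>u\<in>H1 n. \<forall>v\<in>H1 n. F (\<lambda>x. u x + v x) = F u + F v) \<and>
     (\<forall>c::real. \<forall>u\<in>H1 n. F (\<lambda>x. c *\<^sub>R u x) = c * F u) \<and>
     (\<exists>C. \<forall>u\<in>H1 n. \<bar>F u\<bar> \<le> C * H1_norm n u)}"

definition X_space :: "nat \<Rightarrow> ((nat \<Rightarrow> real) \<Rightarrow> complex) set" where
  "X_space n = H1 n \<inter> Lp (leb n) 1"

text \<open>\<open>F\<close> coincides with \<open>f\<close> as a distribution on the open set \<open>\<Omega>\<close>.\<close>

definition coincides_on ::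
    "nat \<Rightarrow> (nat \<Rightarrow> real) set \<Rightarrow> (((nat \<Rightarrow> real) \<Rightarrow> complex) \<Rightarrow> real) \<Rightarrow>
     ((nat \<Rightarrow> real) \<Rightarrow> complex) \<Rightarrow> bool" where
  "coincides_on n \<Omega> F f \<longleftrightarrow>
     (\<forall>\<psi>\<in>test_functions n \<Omega>. F \<psi> = pairing (restrict_space (leb n) \<Omega>) f \<psi>)"

text \<open>
  The support of a class modulo equality a.e.: the complement of the union of the relatively open
  sets on which \<open>u\<close> vanishes a.e.
\<close>

definition supp :: "nat \<Rightarrow> ((nat \<Rightarrow> real) \<Rightarrow> complex) \<Rightarrow> (nat \<Rightarrow> real) set" where
  "supp n u = Rn n - \<Union>{V. openin (top_of_set (Rn n)) V \<and> (AE x in leb n. x \<in> V \<longrightarrow> u x = 0)}"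


definition \<A> :: "complex set" where
  "\<A> = - {z. Re z \<le> 0 \<and> Im z = 0}"

definition admissible_pairs :: "(complex \<times> complex) set" where
  "admissible_pairs = {(a, b). a \<in> \<A> \<and> b \<in> \<A> \<and>
     (Im a * Im b \<ge> 0 \<or> (Im a * Im b < 0 \<and> Re b > Im b / Im a * Re a))}"

definition Linf_plus_Lp :: "nat \<Rightarrow> real \<Rightarrow> ((nat \<Rightarrow> real) \<Rightarrow> real) set" where
  "Linf_plus_Lp n p =
     {\<phi>. \<exists>\<phi>\<^sub>1\<in>Linf (leb n). \<exists>\<phi>\<^sub>2\<in>Lp (leb n) p. \<forall>x\<in>Rn n. \<phi> x = \<phi>\<^sub>1 x + \<phi>\<^sub>2 x}"

definition admissible_potential :: "nat \<Rightarrow> ((nat \<Rightarrow> real) \<Rightarrow> real) \<Rightarrow> bool" where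
  "admissible_potential n \<phi> \<longleftrightarrow>
     (AE x in leb n. 0 \<le> \<phi> x) \<and>
     (n = 1 \<longrightarrow> \<phi> \<in> Linf_plus_Lp n 2) \<and>
     (n = 2 \<longrightarrow> (\<exists>\<kappa>>0. \<phi> \<in> Linf_plus_Lp n (2 + \<kappa>))) \<and>
     (n \<ge> 3 \<longrightarrow> \<phi> \<in> Linf_plus_Lp n (real n))"

definition saturated_section ::
    "nat \<Rightarrow> ((nat \<Rightarrow> real) \<Rightarrow> complex) \<Rightarrow> ((nat \<Rightarrow> real) \<Rightarrow> complex) \<Rightarrow> bool" where
  "saturated_section n u U \<longleftrightarrow>
     U \<in> Linf (leb n) \<and> Linf_norm (leb n) U \<le> 1 \<and>
     (AE x in leb n. u x \<noteq> 0 \<longrightarrow> U x = u x / complex_of_real (cmod (u x)))"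

definition global_weak_solution ::
    "nat \<Rightarrow> complex \<Rightarrow> complex \<Rightarrow> ((nat \<Rightarrow> real) \<Rightarrow> real) \<Rightarrow> (((nat \<Rightarrow> real) \<Rightarrow> complex) \<Rightarrow> real) \<Rightarrow>
     ((nat \<Rightarrow> real) \<Rightarrow> complex) \<Rightarrow> bool" where
  "global_weak_solution n a b \<phi> F u \<longleftrightarrow>
     u \<in> X_space n \<and>
     (\<exists>U. saturated_section n u U \<and>
       (\<forall>v\<in>X_space n.
          (\<Sum>i<n. pairing (leb n) (weak_grad n u i) (weak_grad n v i))
          + pairing (leb n) (\<lambda>x. a * U x) v
          + pairing (leb n) (\<lambda>x. b * u x) v
          + pairing (leb n) (\<lambda>x. complex_of_real (\<phi> x) * u x) v
          = F v))"

end

theory Submission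
  imports Defs
begin

text \<open>
  The proof is the energy method in half-spaces. Admissibility of \<open>(a, b)\<close> says that the three
  numbers \<open>1\<close>, \<open>a\<close>, \<open>b\<close> lie in a common open half-plane through the origin: some \<open>l\<close> in the closed
  unit disc makes \<open>Re l\<close>, \<open>Re (l a)\<close> and \<open>Re (l b)\<close> positive. The largest lower bound reached by these three
  numbers as \<open>l\<close> varies is a positive Lipschitz function of the pair (\<open>rot_margin\<close>), and \<open>M\<close> is a
  multiple of its inverse.

  Fix a coordinate direction with sign, \<open>s x\<^sub>i\<close>, and a level \<open>\<rho>\<close> beyond the compact set \<open>K\<close>. Testing the
  equation with \<open>cnj l \<sqdot> \<eta> \<sqdot> u\<close>, where \<open>\<eta>\<close> is a smooth cutoff that depends on \<open>s x\<^sub>i\<close> only and vanishes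
  below \<open>\<rho>\<close>, makes all zero order terms coercive. The potential contributes \<open>Re l \<integral> \<phi> \<eta> |u|\<^sup>2 \<ge> 0\<close>; the
  datum contributes at most \<open>\<kappa> \<integral> \<eta> |u|\<close>, half of what the saturated term controls, because it is small
  outside \<open>K\<close>. What remains (\<open>half_space_energy\<close>) is a bound of \<open>\<kappa> \<integral> \<eta> (|\<nabla>u|\<^sup>2 + |u|\<^sup>2 + |u|)\<close> by \<open>C / h\<close> times
  the integral of \<open>|\<partial>\<^sub>i u| |u|\<close> over the half-space \<open>s x\<^sub>i > \<rho>\<close>, where \<open>h\<close> is the width of the cutoff.

  The term linear in \<open>|u|\<close> makes this inequality close with a gain. Let \<open>E \<rho>\<close> be the integral of
  \<open>|\<nabla>u|\<^sup>2 + |u|\<^sup>2 + |u|\<close> over the half-space. Nash's inequality bounds the square of the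
  \<open>L\<^sup>2\<close> norm of \<open>u\<close> there by a multiple of \<open>r\<^sup>-\<^sup>n E\<^sup>2 + r\<^sup>2 h\<^sup>-\<^sup>2 E\<close> for every length \<open>r\<close> (\<open>nash_half_space\<close>), which
  is of higher order than \<open>E\<close> if \<open>r\<close> is a suitable power of \<open>E\<close>. A De Giorgi iteration over levels with
  geometrically decreasing gaps (\<open>de_giorgi\<close>) then forces \<open>E\<close> to vanish at a finite level, and doing this
  for the \<open>2n\<close> half-spaces bounds the support.

  Two approximation results carry the rest. Test functions are dense in \<open>L\<^sup>2\<close>
  (\<open>L2_test_limit\<close>), so that \<open>L\<^sup>2\<close> bounds can be proved by duality (\<open>L2_bound_by_duality\<close>): this gives
  uniqueness of weak derivatives and the estimate of translations by the gradient, and from the latter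
  Nash's inequality. Functions that vanish on a half-space are \<open>H\<^sup>1\<close> limits of test functions that
  vanish on a slightly smaller one and have no larger \<open>L\<^sup>1\<close> norm (\<open>sob_half_space_approx\<close>), so that the
  bound on \<open>F\<close> as a distribution off \<open>K\<close> applies to the function \<open>cnj l \<sqdot> \<eta> \<sqdot> u\<close> (\<open>functional_bound\<close>).
\<close>

section \<open>Lebesgue measure and topology of the carrier\<close>

lemma space_leb [simp]: "space (leb n) = Rn n"
  by (simp add: space_PiM)

interpretation lebp: product_sigma_finite "\<lambda>_::nat. lborel :: real measure"
  by standard

lemma sigma_finite_leb: "sigma_finite_measure (leb n)"
  by (rule lebp.sigma_finite) simp

text \<open>
  Vector operations do not preserve extensionality, so translations (\<open>s = 1\<close>),
  point reflections (\<open>s = - 1\<close>) and dilations are written with an explicit restriction. In particular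
  \<open>aff n (- 1) x y\<close> is the difference \<open>x - y\<close>.
\<close>

definition aff :: "nat \<Rightarrow> real \<Rightarrow> (nat \<Rightarrow> real) \<Rightarrow> (nat \<Rightarrow> real) \<Rightarrow> (nat \<Rightarrow> real)" where
  "aff n s c x = (\<lambda>i\<in>{..<n}. s * x i + c i)"

lemma aff_in_Rn [simp]: "aff n s c x \<in> Rn n"
  by (simp add: aff_def)

lemma aff_nth [simp]: "i < n \<Longrightarrow> aff n s c x i = s * x i + c i"
  by (simp add: aff_def)

lemma Rn_upd: "x \<in> Rn n \<Longrightarrow> i < n \<Longrightarrow> x(i := t) \<in> Rn n"
  by (auto simp: PiE_iff extensional_def)

lemma Rn_eqI: "x \<in> Rn n \<Longrightarrow> y \<in> Rn n \<Longrightarrow> (\<And>i. i < n \<Longrightarrow> x i = y i) \<Longrightarrow> x = y"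
  by (rule PiE_ext) auto

lemma aff_upd: "i < n \<Longrightarrow> aff n s c (x(i := t)) = (aff n s c x)(i := s * t + c i)"
  by (auto simp: aff_def fun_eq_iff)

lemma measurable_aff [measurable]: "aff n s c \<in> measurable (leb n) (leb n)"
  unfolding aff_def by measurable

lemma distr_affine_lborel:
  assumes "s = 1 \<or> s = - 1"
  shows "distr lborel lborel (\<lambda>t. s * t + c) = (lborel :: real measure)"
proof -
  have "lborel = density (distr lborel borel (\<lambda>t. c + s * t)) (\<lambda>_. ennreal \<bar>s\<bar>)"
    using assms by (intro lborel_real_affine) auto
  also have "\<dots> = distr lborel borel (\<lambda>t. s * t + c)"
    using assms by (auto simp: density_1 add.commute)
  also have "\<dots> = distr lborel lborel (\<lambda>t. s * t + c)"
    by (rule distr_cong) auto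
  finally show ?thesis by simp
qed

lemma distr_aff:
  assumes "s = 1 \<or> s = - 1"
  shows "distr (leb n) (leb n) (aff n s c) = leb n"
proof (rule lebp.PiM_eqI)
  fix A :: "nat \<Rightarrow> real set" assume A: "\<And>i. i \<in> {..<n} \<Longrightarrow> A i \<in> sets lborel"
  have "emeasure (distr (leb n) (leb n) (aff n s c)) (Pi\<^sub>E {..<n} A)
      = emeasure (leb n) (aff n s c -` Pi\<^sub>E {..<n} A \<inter> space (leb n))"
    using A by (intro emeasure_distr) auto
  also have "aff n s c -` Pi\<^sub>E {..<n} A \<inter> space (leb n) = (\<Pi>\<^sub>E i\<in>{..<n}. (\<lambda>t. s * t + c i) -` A i)"
    by (auto simp: aff_def PiE_iff)
  also have "emeasure (leb n) \<dots> = (\<Prod>i<n. emeasure lborel ((\<lambda>t. s * t + c i) -` A i))"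
    using A by (intro lebp.emeasure_PiM) (auto intro!: measurable_sets_borel[where M=borel])
  also have "\<dots> = (\<Prod>i<n. emeasure lborel (A i))"
  proof (rule prod.cong[OF refl])
    fix i assume "i \<in> {..<n}"
    then have "emeasure (distr lborel lborel (\<lambda>t. s * t + c i)) (A i) = emeasure lborel ((\<lambda>t. s * t + c i) -` A i)"
      using A by (subst emeasure_distr) auto
    then show "emeasure lborel ((\<lambda>t. s * t + c i) -` A i) = emeasure lborel (A i)"
      using distr_affine_lborel[OF assms] by simp
  qed
  finally show "emeasure (distr (leb n) (leb n) (aff n s c)) (Pi\<^sub>E {..<n} A) = (\<Prod>i<n. emeasure lborel (A i))" .
qed auto

lemma
  fixes f :: "(nat \<Rightarrow> real) \<Rightarrow> 'b::{banach, second_countable_topology}"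
  assumes "s = 1 \<or> s = - 1" and [measurable]: "f \<in> borel_measurable (leb n)"
  shows integrable_aff_iff: "integrable (leb n) (\<lambda>x. f (aff n s c x)) \<longleftrightarrow> integrable (leb n) f"
    and integral_aff: "(\<integral>x. f (aff n s c x) \<partial>leb n) = (\<integral>x. f x \<partial>leb n)"
proof -
  show "integrable (leb n) (\<lambda>x. f (aff n s c x)) \<longleftrightarrow> integrable (leb n) f"
    using integrable_distr_eq[of "aff n s c" "leb n" "leb n" f] distr_aff[OF assms(1), of n c] by auto
  show "(\<integral>x. f (aff n s c x) \<partial>leb n) = (\<integral>x. f x \<partial>leb n)"
    using integral_distr[of "aff n s c" "leb n" "leb n" f] distr_aff[OF assms(1), of n c] by auto
qed

lemma nn_integral_aff:
  assumes "s = 1 \<or> s = - 1" and [measurable]: "f \<in> borel_measurable (leb n)"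
  shows "(\<integral>\<^sup>+x. f (aff n s c x) \<partial>leb n) = (\<integral>\<^sup>+x. f x \<partial>leb n)"
  using nn_integral_distr[of "aff n s c" "leb n" "leb n" f] distr_aff[OF assms(1), of n c] by auto

text \<open>
  Composing with the restriction \<open>e\<close> to the coordinates below \<open>n\<close> turns a continuous function on the
  carrier into one on all of \<open>nat \<Rightarrow> real\<close>, whose Borel sets are those of the countable product.
\<close>

lemma measurable_continuous_Rn:
  fixes f :: "(nat \<Rightarrow> real) \<Rightarrow> 'b::topological_space"
  assumes "continuous_on (Rn n) f"
  shows "f \<in> borel_measurable (leb n)"
proof -
  define e :: "(nat \<Rightarrow> real) \<Rightarrow> nat \<Rightarrow> real" where "e x = restrict x {..<n}" for x
  have "continuous_on UNIV e"
  proof (rule continuous_on_coordinatewise_then_product)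
    fix i show "continuous_on UNIV (\<lambda>x. e x i)"
      by (cases "i < n") (simp_all add: e_def)
  qed
  then have "continuous_on UNIV (\<lambda>x. f (e x))"
    by (rule continuous_on_compose2[OF assms]) (simp add: e_def image_subset_iff)
  then have m: "(\<lambda>x. f (e x)) \<in> borel_measurable (borel :: (nat \<Rightarrow> real) measure)"
    by (rule borel_measurable_continuous_onI)
  have "(\<lambda>x. x) \<in> measurable (leb n) (Pi\<^sub>M UNIV (\<lambda>_. borel :: real measure))"
  proof (rule measurable_PiM_single')
    fix i :: nat
    show "(\<lambda>\<omega>. \<omega> i) \<in> borel_measurable (leb n)"
    proof (cases "i < n")
      case False
      then have "(\<lambda>\<omega>. \<omega> i) \<in> borel_measurable (leb n) \<longleftrightarrow> (\<lambda>\<omega>. undefined :: real) \<in> borel_measurable (leb n)"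
        by (intro measurable_cong) (auto simp: PiE_iff extensional_def)
      then show ?thesis by simp
    qed (use measurable_component_singleton[of i "{..<n}" "\<lambda>_. lborel"] in simp)
  qed auto
  then have "(\<lambda>x. x) \<in> measurable (leb n) borel"
    using measurable_cong_sets[OF refl sets_PiM_equal_borel[where 'a=nat and 'b=real], of "leb n"] by blast
  then have "(\<lambda>x. f (e x)) \<in> borel_measurable (leb n)"
    using measurable_compose[OF _ m] by blast
  also have "(\<lambda>x. f (e x)) \<in> borel_measurable (leb n) \<longleftrightarrow> f \<in> borel_measurable (leb n)"
    by (intro measurable_cong) (simp add: e_def extensional_restrict PiE_iff)
  finally show ?thesis .
qed

abbreviation box_n :: "nat \<Rightarrow> real \<Rightarrow> (nat \<Rightarrow> real) set" where
  "box_n n R \<equiv> {..<n} \<rightarrow>\<^sub>E {-R..R}"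

lemma box_n_iff: "x \<in> box_n n R \<longleftrightarrow> x \<in> Rn n \<and> (\<forall>i<n. \<bar>x i\<bar> \<le> R)"
  unfolding PiE_iff by (force simp: abs_le_iff)

lemma compact_box_n: "compact (box_n n R)"
proof -
  let ?S = "\<lambda>i. if i < n then {-R..R} else {undefined :: real}"
  have "x \<in> box_n n R \<longleftrightarrow> x \<in> Pi\<^sub>E UNIV ?S" for x
    unfolding PiE_iff extensional_def by (simp add: split: if_split) (metis not_le lessThan_iff)
  then have "box_n n R = Pi\<^sub>E UNIV ?S" by blast
  moreover have "compactin (product_topology (\<lambda>_. euclidean) UNIV) (Pi\<^sub>E UNIV ?S)"
    unfolding compactin_PiE by simp
  ultimately show ?thesis
    by (simp add: euclidean_product_topology)
qed

lemma compact_subset_box: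
  assumes "compact S" "S \<subseteq> Rn n"
  shows "\<exists>R>0. S \<subseteq> box_n n R"
proof -
  have "\<exists>r. \<forall>x\<in>S. \<bar>x i\<bar> \<le> r" for i
  proof -
    have "compact ((\<lambda>x. x i) ` S)"
      by (rule compact_continuous_image[OF _ assms(1)])
         (rule continuous_on_subset[OF continuous_on_product_coordinates], simp)
    from compact_imp_bounded[OF this] show ?thesis
      unfolding bounded_iff by auto
  qed
  then obtain r where r: "\<And>i x. x \<in> S \<Longrightarrow> \<bar>x i\<bar> \<le> r i" by metis
  define R where "R = 1 + (\<Sum>i<n. \<bar>r i\<bar>)"
  have "\<bar>x i\<bar> \<le> R" if "x \<in> S" "i < n" for x i
  proof -
    have "\<bar>r i\<bar> \<le> (\<Sum>i<n. \<bar>r i\<bar>)"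
      using that by (intro member_le_sum) auto
    with r[OF that(1), of i] show ?thesis unfolding R_def by linarith
  qed
  moreover have "R > 0" unfolding R_def by (simp add: sum_nonneg add_pos_nonneg)
  ultimately show ?thesis using assms(2) by (intro exI[of _ R] conjI subsetI) (simp_all only: box_n_iff, blast)
qed

lemma sets_box_n [measurable]: "box_n n R \<in> sets (leb n)"
  by (intro sets_PiM_I_finite) auto

lemma emeasure_box_n: "emeasure (leb n) (box_n n R) < \<infinity>"
proof -
  have "emeasure (leb n) (box_n n R) = (\<Prod>i<n. emeasure lborel {-R..R})"
    by (intro lebp.emeasure_PiM) auto
  also have "\<dots> < \<infinity>"
    by (cases "R \<ge> 0") (auto simp: less_top[symmetric] ennreal_prod_eq_top simp del: prod_constant)
  finally show ?thesis .
qed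

lemma continuous_on_aff: "continuous_on A (aff n s c)"
proof (rule continuous_on_coordinatewise_then_product)
  fix i
  have "continuous_on A (\<lambda>x. x i :: real)"
    by (rule continuous_on_subset[OF continuous_on_product_coordinates]) simp
  then show "continuous_on A (\<lambda>x. aff n s c x i)"
    by (cases "i < n") (simp_all add: aff_def continuous_on_add continuous_on_mult_left)
qed

section \<open>A smooth ramp on the real line\<close>

text \<open>
  The functions \<open>P(1/t) exp(-1/t)\<close>, extended by \<open>0\<close> to \<open>t \<le> 0\<close>: a family containing the
  classical smooth ramp \<open>exp(-1/t)\<close> that is closed under differentiation.
\<close>

definition expinv :: "real poly \<Rightarrow> real \<Rightarrow> real" where
  "expinv P t = (if t > 0 then poly P (1 / t) * exp (- (1 / t)) else 0)"

lemma tendsto_poly_exp: "((\<lambda>y. poly P y * exp (- y)) \<longlongrightarrow> (0::real)) at_top"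
proof -
  have "((\<lambda>y. \<Sum>i\<le>degree P. coeff P i * (y ^ i / exp y)) \<longlongrightarrow> (\<Sum>i\<le>degree P. coeff P i * 0)) at_top"
    by (intro tendsto_sum tendsto_mult tendsto_const tendsto_power_div_exp_0)
  then show ?thesis
    by (simp add: poly_altdef sum_distrib_right exp_minus divide_inverse mult.assoc)
qed

lemma tendsto_expinv_0: "(expinv P \<longlongrightarrow> 0) (at 0)"
proof (subst filterlim_at_split, intro conjI)
  show "(expinv P \<longlongrightarrow> 0) (at_left 0)"
    by (rule tendsto_eventually) (auto simp: expinv_def eventually_at_filter)
  have "((\<lambda>t. poly P (1 / t) * exp (- (1 / t))) \<longlongrightarrow> 0) (at_right 0)"
    using filterlim_compose[OF tendsto_poly_exp filterlim_inverse_at_top_right, of P]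
    by (simp add: inverse_eq_divide)
  then show "(expinv P \<longlongrightarrow> 0) (at_right 0)"
    by (rule Lim_transform_eventually) (auto simp: expinv_def eventually_at_filter)
qed

definition expinv_next :: "real poly \<Rightarrow> real poly" where
  "expinv_next P = [:0, 0, 1:] * (P - pderiv P)"

text \<open>
  Only \<open>t = 0\<close> needs an argument: there the difference quotient of the function belonging to \<open>P\<close> is
  the function belonging to \<open>X P\<close>, which tends to \<open>0\<close>.
\<close>

lemma DERIV_expinv: "(expinv P has_real_derivative expinv (expinv_next P) t) (at t)"
proof -
  consider "t < 0" | "t = 0" | "t > 0" by linarith
  then show ?thesis
  proof cases
    case 1
    have "((\<lambda>_. 0) has_real_derivative expinv (expinv_next P) t) (at t)"
      using 1 by (simp add: expinv_def)
    moreover have "\<forall>\<^sub>F s in nhds t. expinv P s = 0"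
      using eventually_nhds_in_open[of "{..<0}" t] 1
      by (auto simp: expinv_def elim!: eventually_mono)
    ultimately show ?thesis by (subst DERIV_cong_ev[OF refl _ refl])
  next
    case 2
    have "(expinv P h - expinv P 0) / h = expinv (pCons 0 P) h" for h
      by (simp add: expinv_def)
    then have "(\<lambda>h. (expinv P h - expinv P 0) / h) = expinv (pCons 0 P)" by blast
    then show ?thesis
      using tendsto_expinv_0[of "pCons 0 P"] 2 unfolding DERIV_def
      by (simp add: expinv_def[of _ 0])
  next
    case 3
    have "((\<lambda>s. poly P (1 / s) * exp (- (1 / s))) has_real_derivative expinv (expinv_next P) t) (at t)"
      using 3 by (auto intro!: derivative_eq_intros
          simp: expinv_def expinv_next_def power2_eq_square field_simps)
    moreover have "\<forall>\<^sub>F s in nhds t. expinv P s = poly P (1 / s) * exp (- (1 / s))"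
      using eventually_nhds_in_open[of "{0<..}" t] 3
      by (auto simp: expinv_def elim!: eventually_mono)
    ultimately show ?thesis by (subst DERIV_cong_ev[OF refl _ refl])
  qed
qed

text \<open>
  Sequences of successive derivatives: carrying all derivatives along makes smoothness of a composition with
  a coordinate an induction on the order alone.
\<close>

definition derivs :: "(nat \<Rightarrow> real \<Rightarrow> real) \<Rightarrow> bool" where
  "derivs D \<longleftrightarrow> (\<forall>k t. (D k has_real_derivative D (Suc k) t) (at t))"

definition ramp :: "nat \<Rightarrow> real \<Rightarrow> real" where
  "ramp k = expinv ((expinv_next ^^ k) 1)"

lemma derivs_ramp: "derivs ramp"
  by (simp add: derivs_def ramp_def DERIV_expinv)

lemma derivs_affine: "derivs D \<Longrightarrow> derivs (\<lambda>k t. s ^ k * D k (s * t + c))"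
  unfolding derivs_def
proof (intro allI)
  fix k t assume D: "\<forall>k t. (D k has_real_derivative D (Suc k) t) (at t)"
  have "((\<lambda>t. D k (s * t + c)) has_real_derivative D (Suc k) (s * t + c) * s) (at t)"
    by (rule DERIV_chain2[OF D[rule_format]]) (auto intro!: derivative_eq_intros)
  from DERIV_cmult[OF this, of "s ^ k"]
  show "((\<lambda>t. s ^ k * D k (s * t + c)) has_real_derivative s ^ Suc k * D (Suc k) (s * t + c)) (at t)"
    by (simp add: mult_ac)
qed

lemma ramp_0: "ramp 0 t = (if t > 0 then exp (- (1 / t)) else 0)"
  by (simp add: ramp_def expinv_def)

lemma ramp_nonpos [simp]: "t \<le> 0 \<Longrightarrow> ramp k t = 0"
  by (simp add: ramp_def expinv_def)

lemma ramp_0_bounds: "0 \<le> ramp 0 t" "ramp 0 t \<le> 1"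
  by (auto simp: ramp_0)

lemma ramp_1_bounds: "0 \<le> ramp (Suc 0) t" "ramp (Suc 0) t \<le> 2"
proof -
  have *: "ramp (Suc 0) t = (1 / t)\<^sup>2 * exp (- (1 / t))" if "t > 0"
    using that by (simp add: ramp_def expinv_def expinv_next_def power2_eq_square)
  have "(1 / t)\<^sup>2 * exp (- (1 / t)) \<le> 2" if "t > 0"
  proof -
    have "1 + 1 / t + (1 / t)\<^sup>2 / 2 \<le> exp (1 / t)"
      using that by (intro exp_lower_Taylor_quadratic) auto
    then have "(1 / t)\<^sup>2 \<le> 2 * exp (1 / t)" using that by (smt (verit) divide_pos_pos field_sum_of_halves)
    then have "(1 / t)\<^sup>2 * exp (- (1 / t)) \<le> (2 * exp (1 / t)) * exp (- (1 / t))"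
      by (intro mult_right_mono) auto
    also have "\<dots> = 2" by (simp add: mult.assoc flip: exp_add)
    finally show ?thesis .
  qed
  with * show "0 \<le> ramp (Suc 0) t" "ramp (Suc 0) t \<le> 2"
    by (cases "t > 0"; simp)+
qed

lemma derivs_cont: "derivs D \<Longrightarrow> continuous_on A (D k)"
  unfolding derivs_def
  by (meson DERIV_isCont continuous_at_imp_continuous_on)

section \<open>Smooth functions of several variables\<close>

definition Csmooth :: "nat \<Rightarrow> ((nat \<Rightarrow> real) \<Rightarrow> complex) \<Rightarrow> bool" where
  "Csmooth n f \<longleftrightarrow> (\<forall>k. Ck n k f)"

lemma partial_deriv_cong:
  "(\<And>x. x \<in> Rn n \<Longrightarrow> f x = g x) \<Longrightarrow> i < n \<Longrightarrow> x \<in> Rn n \<Longrightarrow> partial_deriv i f x = partial_deriv i g x"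
  unfolding partial_deriv_def by (simp add: Rn_upd)

text \<open>
  Differentiation is along coordinate lines, which do not leave the carrier, so values off the carrier
  never enter.
\<close>

lemma Ck_cong:
  assumes "\<And>x. x \<in> Rn n \<Longrightarrow> f x = g x"
  shows "Ck n k f \<longleftrightarrow> Ck n k g"
  using assms
proof (induction k arbitrary: f g)
  case 0
  then show ?case by (simp cong: continuous_on_cong)
next
  case (Suc k)
  have 1: "continuous_on (Rn n) f \<longleftrightarrow> continuous_on (Rn n) g"
    using Suc.prems by (intro continuous_on_cong) auto
  have 2: "Ck n k (partial_deriv i f) \<longleftrightarrow> Ck n k (partial_deriv i g)" if "i < n" for i
    by (rule Suc.IH) (rule partial_deriv_cong[OF Suc.prems that])
  have 3: "(\<lambda>t. f (x(i := t))) = (\<lambda>t. g (x(i := t)))" if "i < n" "x \<in> Rn n" for i x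
  proof
    fix t show "f (x(i := t)) = g (x(i := t))"
      by (rule Suc.prems) (rule Rn_upd[OF that(2,1)])
  qed
  show ?case using 1 2 3 by (simp cong: ball_cong)
qed

lemma Ck_Suc_imp: "Ck n (Suc k) f \<Longrightarrow> Ck n k f"
  by (induction k arbitrary: f) auto

lemma Ck_cont: "Ck n k f \<Longrightarrow> continuous_on (Rn n) f"
  by (cases k) auto

lemma Ck_has_vd:
  assumes "Ck n (Suc k) f" "i < n" "x \<in> Rn n"
  shows "((\<lambda>t. f (x(i := t))) has_vector_derivative partial_deriv i f (x(i := t0))) (at t0)"
proof -
  have "(\<lambda>t. f ((x(i := t0))(i := t))) differentiable at ((x(i := t0)) i)"
    using assms Rn_upd[OF assms(3,2), of t0] unfolding Ck.simps by blast
  then have "(\<lambda>t. f (x(i := t))) differentiable at t0"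
    unfolding fun_upd_upd fun_upd_same .
  then show ?thesis
    unfolding partial_deriv_def fun_upd_upd fun_upd_same vector_derivative_works .
qed

lemma Ck_has_vd':
  assumes "Ck n (Suc k) f" "i < n" "x \<in> Rn n"
  shows "((\<lambda>t. f (x(i := t))) has_vector_derivative partial_deriv i f x) (at (x i))"
  using Ck_has_vd[OF assms, of "x i"] unfolding fun_upd_triv .

lemma partial_derivI:
  assumes "((\<lambda>t. f (x(i := t))) has_vector_derivative D) (at (x i))"
  shows "partial_deriv i f x = D" "(\<lambda>t. f (x(i := t))) differentiable at (x i)"
  using assms unfolding partial_deriv_def
  by (auto intro: vector_derivative_at differentiableI_vector)

text \<open>
  The form in which smoothness is verified below: the partial derivatives are named by the caller
  instead of being given through \<open>vector_derivative\<close>.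
\<close>

lemma Ck_SucI:
  assumes "continuous_on (Rn n) f"
    and "\<And>i x. i < n \<Longrightarrow> x \<in> Rn n \<Longrightarrow> ((\<lambda>t. f (x(i := t))) has_vector_derivative F i x) (at (x i))"
    and "\<And>i. i < n \<Longrightarrow> Ck n k (F i)"
  shows "Ck n (Suc k) f"
proof -
  have "Ck n k (partial_deriv i f) \<longleftrightarrow> Ck n k (F i)" if "i < n" for i
    by (rule Ck_cong) (use assms(2)[OF that] partial_derivI(1) in blast)
  moreover have "(\<lambda>t. f (x(i := t))) differentiable at (x i)" if "i < n" "x \<in> Rn n" for i x
    by (rule partial_derivI(2)) (rule assms(2)[OF that])
  ultimately show ?thesis using assms(1,3) unfolding Ck.simps by blast
qed

lemma Ck_const: "Ck n k (\<lambda>_. c)"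
proof (induction k arbitrary: c)
  case (Suc k)
  show ?case by (rule Ck_SucI[where F = "\<lambda>_ _. 0"]) (auto intro: Suc)
qed simp

lemma Ck_add: "Ck n k f \<Longrightarrow> Ck n k g \<Longrightarrow> Ck n k (\<lambda>x. f x + g x)"
proof (induction k arbitrary: f g)
  case 0
  then show ?case by (auto intro: continuous_on_add)
next
  case (Suc k)
  show ?case
  proof (rule Ck_SucI[where F = "\<lambda>i x. partial_deriv i f x + partial_deriv i g x"])
    show "continuous_on (Rn n) (\<lambda>x. f x + g x)"
      using Suc.prems by (auto intro: continuous_on_add)
    show "((\<lambda>t. f (x(i := t)) + g (x(i := t))) has_vector_derivative
        partial_deriv i f x + partial_deriv i g x) (at (x i))" if "i < n" "x \<in> Rn n" for i x
      by (rule has_vector_derivative_add[OF Ck_has_vd'[OF Suc.prems(1) that] Ck_has_vd'[OF Suc.prems(2) that]])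
  qed (use Suc in auto)
qed

lemma Ck_mult: "Ck n k f \<Longrightarrow> Ck n k g \<Longrightarrow> Ck n k (\<lambda>x. f x * g x)"
proof (induction k arbitrary: f g)
  case 0
  then show ?case by (auto intro: continuous_on_mult)
next
  case (Suc k)
  show ?case
  proof (rule Ck_SucI[where F = "\<lambda>i x. f x * partial_deriv i g x + partial_deriv i f x * g x"])
    show "continuous_on (Rn n) (\<lambda>x. f x * g x)"
      using Suc.prems by (auto intro: continuous_on_mult)
    show "((\<lambda>t. f (x(i := t)) * g (x(i := t))) has_vector_derivative
        f x * partial_deriv i g x + partial_deriv i f x * g x) (at (x i))" if "i < n" "x \<in> Rn n" for i x
      using has_vector_derivative_mult[OF Ck_has_vd'[OF Suc.prems(1) that] Ck_has_vd'[OF Suc.prems(2) that]]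
      unfolding fun_upd_triv .
    show "Ck n k (\<lambda>x. f x * partial_deriv i g x + partial_deriv i f x * g x)" if "i < n" for i
      using Suc.prems that
      by (intro Ck_add Suc.IH Ck_Suc_imp[OF Suc.prems(1)] Ck_Suc_imp[OF Suc.prems(2)]) auto
  qed
qed

lemma Ck_coord:
  assumes D: "derivs D" and i: "i < n"
  shows "Ck n k (\<lambda>x. complex_of_real (D m (x i)))"
proof (induction k arbitrary: m)
  have c: "continuous_on (Rn n) (\<lambda>x. complex_of_real (D m (x i)))" for m
    by (intro continuous_on_of_real continuous_on_compose2[OF derivs_cont[OF D, of UNIV]]
         continuous_on_subset[OF continuous_on_product_coordinates]) auto
  { case 0 show ?case using c by simp }
  case (Suc k)
  show ?case
  proof (rule Ck_SucI[where F = "\<lambda>j x. if j = i then complex_of_real (D (Suc m) (x i)) else 0"])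
    show "((\<lambda>t. complex_of_real (D m ((x(j := t)) i))) has_vector_derivative
        (if j = i then complex_of_real (D (Suc m) (x i)) else 0)) (at (x j))" for j x
    proof (cases "j = i")
      case True
      have "(D m has_real_derivative D (Suc m) (x i)) (at (x i))"
        using D by (simp add: derivs_def)
      from has_vector_derivative_of_real[OF this] show ?thesis using True by simp
    qed auto
    show "Ck n k (\<lambda>x. if j = i then complex_of_real (D (Suc m) (x i)) else 0)" for j
      by (cases "j = i") (auto intro: Suc Ck_const)
  qed (rule c)
qed

lemma partial_deriv_coord:
  assumes D: "derivs D"
  shows "partial_deriv j (\<lambda>x. complex_of_real (D m (x i))) x = (if j = i then complex_of_real (D (Suc m) (x i)) else 0)"
proof (rule partial_derivI(1), cases "j = i")
  case True
  have "(D m has_real_derivative D (Suc m) (x i)) (at (x i))"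
    using D by (simp add: derivs_def)
  from has_vector_derivative_of_real[OF this]
  show "((\<lambda>t. complex_of_real (D m ((x(j := t)) i))) has_vector_derivative
        (if j = i then complex_of_real (D (Suc m) (x i)) else 0)) (at (x j))" using True by simp
qed auto

lemma Ck_prod:
  assumes "finite A" "\<And>a. a \<in> A \<Longrightarrow> Ck n k (f a)"
  shows "Ck n k (\<lambda>x. \<Prod>a\<in>A. f a x)"
  using assms by (induction A rule: finite_induct) (auto intro: Ck_const Ck_mult)

lemma has_vd_aff:
  assumes "Ck n (Suc k) f" "i < n" "x \<in> Rn n"
  shows "((\<lambda>t. f (aff n s c (x(i := t)))) has_vector_derivative
      complex_of_real s * partial_deriv i f (aff n s c x)) (at (x i))"
proof -
  let ?y = "aff n s c x"
  have "((\<lambda>t. f (?y(i := t))) has_vector_derivative partial_deriv i f (?y(i := s * x i + c i))) (at (s * x i + c i))"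
    by (rule Ck_has_vd[OF assms(1,2)]) simp
  moreover have "?y(i := s * x i + c i) = ?y" using assms(2) by (auto simp: fun_eq_iff)
  ultimately have 1: "((\<lambda>t. f (?y(i := t))) has_vector_derivative partial_deriv i f ?y) (at (s * x i + c i))"
    by simp
  have 2: "((\<lambda>t. s * t + c i) has_vector_derivative s) (at (x i))"
    by (auto intro!: derivative_eq_intros)
  from vector_diff_chain_at[OF 2 1] show ?thesis
    using assms(2) by (simp add: o_def aff_upd scaleR_conv_of_real)
qed

lemma Ck_aff: "Ck n k f \<Longrightarrow> Ck n k (\<lambda>x. f (aff n s c x))"
proof (induction k arbitrary: f)
  have c: "continuous_on (Rn n) f \<Longrightarrow> continuous_on (Rn n) (\<lambda>x. f (aff n s c x))" for f :: "(nat \<Rightarrow> real) \<Rightarrow> complex"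
    by (rule continuous_on_compose2[OF _ continuous_on_aff], assumption, rule image_subsetI, rule aff_in_Rn)
  { case 0 then show ?case using c by simp }
  case (Suc k)
  show ?case
  proof (rule Ck_SucI[where F = "\<lambda>i x. complex_of_real s * partial_deriv i f (aff n s c x)"])
    show "continuous_on (Rn n) (\<lambda>x. f (aff n s c x))" by (rule c) (rule Ck_cont[OF Suc.prems])
    show "Ck n k (\<lambda>x. complex_of_real s * partial_deriv i f (aff n s c x))" if "i < n" for i
      using Suc.prems that by (intro Ck_mult Ck_const Suc.IH) auto
  qed (rule has_vd_aff[OF Suc.prems])
qed

lemma partial_deriv_aff:
  assumes "Csmooth n f" "i < n" "x \<in> Rn n"
  shows "partial_deriv i (\<lambda>x. f (aff n s c x)) x = s * partial_deriv i f (aff n s c x)"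
  by (rule partial_derivI(1), rule has_vd_aff[where k=0]) (use assms in \<open>auto simp only: Csmooth_def\<close>)

lemma partial_deriv_mult:
  assumes "Csmooth n f" "Csmooth n g" "i < n" "x \<in> Rn n"
  shows "partial_deriv i (\<lambda>x. f x * g x) x = f x * partial_deriv i g x + partial_deriv i f x * g x"
proof (rule partial_derivI(1))
  have "Ck n (Suc 0) f" "Ck n (Suc 0) g" using assms by (auto simp: Csmooth_def simp del: Ck.simps)
  from has_vector_derivative_mult[OF Ck_has_vd'[OF this(1) assms(3,4)] Ck_has_vd'[OF this(2) assms(3,4)]]
  show "((\<lambda>t. f (x(i := t)) * g (x(i := t))) has_vector_derivative
      f x * partial_deriv i g x + partial_deriv i f x * g x) (at (x i))"
    unfolding fun_upd_triv .
qed

lemma Csmooth_partial: "Csmooth n f \<Longrightarrow> i < n \<Longrightarrow> Csmooth n (partial_deriv i f)"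
  unfolding Csmooth_def using Ck.simps(2) by blast

lemma Csmooth_mult: "Csmooth n f \<Longrightarrow> Csmooth n g \<Longrightarrow> Csmooth n (\<lambda>x. f x * g x)"
  by (simp add: Csmooth_def Ck_mult)

lemma Csmooth_add: "Csmooth n f \<Longrightarrow> Csmooth n g \<Longrightarrow> Csmooth n (\<lambda>x. f x + g x)"
  by (simp add: Csmooth_def Ck_add)

lemma Csmooth_const: "Csmooth n (\<lambda>_. c)"
  by (simp add: Csmooth_def Ck_const)

lemma Csmooth_aff: "Csmooth n f \<Longrightarrow> Csmooth n (\<lambda>x. f (aff n s c x))"
  by (simp add: Csmooth_def Ck_aff)

lemma Csmooth_coord: "derivs D \<Longrightarrow> i < n \<Longrightarrow> Csmooth n (\<lambda>x. complex_of_real (D m (x i)))"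
  by (simp add: Csmooth_def Ck_coord)

lemma Csmooth_prod: "finite A \<Longrightarrow> (\<And>a. a \<in> A \<Longrightarrow> Csmooth n (f a)) \<Longrightarrow> Csmooth n (\<lambda>x. \<Prod>a\<in>A. f a x)"
  by (simp add: Csmooth_def Ck_prod)

lemma Csmooth_cont: "Csmooth n f \<Longrightarrow> continuous_on (Rn n) f"
  unfolding Csmooth_def using Ck_cont by blast

lemma Csmooth_measurable: "Csmooth n f \<Longrightarrow> f \<in> borel_measurable (leb n)"
  by (intro measurable_continuous_Rn Csmooth_cont)

lemma Csmooth_has_vd:
  assumes "Csmooth n f" "i < n" "x \<in> Rn n"
  shows "((\<lambda>t. f (x(i := t))) has_vector_derivative partial_deriv i f (x(i := t0))) (at t0)"
  using Ck_has_vd[of n 0 f, OF _ assms(2,3)] assms(1) unfolding Csmooth_def by blast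

section \<open>Test functions\<close>

abbreviation test :: "nat \<Rightarrow> ((nat \<Rightarrow> real) \<Rightarrow> complex) set" where
  "test n \<equiv> test_functions n (Rn n)"

text \<open>
  Compact support, with an explicit radius to be tracked through translations and
  convolutions. The condition is stated by coordinates since it is always applied at a point known to
  have one large coordinate.
\<close>

definition off_box :: "nat \<Rightarrow> real \<Rightarrow> ((nat \<Rightarrow> real) \<Rightarrow> complex) \<Rightarrow> bool" where
  "off_box n R f \<longleftrightarrow> (\<forall>x\<in>Rn n. (\<exists>i<n. \<bar>x i\<bar> > R) \<longrightarrow> f x = 0)"

text \<open>
  A compact subset of the carrier lies in a box, because the coordinate projections are continuous;
  conversely, closed boxes are compact by Tychonoff's theorem.
\<close>

lemma test_iff: "f \<in> test n \<longleftrightarrow> Csmooth n f \<and> (\<exists>R. off_box n R f)"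
proof
  assume f: "f \<in> test n"
  then obtain S where S: "compact S" "S \<subseteq> Rn n" "\<forall>x\<in>Rn n - S. f x = 0"
    by (auto simp: test_functions_def)
  from compact_subset_box[OF S(1,2)] obtain R where R: "S \<subseteq> box_n n R" by blast
  have "off_box n R f"
    unfolding off_box_def
  proof (intro ballI impI)
    fix x assume x: "x \<in> Rn n" "\<exists>i<n. R < \<bar>x i\<bar>"
    then have "x \<notin> box_n n R" unfolding box_n_iff by (meson not_le)
    with x(1) R S(3) show "f x = 0" by blast
  qed
  then show "Csmooth n f \<and> (\<exists>R. off_box n R f)"
    using f by (auto simp: test_functions_def Csmooth_def)
next
  assume "Csmooth n f \<and> (\<exists>R. off_box n R f)"
  then obtain R where f: "Csmooth n f" "off_box n R f" by blast
  have "f x = 0" if "x \<in> Rn n - box_n n R" for x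
  proof -
    have "x \<in> Rn n" "\<exists>i<n. R < \<bar>x i\<bar>" using that unfolding box_n_iff by (auto simp only: Diff_iff box_n_iff not_le not_all de_Morgan_conj)
    with f(2) show ?thesis unfolding off_box_def by blast
  qed
  moreover have "box_n n R \<subseteq> Rn n" unfolding subset_iff box_n_iff by blast
  ultimately show "f \<in> test n"
    using f(1) compact_box_n[of n R] unfolding test_functions_def Csmooth_def by blast
qed

lemma off_box_mono: "off_box n R f \<Longrightarrow> R \<le> R' \<Longrightarrow> off_box n R' f"
  unfolding off_box_def by (meson le_less_trans)

lemma off_box_partial:
  assumes "off_box n R f" "i < n"
  shows "off_box n R (partial_deriv i f)"
  unfolding off_box_def
proof (intro ballI impI)
  fix x assume x: "x \<in> Rn n" "\<exists>j<n. R < \<bar>x j\<bar>"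
  then obtain j where j: "j < n" "R < \<bar>x j\<bar>" by blast
  have "\<forall>\<^sub>F t in nhds (x i). R < \<bar>(x(i := t)) j\<bar>"
  proof (cases "j = i")
    case True
    have "open {t::real. R < \<bar>t\<bar>}" by (intro open_Collect_less continuous_intros)
    from eventually_nhds_in_open[OF this, of "x i"] show ?thesis using j True by simp
  qed (use j in simp)
  then have ev: "\<forall>\<^sub>F t in nhds (x i). f (x(i := t)) = 0"
  proof (rule eventually_mono)
    fix t assume "R < \<bar>(x(i := t)) j\<bar>"
    then show "f (x(i := t)) = 0"
      using assms(1) Rn_upd[OF x(1) assms(2)] j(1) unfolding off_box_def by blast
  qed
  have "((\<lambda>t. f (x(i := t))) has_vector_derivative 0) (at (x i))
      \<longleftrightarrow> ((\<lambda>t. 0::complex) has_vector_derivative 0) (at (x i))"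
    by (rule has_vector_derivative_cong_ev) (use ev eventually_nhds_x_imp_x[OF ev] in \<open>auto elim: eventually_mono\<close>)
  then show "partial_deriv i f x = 0" by (intro partial_derivI(1)) simp
qed

lemma test_partial: "f \<in> test n \<Longrightarrow> i < n \<Longrightarrow> partial_deriv i f \<in> test n"
  unfolding test_iff by (meson Csmooth_partial off_box_partial)

lemma test_mult: "Csmooth n g \<Longrightarrow> f \<in> test n \<Longrightarrow> (\<lambda>x. g x * f x) \<in> test n"
  unfolding test_iff by (auto simp: Csmooth_mult off_box_def)

lemma test_add: "f \<in> test n \<Longrightarrow> g \<in> test n \<Longrightarrow> (\<lambda>x. f x + g x) \<in> test n"
proof -
  assume "f \<in> test n" "g \<in> test n"
  then obtain R R' where *: "Csmooth n f" "Csmooth n g" "off_box n R f" "off_box n R' g"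
    unfolding test_iff by blast
  from off_box_mono[OF this(3), of "max R R'"] off_box_mono[OF this(4), of "max R R'"]
  have "off_box n (max R R') (\<lambda>x. f x + g x)" unfolding off_box_def by auto
  with * show ?thesis unfolding test_iff using Csmooth_add by blast
qed

lemma test_cmult: "f \<in> test n \<Longrightarrow> (\<lambda>x. c * f x) \<in> test n"
  using test_mult[OF Csmooth_const] .

lemma off_box_aff:
  assumes s: "s = 1 \<or> s = - 1" and f: "off_box n R f" and c: "\<And>i. i < n \<Longrightarrow> \<bar>c i\<bar> \<le> Q"
  shows "off_box n (R + Q) (\<lambda>x. f (aff n s c x))"
  unfolding off_box_def
proof (intro ballI impI)
  fix x assume "x \<in> Rn n" "\<exists>i<n. R + Q < \<bar>x i\<bar>"
  then obtain i where i: "i < n" "R + Q < \<bar>x i\<bar>" by blast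
  then have "R < \<bar>aff n s c x i\<bar>" using s c[OF i(1)] by auto
  with f i(1) aff_in_Rn[of n s c x] show "f (aff n s c x) = 0" unfolding off_box_def by blast
qed

lemma bound_finite: "\<exists>Q. \<forall>i<(n::nat). \<bar>c i :: real\<bar> \<le> Q"
proof (intro exI allI impI)
  fix i assume "i < n" then show "\<bar>c i\<bar> \<le> (\<Sum>i<n. \<bar>c i\<bar>)" by (intro member_le_sum) auto
qed

lemma test_aff: "s = 1 \<or> s = - 1 \<Longrightarrow> f \<in> test n \<Longrightarrow> (\<lambda>x. f (aff n s c x)) \<in> test n"
  unfolding test_iff using Csmooth_aff off_box_aff[of s n _ f c] bound_finite[of n c] by blast

lemma test_bounded:
  assumes "f \<in> test n"
  shows "\<exists>C\<ge>0. \<forall>x\<in>Rn n. norm (f x) \<le> C"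
proof -
  obtain R where R: "off_box n R f" and f: "Csmooth n f" using assms unfolding test_iff by blast
  have "box_n n R \<subseteq> Rn n" unfolding subset_iff box_n_iff by blast
  then have "compact (f ` box_n n R)"
    by (intro compact_continuous_image compact_box_n continuous_on_subset[OF Csmooth_cont[OF f]])
  from compact_imp_bounded[OF this] obtain C where C: "\<And>x. x \<in> box_n n R \<Longrightarrow> norm (f x) \<le> C"
    unfolding bounded_iff by auto
  have "norm (f x) \<le> max C 0" if x: "x \<in> Rn n" for x
  proof (cases "x \<in> box_n n R")
    case False
    then have "f x = 0" using x R unfolding box_n_iff off_box_def by (meson not_le)
    then show ?thesis by simp
  qed (use C in \<open>simp add: max.coboundedI1\<close>)
  then show ?thesis by (intro exI[of _ "max C 0"]) auto
qed

lemma test_measurable [measurable_dest]: "f \<in> test n \<Longrightarrow> f \<in> borel_measurable (leb n)"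
  unfolding test_iff using Csmooth_measurable by blast

section \<open>Square integrable functions\<close>

abbreviation L2 :: "nat \<Rightarrow> ((nat \<Rightarrow> real) \<Rightarrow> complex) set" where
  "L2 n \<equiv> Lp (leb n) 2"

abbreviation L2sq :: "nat \<Rightarrow> ((nat \<Rightarrow> real) \<Rightarrow> complex) \<Rightarrow> real" where
  "L2sq n f \<equiv> \<integral>x. (norm (f x))\<^sup>2 \<partial>leb n"

abbreviation L1norm :: "nat \<Rightarrow> ((nat \<Rightarrow> real) \<Rightarrow> complex) \<Rightarrow> real" where
  "L1norm n f \<equiv> \<integral>x. norm (f x) \<partial>leb n"

lemma L2_iff: "f \<in> L2 n \<longleftrightarrow> f \<in> borel_measurable (leb n) \<and> integrable (leb n) (\<lambda>x. (norm (f x))\<^sup>2)"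
  by (simp add: Lp_def)

lemma L2_measurable [measurable_dest]: "f \<in> L2 n \<Longrightarrow> f \<in> borel_measurable (leb n)"
  by (simp add: L2_iff)

lemma L1_iff: "f \<in> Lp (leb n) 1 \<longleftrightarrow> integrable (leb n) (f :: (nat \<Rightarrow> real) \<Rightarrow> complex)"
  by (auto simp: Lp_def integrable_norm_iff)

lemma norm_add_sq: "(norm (a + b :: complex))\<^sup>2 \<le> 2 * (norm a)\<^sup>2 + 2 * (norm b)\<^sup>2"
proof -
  have "(norm (a + b))\<^sup>2 \<le> (norm a + norm b)\<^sup>2" by (intro power_mono norm_triangle_ineq) auto
  also have "\<dots> \<le> 2 * (norm a)\<^sup>2 + 2 * (norm b)\<^sup>2"
    using zero_le_power2[of "norm a - norm b"] by (simp add: power2_eq_square algebra_simps)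
  finally show ?thesis .
qed

lemma norm_diff_sq: "(norm (a - b :: complex))\<^sup>2 \<le> 2 * (norm a)\<^sup>2 + 2 * (norm b)\<^sup>2"
  using norm_add_sq[of a "- b"] by simp

lemma L2_bound:
  assumes "f \<in> borel_measurable (leb n)" "integrable (leb n) g" "AE x in leb n. (norm (f x))\<^sup>2 \<le> g x"
  shows "f \<in> L2 n"
  unfolding L2_iff
  by (intro conjI assms(1) Bochner_Integration.integrable_bound[OF assms(2)]) (use assms in \<open>auto elim: AE_mp\<close>)

lemma L2_add: "f \<in> L2 n \<Longrightarrow> g \<in> L2 n \<Longrightarrow> (\<lambda>x. f x + g x) \<in> L2 n"
  by (rule L2_bound[of _ _ "\<lambda>x. 2 * (norm (f x))\<^sup>2 + 2 * (norm (g x))\<^sup>2"])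
     (auto simp: L2_iff norm_add_sq)

lemma L2_diff: "f \<in> L2 n \<Longrightarrow> g \<in> L2 n \<Longrightarrow> (\<lambda>x. f x - g x) \<in> L2 n"
  by (rule L2_bound[of _ _ "\<lambda>x. 2 * (norm (f x))\<^sup>2 + 2 * (norm (g x))\<^sup>2"])
     (auto simp: L2_iff norm_diff_sq)

lemma L2_mult:
  assumes h: "h \<in> borel_measurable (leb n)" "\<And>x. x \<in> Rn n \<Longrightarrow> norm (h x) \<le> C" and f: "f \<in> L2 n"
  shows "(\<lambda>x. h x * f x) \<in> L2 n"
proof (rule L2_bound[of _ _ "\<lambda>x. C\<^sup>2 * (norm (f x))\<^sup>2"])
  show "AE x in leb n. (norm (h x * f x))\<^sup>2 \<le> C\<^sup>2 * (norm (f x))\<^sup>2"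
    using h(2) by (intro AE_I2) (auto simp: norm_mult power_mult_distrib intro!: mult_right_mono power_mono)
qed (use h f in \<open>auto simp: L2_iff\<close>)

lemma L2_cnj: "f \<in> L2 n \<Longrightarrow> (\<lambda>x. cnj (f x)) \<in> L2 n"
proof -
  have "cnj \<in> borel_measurable borel" by (intro borel_measurable_continuous_onI continuous_intros)
  then show "f \<in> L2 n \<Longrightarrow> (\<lambda>x. cnj (f x)) \<in> L2 n" by (auto simp: L2_iff)
qed

lemma L2_cmult: "f \<in> L2 n \<Longrightarrow> (\<lambda>x. c * f x) \<in> L2 n"
  by (rule L2_mult[of _ _ "norm c"]) auto

lemma mult_le_sq: "x * y \<le> x\<^sup>2 + (y::real)\<^sup>2"
  using zero_le_power2[of "x - y"] zero_le_power2[of "x + y"] by (simp add: power2_eq_square algebra_simps)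

lemma L2_prod_integrable:
  assumes "f \<in> L2 n" "g \<in> L2 n" shows "integrable (leb n) (\<lambda>x. f x * g x)"
proof (rule Bochner_Integration.integrable_bound[of _ "\<lambda>x. (norm (f x))\<^sup>2 + (norm (g x))\<^sup>2"])
  show "AE x in leb n. norm (f x * g x) \<le> norm ((norm (f x))\<^sup>2 + (norm (g x))\<^sup>2)"
    using mult_le_sq by (intro AE_I2) (simp add: norm_mult)
qed (use assms in \<open>auto simp: L2_iff\<close>)

text \<open>
  The class of functions that can be convolved with test functions. Besides \<open>L\<^sup>1\<close> and \<open>L\<^sup>2\<close> it contains the constants,
  whose convolutions yield integration by parts.
\<close>

definition loc_int :: "nat \<Rightarrow> ((nat \<Rightarrow> real) \<Rightarrow> complex) \<Rightarrow> bool" where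
  "loc_int n w \<longleftrightarrow> w \<in> borel_measurable (leb n) \<and>
     (\<forall>R. integrable (leb n) (\<lambda>x. indicator (box_n n R) x * norm (w x)))"

lemma integrable_box: "integrable (leb n) (indicator (box_n n R) :: _ \<Rightarrow> real)"
  using emeasure_box_n[of n R] by (intro integrable_real_indicator) auto

lemma L2_loc_int: "w \<in> L2 n \<Longrightarrow> loc_int n w"
  unfolding loc_int_def
proof (intro conjI allI)
  fix R assume w: "w \<in> L2 n"
  show "integrable (leb n) (\<lambda>x. indicator (box_n n R) x * norm (w x))"
  proof (rule Bochner_Integration.integrable_bound)
    show "integrable (leb n) (\<lambda>x. (indicator (box_n n R) x :: real) + (norm (w x))\<^sup>2)"
      using w integrable_box by (auto simp: L2_iff)
    show "AE x in leb n. norm (indicator (box_n n R) x * norm (w x))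
        \<le> norm ((indicator (box_n n R) x :: real) + (norm (w x))\<^sup>2)"
      using mult_le_sq[of 1 "norm (w _)"] by (intro AE_I2) (auto simp: indicator_def simp del: PiE_iff)
  qed (use w in measurable)
qed (simp add: L2_iff)

lemma loc_int_const: "loc_int n (\<lambda>_. c)"
  unfolding loc_int_def using integrable_box by auto

text \<open>
  The dominating function for all limits under the convolution integral: it depends on \<open>x\<close> only through a
  bound \<open>Q\<close> for its coordinates.
\<close>

lemma off_box_dominated:
  assumes "off_box n R k" "\<forall>x\<in>Rn n. norm (k x) \<le> C" "0 \<le> C" "\<forall>i<n. \<bar>x i\<bar> \<le> Q" "y \<in> Rn n"
  shows "norm (w y * k (aff n (- 1) x y)) \<le> C * (indicator (box_n n (R + Q)) y * norm (w y))"
proof (cases "y \<in> box_n n (R + Q)")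
  case True
  have "norm (w y * k (aff n (- 1) x y)) \<le> norm (w y) * C"
    unfolding norm_mult using assms(2) aff_in_Rn[of n "- 1" x y] by (intro mult_left_mono) auto
  with True show ?thesis by (simp add: mult.commute)
next
  case False
  then have "\<exists>i<n. R + Q < \<bar>y i\<bar>" using assms(5) unfolding box_n_iff by (meson not_le)
  with off_box_aff[of "- 1" n R k x Q] assms have "k (aff n (- 1) x y) = 0"
    unfolding off_box_def by simp
  then show ?thesis using assms(3) by simp
qed

lemma test_loc_int_integrable:
  assumes w: "loc_int n w" and k: "k \<in> test n"
  shows "integrable (leb n) (\<lambda>y. w y * k (aff n (- 1) x y))"
proof -
  obtain R C Q where R: "off_box n R k" "\<forall>x\<in>Rn n. norm (k x) \<le> C" "0 \<le> C" "\<forall>i<n. \<bar>x i\<bar> \<le> Q"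
    using k test_bounded[OF k] bound_finite[of n x] unfolding test_iff by blast
  have [measurable]: "w \<in> borel_measurable (leb n)" "k \<in> borel_measurable (leb n)"
    using w k test_measurable by (auto simp: loc_int_def)
  show ?thesis
  proof (rule Bochner_Integration.integrable_bound)
    show "integrable (leb n) (\<lambda>y. C * (indicator (box_n n (R + Q)) y * norm (w y)))"
      using w unfolding loc_int_def by (intro integrable_mult_right) blast
    show "AE y in leb n. norm (w y * k (aff n (- 1) x y)) \<le> norm (C * (indicator (box_n n (R + Q)) y * norm (w y)))"
      by (intro AE_I2 order.trans[OF off_box_dominated[OF R]]) auto
  qed measurable
qed

lemma L2_test: assumes k: "k \<in> test n" shows "k \<in> L2 n"
proof -
  obtain R C where R: "off_box n R k" "\<forall>x\<in>Rn n. norm (k x) \<le> C" "0 \<le> C"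
    using k test_bounded[OF k] unfolding test_iff by blast
  show ?thesis
  proof (rule L2_bound[of _ _ "\<lambda>x. C\<^sup>2 * indicator (box_n n R) x"])
    have "(norm (k x))\<^sup>2 \<le> C\<^sup>2 * indicator (box_n n R) x" if x: "x \<in> Rn n" for x
    proof (cases "x \<in> box_n n R")
      case True
      then show ?thesis using R(2) x by (simp add: power_mono del: PiE_iff)
    next
      case False
      then have "k x = 0" using x R unfolding box_n_iff off_box_def by (meson not_le)
      then show ?thesis by simp
    qed
    then show "AE x in leb n. (norm (k x))\<^sup>2 \<le> C\<^sup>2 * indicator (box_n n R) x" by (intro AE_I2) simp
  qed (use k test_measurable integrable_box in auto)
qed

lemma loc_int_test_integrable:
  assumes w: "loc_int n w" and k: "k \<in> test n"
  shows "integrable (leb n) (\<lambda>y. w y * k y)"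
proof -
  have "integrable (leb n) (\<lambda>y. w y * (\<lambda>x. k (aff n (- 1) (\<lambda>_. 0) x)) (aff n (- 1) (\<lambda>_. 0) y))"
    by (rule test_loc_int_integrable[OF w test_aff]) (use k in auto)
  moreover have "aff n (- 1) (\<lambda>_. 0) (aff n (- 1) (\<lambda>_. 0) y) = y" if "y \<in> Rn n" for y
    by (rule Rn_eqI[OF aff_in_Rn that]) simp
  ultimately show ?thesis
    by (subst Bochner_Integration.integrable_cong[OF refl, where g = "\<lambda>y. w y * k (aff n (- 1) (\<lambda>_. 0) (aff n (- 1) (\<lambda>_. 0) y))"]) simp_all
qed

section \<open>Differentiation under the integral\<close>

lemma vector_derivative_bound:
  fixes f :: "real \<Rightarrow> complex"
  assumes "convex S" "\<And>t. t \<in> S \<Longrightarrow> (f has_vector_derivative f' t) (at t)" "\<And>t. t \<in> S \<Longrightarrow> norm (f' t) \<le> B"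
    and "a \<in> S" "b \<in> S"
  shows "norm (f b - f a) \<le> B * \<bar>b - a\<bar>"
proof -
  have "norm (f b - f a) \<le> B * norm (b - a)"
  proof (rule differentiable_bound[OF assms(1)])
    show "(f has_derivative (\<lambda>h. h *\<^sub>R f' t)) (at t within S)" if "t \<in> S" for t
      using assms(2)[OF that] has_derivative_at_withinI unfolding has_vector_derivative_def by blast
    show "onorm (\<lambda>h. h *\<^sub>R f' t) \<le> B" if "t \<in> S" for t
    proof (rule onorm_bound)
      show "0 \<le> B" using assms(3)[OF that] norm_ge_zero order_trans by blast
      show "norm (h *\<^sub>R f' t) \<le> B * norm h" for h
        using mult_right_mono[OF assms(3)[OF that], of "norm h"] by (simp add: mult.commute)
    qed
  qed (use assms in auto)
  then show ?thesis by simp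
qed

text \<open>
  Dominated convergence for the difference quotients along an arbitrary sequence; the mean value
  inequality provides the dominating function \<open>2 G\<close>.
\<close>

lemma has_vector_derivative_integral:
  fixes f :: "real \<Rightarrow> 'a \<Rightarrow> complex"
  assumes int: "\<And>t. integrable M (f t)"
    and der: "\<And>t y. y \<in> space M \<Longrightarrow> ((\<lambda>t. f t y) has_vector_derivative f' t y) (at t)"
    and m: "f' t0 \<in> borel_measurable M"
    and G: "integrable M G" "\<And>t y. \<bar>t - t0\<bar> < 1 \<Longrightarrow> y \<in> space M \<Longrightarrow> norm (f' t y) \<le> G y"
  shows "((\<lambda>t. \<integral>y. f t y \<partial>M) has_vector_derivative (\<integral>y. f' t0 y \<partial>M)) (at t0)"
proof -
  have int': "integrable M (f' t0)"
    by (rule Bochner_Integration.integrable_bound[OF G(1) m]) (use G(2)[of t0] in \<open>force intro!: AE_I2\<close>)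
  let ?q = "\<lambda>t y. (f t y - f t0 y - (t - t0) *\<^sub>R f' t0 y) /\<^sub>R norm (t - t0)"
  have "((\<lambda>t. \<integral>y. ?q t y \<partial>M) \<longlongrightarrow> 0) (at t0)"
  proof (subst tendsto_at_iff_sequentially, intro allI impI, unfold o_def)
    fix X :: "nat \<Rightarrow> real" assume X: "\<forall>i. X i \<in> UNIV - {t0}" "X \<longlonglongrightarrow> t0"
    then obtain N where N: "\<And>j. j \<ge> N \<Longrightarrow> \<bar>X j - t0\<bar> < 1"
      unfolding LIMSEQ_iff by (metis real_norm_def zero_less_one)
    have "(\<lambda>j. \<integral>y. ?q (X (j + N)) y \<partial>M) \<longlonglongrightarrow> (\<integral>y. 0 \<partial>M)"
    proof (rule integral_dominated_convergence[where w = "\<lambda>y. 2 * G y"])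
      show "AE y in M. (\<lambda>j. ?q (X (j + N)) y) \<longlonglongrightarrow> 0"
      proof (rule AE_I2)
        fix y assume y: "y \<in> space M"
        have "((\<lambda>t. ?q t y) \<longlongrightarrow> 0) (at t0)"
          using der[OF y, of t0] unfolding has_vector_derivative_def has_derivative_at_within by simp
        then have "(\<lambda>j. ?q (X j) y) \<longlonglongrightarrow> 0"
          using X unfolding tendsto_at_iff_sequentially o_def by blast
        then show "(\<lambda>j. ?q (X (j + N)) y) \<longlonglongrightarrow> 0" by (rule LIMSEQ_ignore_initial_segment)
      qed
      show "AE y in M. norm (?q (X (j + N)) y) \<le> 2 * G y" for j
      proof (rule AE_I2)
        fix y assume y: "y \<in> space M"
        let ?t = "X (j + N)"
        have d: "\<bar>?t - t0\<bar> < 1" "?t \<noteq> t0" using N X by auto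
        have "norm (f ?t y - f t0 y) \<le> G y * \<bar>?t - t0\<bar>"
          using d by (intro vector_derivative_bound[where S = "ball t0 1" and f' = "\<lambda>t. f' t y"] der[OF y] G(2)[OF _ y])
             (auto simp: dist_real_def abs_minus_commute)
        moreover have "norm ((?t - t0) *\<^sub>R f' t0 y) \<le> G y * \<bar>?t - t0\<bar>"
          using mult_right_mono[OF G(2)[of t0 y], of "\<bar>?t - t0\<bar>"] y by (simp add: mult.commute)
        ultimately have "norm (f ?t y - f t0 y - (?t - t0) *\<^sub>R f' t0 y) \<le> 2 * G y * \<bar>?t - t0\<bar>"
          using norm_triangle_ineq4[of "f ?t y - f t0 y" "(?t - t0) *\<^sub>R f' t0 y"] by linarith
        moreover have "norm (?q ?t y) = norm (f ?t y - f t0 y - (?t - t0) *\<^sub>R f' t0 y) / \<bar>?t - t0\<bar>"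
          by (simp add: divide_inverse_commute)
        ultimately show "norm (?q ?t y) \<le> 2 * G y" using d by (simp add: pos_divide_le_eq)
      qed
      show "?q (X (j + N)) \<in> borel_measurable M" for j
        using int[THEN borel_measurable_integrable] m by measurable
    qed (use G in auto)
    then have "(\<lambda>j. \<integral>y. ?q (X (j + N)) y \<partial>M) \<longlonglongrightarrow> 0" by simp
    then show "(\<lambda>j. \<integral>y. ?q (X j) y \<partial>M) \<longlonglongrightarrow> 0" by (rule LIMSEQ_offset)
  qed
  then have "((\<lambda>t. ((\<integral>y. f t y \<partial>M) - (\<integral>y. f t0 y \<partial>M) - (t - t0) *\<^sub>R (\<integral>y. f' t0 y \<partial>M)) /\<^sub>R norm (t - t0)) \<longlongrightarrow> 0) (at t0)"
    using int int' by simp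
  then show ?thesis
    unfolding has_vector_derivative_def has_derivative_at_within by (simp add: bounded_linear_scaleR_left)
qed

section \<open>Convolution with test functions\<close>

definition conv :: "nat \<Rightarrow> ((nat \<Rightarrow> real) \<Rightarrow> complex) \<Rightarrow> ((nat \<Rightarrow> real) \<Rightarrow> complex) \<Rightarrow> (nat \<Rightarrow> real) \<Rightarrow> complex" where
  "conv n k w x = (\<integral>y. w y * k (aff n (- 1) x y) \<partial>leb n)"

lemma convergent_Rn_bounded:
  assumes "u \<longlonglongrightarrow> (a :: nat \<Rightarrow> real)"
  shows "\<exists>Q. \<forall>j. \<forall>i<n. \<bar>u j i\<bar> \<le> Q"
proof -
  have "(\<lambda>j. u j i) \<longlonglongrightarrow> a i" for i
  proof -
    have "continuous_on UNIV (\<lambda>x::nat \<Rightarrow> real. x i)" by simp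
    from continuous_on_tendsto_compose[OF this assms] show ?thesis by simp
  qed
  then have "Bseq (\<lambda>j. u j i)" for i
    using convergent_imp_Bseq convergentI by blast
  then have "\<exists>r. \<forall>j. \<bar>u j i\<bar> \<le> r" for i
    unfolding Bseq_def real_norm_def by blast
  then obtain r where r: "\<And>i j. \<bar>u j i\<bar> \<le> r i" by metis
  obtain Q where "\<forall>i<n. \<bar>r i\<bar> \<le> Q" using bound_finite by blast
  moreover have "\<bar>u j i\<bar> \<le> \<bar>r i\<bar>" for i j using r[of j i] by linarith
  ultimately show ?thesis using order_trans by blast
qed

lemma continuous_on_conv:
  assumes w: "loc_int n w" and k: "k \<in> test n"
  shows "continuous_on (Rn n) (conv n k w)"
proof (rule continuous_on_sequentiallyI)
  fix u and a :: "nat \<Rightarrow> real"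
  assume u: "\<forall>j. u j \<in> Rn n" "a \<in> Rn n" "u \<longlonglongrightarrow> a"
  obtain R C where R: "off_box n R k" "\<forall>x\<in>Rn n. norm (k x) \<le> C" "0 \<le> C"
    using k test_bounded[OF k] unfolding test_iff by blast
  obtain Q where Q: "\<forall>j. \<forall>i<n. \<bar>u j i\<bar> \<le> Q" using convergent_Rn_bounded[OF u(3)] by blast
  have [measurable]: "w \<in> borel_measurable (leb n)" "k \<in> borel_measurable (leb n)"
    using w k test_measurable by (auto simp: loc_int_def)
  show "(\<lambda>j. conv n k w (u j)) \<longlonglongrightarrow> conv n k w a"
    unfolding conv_def
  proof (rule integral_dominated_convergence)
    show "integrable (leb n) (\<lambda>y. C * (indicator (box_n n (R + Q)) y * norm (w y)))"
      using w unfolding loc_int_def by (intro integrable_mult_right) blast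
    show "AE y in leb n. norm (w y * k (aff n (- 1) (u j) y)) \<le> C * (indicator (box_n n (R + Q)) y * norm (w y))" for j
      using Q by (intro AE_I2 off_box_dominated[OF R]) auto
    show "AE y in leb n. (\<lambda>j. w y * k (aff n (- 1) (u j) y)) \<longlonglongrightarrow> w y * k (aff n (- 1) a y)"
    proof (intro AE_I2 tendsto_mult tendsto_const)
      fix y
      have "continuous_on UNIV (\<lambda>x. aff n (- 1) x y)"
      proof (rule continuous_on_coordinatewise_then_product)
        fix i
        have "continuous_on UNIV (\<lambda>x::nat \<Rightarrow> real. x i + - 1 * y i)" by (rule continuous_on_add) simp_all
        then show "continuous_on UNIV (\<lambda>x. aff n (- 1) x y i)"
          by (cases "i < n") (simp_all add: aff_def)
      qed
      then have c: "continuous_on (Rn n) (\<lambda>x. aff n (- 1) x y)" by (rule continuous_on_subset) simp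
      have "Csmooth n k" using k by (simp add: test_iff)
      have "(\<lambda>x. aff n (- 1) x y) ` Rn n \<subseteq> Rn n" by (rule image_subsetI, rule aff_in_Rn)
      from continuous_on_compose2[OF Csmooth_cont[OF \<open>Csmooth n k\<close>] c this]
      have kc: "continuous_on (Rn n) (\<lambda>x. k (aff n (- 1) x y))" .
      have "\<forall>\<^sub>F j in sequentially. u j \<in> Rn n" by (rule always_eventually) (use u(1) in blast)
      from continuous_on_tendsto_compose[OF kc u(3,2) this]
      show "(\<lambda>j. k (aff n (- 1) (u j) y)) \<longlonglongrightarrow> k (aff n (- 1) a y)" .
    qed
  qed measurable
qed

lemma aff_upd_shift: "i < n \<Longrightarrow> aff n s (x(i := t)) y = (aff n s x y)(i := s * y i + t)"
  by (auto simp: aff_def fun_eq_iff)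

lemma conv_has_vd:
  assumes w: "loc_int n w" and k: "k \<in> test n" and i: "i < n" and x: "x \<in> Rn n"
  shows "((\<lambda>t. conv n k w (x(i := t))) has_vector_derivative conv n (partial_deriv i k) w (x(i := t0))) (at t0)"
proof -
  have k': "partial_deriv i k \<in> test n" by (rule test_partial[OF k i])
  obtain R C where R: "off_box n R (partial_deriv i k)" "\<forall>x\<in>Rn n. norm (partial_deriv i k x) \<le> C" "0 \<le> C"
    using k' test_bounded[OF k'] unfolding test_iff by blast
  obtain Q where Q: "\<forall>i<n. \<bar>x i\<bar> \<le> Q" using bound_finite by blast
  define Q' where "Q' = max Q (\<bar>t0\<bar> + 1)"
  have [measurable]: "w \<in> borel_measurable (leb n)" "partial_deriv i k \<in> borel_measurable (leb n)"
    using w k' test_measurable by (auto simp: loc_int_def)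
  show ?thesis unfolding conv_def
  proof (rule has_vector_derivative_integral)
    show "integrable (leb n) (\<lambda>y. C * (indicator (box_n n (R + Q')) y * norm (w y)))"
      using w unfolding loc_int_def by (intro integrable_mult_right) blast
    show "norm (w y * partial_deriv i k (aff n (- 1) (x(i := t)) y)) \<le> C * (indicator (box_n n (R + Q')) y * norm (w y))"
      if t: "\<bar>t - t0\<bar> < 1" and y: "y \<in> space (leb n)" for t y
    proof (rule off_box_dominated[OF R])
      show "\<forall>j<n. \<bar>(x(i := t)) j\<bar> \<le> Q'"
        using Q t by (auto simp: Q'_def max_def)
    qed (use y in simp)
    show "integrable (leb n) (\<lambda>y. w y * k (aff n (- 1) (x(i := t)) y))" for t
      by (rule test_loc_int_integrable[OF w k])
    show "((\<lambda>t. w y * k (aff n (- 1) (x(i := t)) y)) has_vector_derivative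
        w y * partial_deriv i k (aff n (- 1) (x(i := t)) y)) (at t)" for t y
    proof -
      let ?z = "aff n (- 1) x y"
      have "((\<lambda>t. k (?z(i := t))) has_vector_derivative partial_deriv i k (?z(i := - y i + t))) (at (- y i + t))"
        using k by (intro Csmooth_has_vd[OF _ i]) (auto simp: test_iff)
      moreover have "((\<lambda>t. - y i + t) has_vector_derivative 1) (at t)"
        by (auto intro!: derivative_eq_intros)
      ultimately have "((\<lambda>t. k (?z(i := - y i + t))) has_vector_derivative partial_deriv i k (?z(i := - y i + t))) (at t)"
        using vector_diff_chain_at[of "\<lambda>t. - y i + t" 1 t "\<lambda>t. k (?z(i := t))"] by (simp add: o_def)
      then show ?thesis
        using i by (simp add: aff_upd_shift has_vector_derivative_mult_right)
    qed
  qed measurable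
qed

lemma Csmooth_conv:
  assumes w: "loc_int n w" and k: "k \<in> test n"
  shows "Csmooth n (conv n k w)"
  unfolding Csmooth_def
proof
  fix m show "Ck n m (conv n k w)" using k
  proof (induction m arbitrary: k)
    case 0 then show ?case using continuous_on_conv[OF w] by simp
  next
    case (Suc m)
    show ?case
    proof (rule Ck_SucI[where F = "\<lambda>i. conv n (partial_deriv i k) w"])
      show "((\<lambda>t. conv n k w (x(i := t))) has_vector_derivative conv n (partial_deriv i k) w x) (at (x i))"
        if "i < n" "x \<in> Rn n" for i x
        using conv_has_vd[OF w Suc.prems that, of "x i"] unfolding fun_upd_triv .
    qed (use Suc test_partial continuous_on_conv[OF w] in auto)
  qed
qed

lemma partial_deriv_conv:
  assumes w: "loc_int n w" and k: "k \<in> test n" and i: "i < n" "x \<in> Rn n"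
  shows "partial_deriv i (conv n k w) x = conv n (partial_deriv i k) w x"
  using conv_has_vd[OF assms, of "x i"] unfolding fun_upd_triv by (intro partial_derivI(1))

text \<open>
  For fixed \<open>x\<close> the function \<open>y \<mapsto> k (x - y)\<close> is itself a test function, with \<open>i\<close>-th derivative
  \<open>- (\<partial>\<^sub>i k) (x - y)\<close>. Hence a derivative that falls on the kernel can be moved to the weakly
  differentiable factor.
\<close>

lemma partial_deriv_conv_weak:
  assumes w: "loc_int n w" and k: "k \<in> test n" and i: "i < n" "x \<in> Rn n" and g: "weak_partial n i w g"
  shows "partial_deriv i (conv n k w) x = conv n k g x"
proof -
  have t: "(\<lambda>y. k (aff n (- 1) x y)) \<in> test n" by (rule test_aff[OF _ k]) simp
  have "(\<integral>y. w y * partial_deriv i (\<lambda>y. k (aff n (- 1) x y)) y \<partial>leb n) = - (\<integral>y. g y * k (aff n (- 1) x y) \<partial>leb n)"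
    using g t unfolding weak_partial_def by blast
  moreover have "(\<integral>y. w y * partial_deriv i (\<lambda>y. k (aff n (- 1) x y)) y \<partial>leb n)
      = (\<integral>y. - (w y * partial_deriv i k (aff n (- 1) x y)) \<partial>leb n)"
    using k i by (intro Bochner_Integration.integral_cong) (auto simp: partial_deriv_aff test_iff)
  ultimately show ?thesis
    unfolding partial_deriv_conv[OF w k i] by (simp add: conv_def)
qed

lemma integral_test_reflect: "(\<integral>y. f (aff n (- 1) x y) \<partial>leb n) = (\<integral>y. f y \<partial>leb n)"
  if "f \<in> borel_measurable (leb n)" for f :: "(nat \<Rightarrow> real) \<Rightarrow> complex"
  using that by (intro integral_aff) auto

text \<open>
  Convolving with the constant \<open>1\<close> gives a constant function, whose derivative is the integral of
  \<open>\<partial>\<^sub>i k\<close>.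
\<close>

lemma integral_partial_deriv_test:
  assumes k: "k \<in> test n" and i: "i < n"
  shows "(\<integral>y. partial_deriv i k y \<partial>leb n) = 0"
proof -
  let ?x = "\<lambda>i\<in>{..<n}. 0 :: real"
  have x: "?x \<in> Rn n" by simp
  have 1: "conv n f (\<lambda>_. 1) x = (\<integral>y. f y \<partial>leb n)" if "f \<in> test n" for f x
    using integral_test_reflect[OF test_measurable[OF that]] by (simp add: conv_def)
  have "((\<lambda>t. conv n k (\<lambda>_. 1) (?x(i := t))) has_vector_derivative conv n (partial_deriv i k) (\<lambda>_. 1) (?x(i := 0))) (at 0)"
    by (rule conv_has_vd[OF loc_int_const k i x])
  then have "((\<lambda>t::real. \<integral>y. k y \<partial>leb n) has_vector_derivative (\<integral>y. partial_deriv i k y \<partial>leb n)) (at 0)"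
    unfolding 1[OF k] 1[OF test_partial[OF k i]] .
  moreover have "((\<lambda>t::real. \<integral>y. k y \<partial>leb n) has_vector_derivative 0) (at 0)" by simp
  ultimately show ?thesis by (rule vector_derivative_unique_at)
qed

lemma weak_partial_smooth:
  assumes f: "Csmooth n f" and i: "i < n"
  shows "weak_partial n i f (partial_deriv i f)"
  unfolding weak_partial_def
proof
  fix \<psi> assume p: "\<psi> \<in> test n"
  have s: "Csmooth n \<psi>" using p by (simp add: test_iff)
  have "(\<integral>y. partial_deriv i (\<lambda>x. f x * \<psi> x) y \<partial>leb n) = 0"
    by (rule integral_partial_deriv_test[OF test_mult[OF f p] i])
  moreover have "(\<integral>y. partial_deriv i (\<lambda>x. f x * \<psi> x) y \<partial>leb n)
      = (\<integral>y. f y * partial_deriv i \<psi> y + partial_deriv i f y * \<psi> y \<partial>leb n)"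
    using f s i by (intro Bochner_Integration.integral_cong) (auto simp: partial_deriv_mult)
  moreover have "integrable (leb n) (\<lambda>y. f y * partial_deriv i \<psi> y)" "integrable (leb n) (\<lambda>y. partial_deriv i f y * \<psi> y)"
    using loc_int_test_integrable[OF loc_int_const[of n 1] test_mult[OF f test_partial[OF p i]]]
      loc_int_test_integrable[OF loc_int_const[of n 1] test_mult[OF Csmooth_partial[OF f i] p]] by simp_all
  ultimately show "(\<integral>x. f x * partial_deriv i \<psi> x \<partial>leb n) = - (\<integral>x. partial_deriv i f x * \<psi> x \<partial>leb n)"
    by (simp add: add_eq_0_iff2)
qed

section \<open>Density of test functions\<close>

text \<open>
  Membership in the closure of the test functions in \<open>L\<^sup>2\<close>. Since the whole of \<open>L\<^sup>2\<close> turns out to have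
  the property, it serves only to organise the induction that proves this.
\<close>

definition test_limit :: "nat \<Rightarrow> ((nat \<Rightarrow> real) \<Rightarrow> complex) \<Rightarrow> bool" where
  "test_limit n w \<longleftrightarrow> w \<in> L2 n \<and> (\<forall>e>0. \<exists>\<psi>\<in>test n. L2sq n (\<lambda>x. w x - \<psi> x) < e)"

lemma L2_integrable: "f \<in> L2 n \<Longrightarrow> integrable (leb n) (\<lambda>x. (norm (f x))\<^sup>2)"
  by (simp add: L2_iff)

lemma L2_integral_add_le:
  assumes "f \<in> L2 n" "g \<in> L2 n"
  shows "L2sq n (\<lambda>x. f x + g x) \<le> 2 * L2sq n f + 2 * L2sq n g"
proof -
  have "L2sq n (\<lambda>x. f x + g x) \<le> (\<integral>x. 2 * (norm (f x))\<^sup>2 + 2 * (norm (g x))\<^sup>2 \<partial>leb n)"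
    by (rule integral_mono[OF L2_integrable[OF L2_add[OF assms]] _ norm_add_sq])
       (use assms[THEN L2_integrable] in simp)
  also have "\<dots> = 2 * L2sq n f + 2 * L2sq n g"
    using assms[THEN L2_integrable] by simp
  finally show ?thesis .
qed

lemma test_zero: "(\<lambda>_. 0) \<in> test n"
  unfolding test_iff by (auto simp: Csmooth_const off_box_def)

lemma test_limit_closed:
  assumes w: "w \<in> L2 n" and v: "\<And>j. test_limit n (v j)"
    and lim: "(\<lambda>j. L2sq n (\<lambda>x. w x - v j x)) \<longlonglongrightarrow> 0"
  shows "test_limit n w"
  unfolding test_limit_def
proof (intro conjI w allI impI)
  fix e :: real assume e: "e > 0"
  then have "\<forall>\<^sub>F j in sequentially. (L2sq n (\<lambda>x. w x - v j x)) < e / 4"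
    using lim by (intro order_tendstoD(2)) auto
  then obtain j where j: "L2sq n (\<lambda>x. w x - v j x) < e / 4"
    using eventually_happens by force
  obtain \<psi> where p: "\<psi> \<in> test n" "L2sq n (\<lambda>x. v j x - \<psi> x) < e / 4"
    using v[of j] e unfolding test_limit_def by (meson zero_less_divide_iff zero_less_numeral)
  have "v j \<in> L2 n" using v by (simp add: test_limit_def)
  then have "L2sq n (\<lambda>x. w x - v j x + (v j x - \<psi> x)) < e"
    using L2_integral_add_le[of "\<lambda>x. w x - v j x" n "\<lambda>x. v j x - \<psi> x"] w p j L2_test[OF p(1)]
    by (simp add: L2_diff)
  with p(1) show "\<exists>\<psi>\<in>test n. L2sq n (\<lambda>x. w x - \<psi> x) < e" by auto
qed

lemma test_limit_zero: "test_limit n (\<lambda>_. 0)"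
  unfolding test_limit_def using L2_test[OF test_zero] test_zero by force

lemma test_limit_add:
  assumes "test_limit n v" "test_limit n w" shows "test_limit n (\<lambda>x. v x + w x)"
  unfolding test_limit_def
proof (intro conjI allI impI)
  have L: "v \<in> L2 n" "w \<in> L2 n" using assms by (auto simp: test_limit_def)
  then show "(\<lambda>x. v x + w x) \<in> L2 n" by (rule L2_add)
  fix e :: real assume "e > 0"
  then have "e / 4 > 0" by simp
  then obtain f g where f: "f \<in> test n" "L2sq n (\<lambda>x. v x - f x) < e / 4"
    and g: "g \<in> test n" "L2sq n (\<lambda>x. w x - g x) < e / 4"
    using assms unfolding test_limit_def by meson
  have "L2sq n (\<lambda>x. v x - f x + (w x - g x)) < e"
    using L2_integral_add_le[of "\<lambda>x. v x - f x" n "\<lambda>x. w x - g x"] f g L2_test L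
    by (simp add: L2_diff)
  then show "\<exists>\<psi>\<in>test n. L2sq n (\<lambda>x. v x + w x - \<psi> x) < e"
    using test_add[OF f(1) g(1)] by (intro bexI[of _ "\<lambda>x. f x + g x"]) (simp_all add: algebra_simps)
qed

lemma test_limit_cmult:
  assumes "test_limit n v" shows "test_limit n (\<lambda>x. c * v x)"
proof (cases "c = 0")
  case True then show ?thesis using test_limit_zero by simp
next
  case False
  show ?thesis
    unfolding test_limit_def
  proof (intro conjI allI impI)
    show "(\<lambda>x. c * v x) \<in> L2 n" using assms by (intro L2_cmult) (simp add: test_limit_def)
    fix e :: real assume "e > 0"
    then have "e / (norm c)\<^sup>2 > 0" using False by simp
    then obtain f where f: "f \<in> test n" "L2sq n (\<lambda>x. v x - f x) < e / (norm c)\<^sup>2"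
      using assms unfolding test_limit_def by meson
    have "L2sq n (\<lambda>x. c * v x - c * f x) = (norm c)\<^sup>2 * L2sq n (\<lambda>x. v x - f x)"
      by (simp add: norm_mult power_mult_distrib flip: right_diff_distrib)
    also have "\<dots> < e" using f(2) False by (simp add: field_simps)
    finally show "\<exists>\<psi>\<in>test n. L2sq n (\<lambda>x. c * v x - \<psi> x) < e"
      using test_cmult[OF f(1), of c] by (intro bexI[of _ "\<lambda>x. c * f x"])
  qed
qed

lemma test_limit_sum:
  "finite A \<Longrightarrow> (\<And>a. a \<in> A \<Longrightarrow> test_limit n (v a)) \<Longrightarrow> test_limit n (\<lambda>x. \<Sum>a\<in>A. v a x)"
  by (induction A rule: finite_induct) (auto intro: test_limit_zero test_limit_add)

lemma test_limit_dominated: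
  assumes w: "w \<in> borel_measurable (leb n)" and v: "\<And>j. test_limit n (v j)"
    and G: "integrable (leb n) G" "\<And>x. x \<in> Rn n \<Longrightarrow> (norm (w x))\<^sup>2 \<le> G x"
      "\<And>j x. x \<in> Rn n \<Longrightarrow> (norm (v j x))\<^sup>2 \<le> G x"
    and lim: "\<And>x. x \<in> Rn n \<Longrightarrow> (\<lambda>j. v j x) \<longlonglongrightarrow> w x"
  shows "test_limit n w"
proof (rule test_limit_closed[OF _ v])
  show "w \<in> L2 n" by (rule L2_bound[OF w G(1)]) (use G(2) in \<open>auto intro!: AE_I2\<close>)
  have [measurable]: "v j \<in> borel_measurable (leb n)" for j
    by (rule L2_measurable) (use v[of j] in \<open>simp add: test_limit_def\<close>)
  have "(\<lambda>j. L2sq n (\<lambda>x. w x - v j x)) \<longlonglongrightarrow> (\<integral>x. 0 \<partial>leb n)"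
  proof (rule integral_dominated_convergence[where w = "\<lambda>x. 4 * G x"])
    show "AE x in leb n. (\<lambda>j. (norm (w x - v j x))\<^sup>2) \<longlonglongrightarrow> 0"
    proof (rule AE_I2)
      fix x assume "x \<in> space (leb n)"
      then have "(\<lambda>j. (norm (w x - v j x))\<^sup>2) \<longlonglongrightarrow> (norm (w x - w x))\<^sup>2"
        using lim by (intro tendsto_intros) simp
      then show "(\<lambda>j. (norm (w x - v j x))\<^sup>2) \<longlonglongrightarrow> 0" by simp
    qed
    show "AE x in leb n. norm ((norm (w x - v j x))\<^sup>2) \<le> 4 * G x" for j
    proof (rule AE_I2)
      fix x assume "x \<in> space (leb n)"
      then have "x \<in> Rn n" by simp
      then show "norm ((norm (w x - v j x))\<^sup>2) \<le> 4 * G x"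
        using norm_diff_sq[of "w x" "v j x"] G(2)[of x] G(3)[of x j] by simp
    qed
  qed (use w G(1) in auto)
  then show "(\<lambda>j. L2sq n (\<lambda>x. w x - v j x)) \<longlonglongrightarrow> 0" by simp
qed

lemma Csmooth_ramp: "i < n \<Longrightarrow> Csmooth n (\<lambda>x. complex_of_real (ramp 0 (s * x i + c)))"
  using Csmooth_coord[OF derivs_affine[OF derivs_ramp, of s c], of i n 0] by simp

lemma ramp_tendsto: "(\<lambda>j. ramp 0 (real j * t)) \<longlonglongrightarrow> (if t > 0 then 1 else 0)"
proof (cases "t > 0")
  case True
  have "(\<lambda>j. exp (- (1 / t) * (1 / real j))) \<longlonglongrightarrow> exp (- (1 / t) * 0)"
    by (intro tendsto_intros lim_1_over_n)
  then have "(\<lambda>j. exp (- (1 / (real j * t)))) \<longlonglongrightarrow> 1" by (simp add: mult.commute)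
  moreover have "\<forall>\<^sub>F j in sequentially. exp (- (1 / (real j * t))) = ramp 0 (real j * t)"
    by (rule eventually_mono[OF eventually_gt_at_top[of 0]]) (use True in \<open>simp add: ramp_0\<close>)
  ultimately show ?thesis using True by (simp add: Lim_transform_eventually)
next
  case False
  then have "real j * t \<le> 0" for j by (simp add: mult_nonneg_nonpos)
  then show ?thesis using False by simp
qed

text \<open>
  The product over the coordinates of \<open>ramp 0 (j (x\<^sub>i - a\<^sub>i)) ramp 0 (j (b\<^sub>i - x\<^sub>i))\<close> is a test
  function with values in \<open>[0, 1]\<close> and tends to the indicator of the open box as \<open>j \<rightarrow> \<infinity>\<close>.
\<close>

lemma test_limit_open_box: "test_limit n (indicator (\<Pi>\<^sub>E i\<in>{..<n}. {a i<..<b i}))"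
proof -
  define v where "v j x = (\<Prod>i<n. complex_of_real (ramp 0 (real j * (x i - a i))) * complex_of_real (ramp 0 (real j * (b i - x i))))"
    for j :: nat and x :: "nat \<Rightarrow> real"
  obtain P Q where PQ: "\<forall>i<n. \<bar>a i\<bar> \<le> P" "\<forall>i<n. \<bar>b i\<bar> \<le> Q" using bound_finite by metis
  have off: "off_box n (max P Q) (v j)" for j
    unfolding off_box_def
  proof (intro ballI impI)
    fix x assume "x \<in> Rn n" "\<exists>i<n. max P Q < \<bar>x i\<bar>"
    then obtain i where i: "i < n" "max P Q < \<bar>x i\<bar>" by blast
    then have "x i - a i < 0 \<or> b i - x i < 0" using PQ by (smt (verit))
    then have "real j * (x i - a i) \<le> 0 \<or> real j * (b i - x i) \<le> 0"
      by (auto simp: mult_nonneg_nonpos)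
    then have "complex_of_real (ramp 0 (real j * (x i - a i))) * complex_of_real (ramp 0 (real j * (b i - x i))) = 0" by auto
    then show "v j x = 0" unfolding v_def using i(1) by (intro prod_zero) auto
  qed
  have "Csmooth n (v j)" for j
    unfolding v_def
  proof (intro Csmooth_prod Csmooth_mult finite_lessThan)
    fix i assume "i \<in> {..<n}"
    then have i: "i < n" by simp
    show "Csmooth n (\<lambda>x. complex_of_real (ramp 0 (real j * (x i - a i))))"
      using Csmooth_ramp[OF i, of "real j" "- real j * a i"] by (simp add: algebra_simps)
    show "Csmooth n (\<lambda>x. complex_of_real (ramp 0 (real j * (b i - x i))))"
      using Csmooth_ramp[OF i, of "- real j" "real j * b i"] by (simp add: algebra_simps)
  qed
  with off have t: "v j \<in> test n" for j unfolding test_iff by blast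
  have le1: "norm (v j x) \<le> 1" for j x
    unfolding v_def prod_norm[symmetric]
    by (rule prod_le_1) (auto simp: norm_mult ramp_0_bounds intro!: mult_le_one)
  show ?thesis
  proof (rule test_limit_dominated[where v = v and G = "indicator (box_n n (max P Q))"])
    show "test_limit n (v j)" for j
      unfolding test_limit_def using L2_test[OF t] t[of j] by force
    show "(norm (v j x))\<^sup>2 \<le> indicator (box_n n (max P Q)) x" if x: "x \<in> Rn n" for j x
    proof (cases "x \<in> box_n n (max P Q)")
      case True
      then show ?thesis using le1[of j x] by (simp add: power_le_one del: PiE_iff)
    next
      case False
      then have "v j x = 0" using off[of j] x unfolding box_n_iff off_box_def by (meson not_le)
      then show ?thesis by simp
    qed
    have sub: "x \<in> box_n n (max P Q)" if x: "x \<in> (\<Pi>\<^sub>E i\<in>{..<n}. {a i<..<b i})" for x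
      unfolding box_n_iff
    proof (intro conjI allI impI)
      show "x \<in> Rn n" using x by (auto simp: PiE_iff)
      fix i assume i: "i < n"
      then have "a i < x i" "x i < b i" using x by (auto simp: PiE_iff)
      then show "\<bar>x i\<bar> \<le> max P Q" using PQ i by (smt (verit))
    qed
    show "(norm (indicator (\<Pi>\<^sub>E i\<in>{..<n}. {a i<..<b i}) x :: complex))\<^sup>2 \<le> indicator (box_n n (max P Q)) x" for x
      using sub[of x] by (cases "x \<in> (\<Pi>\<^sub>E i\<in>{..<n}. {a i<..<b i})") (simp_all del: PiE_iff)
    show "(\<lambda>j. v j x) \<longlonglongrightarrow> indicator (\<Pi>\<^sub>E i\<in>{..<n}. {a i<..<b i}) x" if x: "x \<in> Rn n" for x
    proof -
      have "(\<lambda>j. v j x) \<longlonglongrightarrow> (\<Prod>i<n. complex_of_real (if x i - a i > 0 then 1 else 0) * complex_of_real (if b i - x i > 0 then 1 else 0))"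
        unfolding v_def by (intro tendsto_intros ramp_tendsto)
      also have "(\<Prod>i<n. complex_of_real (if x i - a i > 0 then 1 else 0) * complex_of_real (if b i - x i > 0 then 1 else 0))
          = indicator (\<Pi>\<^sub>E i\<in>{..<n}. {a i<..<b i}) x"
      proof (cases "\<forall>i<n. a i < x i \<and> x i < b i")
        case True
        then have "x \<in> (\<Pi>\<^sub>E i\<in>{..<n}. {a i<..<b i})" using x by (auto simp: PiE_iff)
        with True show ?thesis by (simp del: PiE_iff)
      next
        case False
        then obtain i where i: "i < n" "\<not> (a i < x i \<and> x i < b i)" by blast
        then have "x \<notin> (\<Pi>\<^sub>E i\<in>{..<n}. {a i<..<b i})" by (auto simp: PiE_iff)
        moreover have "(\<Prod>i<n. complex_of_real (if x i - a i > 0 then 1 else 0) * complex_of_real (if b i - x i > 0 then 1 else 0)) = 0"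
          using i by (intro prod_zero) auto
        ultimately show ?thesis by (simp del: PiE_iff)
      qed
      finally show ?thesis .
    qed
  qed (use integrable_box in auto)
qed

lemma sets_leb_open_boxes:
  "sets (leb n) = sigma_sets (Rn n) {\<Pi>\<^sub>E i\<in>{..<n}. {a i<..<b i} | a b. True}"
proof -
  let ?E = "\<lambda>_::nat. range (\<lambda>(a, b). {a<..<b::real})"
  have "sets (leb n) = sets (\<Pi>\<^sub>M i\<in>{..<n}. sigma UNIV (?E i))"
    using borel_eq_box[where 'a=real] by (intro sets_PiM_cong refl) simp
  also have "\<dots> = sets (sigma (Rn n) {{f\<in>Rn n. \<forall>i\<in>j. f i \<in> A i} | A j. j \<in> {{..<n}} \<and> A \<in> Pi j ?E})"
  proof (rule sets_PiM_sigma)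
    show "\<exists>S\<subseteq>?E i. countable S \<and> UNIV = \<Union>S" for i :: nat
    proof (intro exI conjI)
      let ?S = "range (\<lambda>k::nat. {- real k<..<real k})"
      show "?S \<subseteq> ?E i" by auto
      show "UNIV = \<Union>?S"
      proof (intro equalityI subsetI)
        fix x :: real
        obtain k where "\<bar>x\<bar> < real k" using reals_Archimedean2 by blast
        then show "x \<in> \<Union>?S" by (auto intro!: exI[of _ k])
      qed simp
    qed simp
  qed auto
  also have "{{f\<in>Rn n. \<forall>i\<in>j. f i \<in> A i} | A j. j \<in> {{..<n}} \<and> A \<in> Pi j ?E}
      = {\<Pi>\<^sub>E i\<in>{..<n}. {a i<..<b i} | a b. True}" (is "?L = ?R")
  proof (intro equalityI subsetI)
    fix X assume "X \<in> ?L"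
    then obtain A j where XA: "X = {f\<in>Rn n. \<forall>i\<in>j. f i \<in> A i} \<and> j \<in> {{..<n}} \<and> A \<in> Pi j ?E"
      unfolding mem_Collect_eq by (elim exE)
    then have j: "j = {..<n}" by simp
    from XA have X: "X = {f\<in>Rn n. \<forall>i\<in>{..<n}. f i \<in> A i}" unfolding j by (rule conjunct1)
    from XA have A: "A \<in> Pi {..<n} ?E" unfolding j by (elim conjE)
    have "\<forall>i\<in>{..<n}. \<exists>a b. A i = {a<..<b}" using A by (simp add: Pi_iff image_iff)
    then obtain a b where ab: "\<forall>i\<in>{..<n}. A i = {a i<..<b i}" by metis
    have "X = (\<Pi>\<^sub>E i\<in>{..<n}. {a i<..<b i})" unfolding X set_eq_iff mem_Collect_eq PiE_iff using ab by (metis UNIV_I)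
    then show "X \<in> ?R" by blast
  next
    fix X assume "X \<in> ?R"
    then obtain a b where X: "X = (\<Pi>\<^sub>E i\<in>{..<n}. {a i<..<b i})" by blast
    have "X = {f\<in>Rn n. \<forall>i\<in>{..<n}. f i \<in> {a i<..<b i}}" unfolding X set_eq_iff mem_Collect_eq PiE_iff by (metis UNIV_I)
    moreover have "(\<lambda>i. {a i<..<b i}) \<in> Pi {..<n} ?E" by auto
    ultimately have "X = {f\<in>Rn n. \<forall>i\<in>{..<n}. f i \<in> {a i<..<b i}} \<and> {..<n} \<in> {{..<n}} \<and> (\<lambda>i. {a i<..<b i}) \<in> Pi {..<n} ?E"
      by simp
    then show "X \<in> ?L" unfolding mem_Collect_eq by (intro exI)
  qed
  also have "sets (sigma (Rn n) \<dots>) = sigma_sets (Rn n) \<dots>"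
    by (intro sets_measure_of) (auto simp: PiE_iff)
  finally show ?thesis .
qed

abbreviation open_box :: "nat \<Rightarrow> real \<Rightarrow> (nat \<Rightarrow> real) set" where
  "open_box n R \<equiv> (\<Pi>\<^sub>E i\<in>{..<n}. {-R<..<R})"

text \<open>
  Open boxes are stable under intersection and generate the Borel sets; the intersection with a fixed box
  keeps all indicators in \<open>L\<^sup>2\<close>, so that complements and disjoint unions are harmless.
\<close>

lemma test_limit_indicator:
  assumes "A \<in> sets (leb n)"
  shows "test_limit n (indicator (A \<inter> open_box n R))"
proof -
  let ?G = "{\<Pi>\<^sub>E i\<in>{..<n}. {a i<..<b i::real} | a b. True}"
  have A: "A \<in> sigma_sets (Rn n) ?G" using assms sets_leb_open_boxes by blast
  have int: "(\<Pi>\<^sub>E i\<in>{..<n}. {a i<..<b i}) \<inter> (\<Pi>\<^sub>E i\<in>{..<n}. {c i<..<d i})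
      = (\<Pi>\<^sub>E i\<in>{..<n}. {max (a i) (c i)<..<min (b i) (d i::real)})" for a b c d
    by (simp only: PiE_Int Int_greaterThanLessThan)
  have sub: "open_box n R \<subseteq> Rn n" by (rule PiE_mono) auto
  have sets: "X \<in> sets (leb n)" if "X \<in> sigma_sets (Rn n) ?G" for X
    using that sets_leb_open_boxes by blast
  have ob: "open_box n R \<in> sets (leb n)" by (intro sets_PiM_I_finite) auto
  have obb: "open_box n R \<subseteq> box_n n R" by (rule PiE_mono) auto
  show ?thesis
  proof (rule sigma_sets_induct_disjoint[OF _ _ A])
    show "Int_stable ?G"
    proof (rule Int_stableI)
      fix X Y assume "X \<in> ?G" "Y \<in> ?G"
      then obtain a b c d where "X = (\<Pi>\<^sub>E i\<in>{..<n}. {a i<..<b i})" "Y = (\<Pi>\<^sub>E i\<in>{..<n}. {c i<..<d i})" by blast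
      then have "X \<inter> Y = (\<Pi>\<^sub>E i\<in>{..<n}. {max (a i) (c i)<..<min (b i) (d i)})" by (simp only: int)
      then show "X \<inter> Y \<in> ?G" by (intro CollectI exI conjI TrueI)
    qed
    show "?G \<subseteq> Pow (Rn n)" by (auto simp: PiE_iff)
    show "test_limit n (indicator (X \<inter> open_box n R))" if X0: "X \<in> ?G" for X
    proof -
      obtain a b where "X = (\<Pi>\<^sub>E i\<in>{..<n}. {a i<..<b i}) \<and> True"
        using X0 unfolding mem_Collect_eq by (elim exE)
      then have X: "X = (\<Pi>\<^sub>E i\<in>{..<n}. {a i<..<b i})" by (rule conjunct1)
      show ?thesis unfolding X int by (rule test_limit_open_box)
    qed
    have "(indicator ({} \<inter> open_box n R) :: _ \<Rightarrow> complex) = (\<lambda>_. 0)" by (simp add: fun_eq_iff)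
    then show "test_limit n (indicator ({} \<inter> open_box n R))" using test_limit_zero by simp
    show "test_limit n (indicator ((Rn n - X) \<inter> open_box n R))"
      if "X \<in> sigma_sets (Rn n) ?G" "test_limit n (indicator (X \<inter> open_box n R))" for X
    proof -
      have "(indicator ((Rn n - X) \<inter> open_box n R) :: _ \<Rightarrow> complex)
          = (\<lambda>x. indicator (open_box n R) x + (- 1) * indicator (X \<inter> open_box n R) x)"
      proof
        fix x show "(indicator ((Rn n - X) \<inter> open_box n R) x :: complex)
            = indicator (open_box n R) x + (- 1) * indicator (X \<inter> open_box n R) x"
          using subsetD[OF sub, of x] by (cases "x \<in> open_box n R"; cases "x \<in> X") (simp_all only: indicator_def Int_iff Diff_iff, simp_all)
      qed
      then show ?thesis
        using test_limit_add[OF test_limit_open_box[of n "\<lambda>_. - R" "\<lambda>_. R"] test_limit_cmult[OF that(2), of "- 1"]]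
        by (simp only:)
    qed
    show "test_limit n (indicator ((\<Union>i. X i) \<inter> open_box n R))"
      if X: "disjoint_family X" "range X \<subseteq> sigma_sets (Rn n) ?G"
        "\<And>i. test_limit n (indicator (X i \<inter> open_box n R))" for X :: "nat \<Rightarrow> (nat \<Rightarrow> real) set"
    proof (rule test_limit_dominated[where G = "indicator (box_n n R)"
          and v = "\<lambda>j x. \<Sum>i<j. indicator (X i \<inter> open_box n R) x"])
      have Xs: "X i \<in> sets (leb n)" for i using X(2) sets by blast
      then show "indicator ((\<Union>i. X i) \<inter> open_box n R) \<in> borel_measurable (leb n)"
        using ob by (intro borel_measurable_indicator) auto
      show "test_limit n (\<lambda>x. \<Sum>i<j. indicator (X i \<inter> open_box n R) x)" for j
        using X(3) by (intro test_limit_sum) auto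
      have eq: "(\<Sum>i<j. indicator (X i \<inter> open_box n R) x) = (indicator ((\<Union>i<j. X i) \<inter> open_box n R) x :: complex)" for j x
      proof -
        have d: "disjoint_family_on (\<lambda>i. X i \<inter> open_box n R) {..<j}"
          using X(1) unfolding disjoint_family_on_def by blast
        have "(\<Union>i<j. X i) \<inter> open_box n R = (\<Union>i<j. X i \<inter> open_box n R)" by blast
        then show ?thesis by (simp only: indicator_UN_disjoint[OF finite_lessThan d])
      qed
      show "(norm (indicator ((\<Union>i. X i) \<inter> open_box n R) x :: complex))\<^sup>2 \<le> indicator (box_n n R) x" for x
        using subsetD[OF obb, of x] by (cases "x \<in> open_box n R") (simp_all add: indicator_def)
      show "(norm (\<Sum>i<j. indicator (X i \<inter> open_box n R) x :: complex))\<^sup>2 \<le> indicator (box_n n R) x" for j x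
        unfolding eq using subsetD[OF obb, of x] by (cases "x \<in> open_box n R") (simp_all add: indicator_def)
      show "(\<lambda>j. \<Sum>i<j. indicator (X i \<inter> open_box n R) x :: complex) \<longlonglongrightarrow> indicator ((\<Union>i. X i) \<inter> open_box n R) x" for x
      proof (rule tendsto_eventually, cases "x \<in> (\<Union>i. X i)")
        case True
        then obtain i where i: "x \<in> X i" by blast
        show "\<forall>\<^sub>F j in sequentially. (\<Sum>i<j. indicator (X i \<inter> open_box n R) x :: complex) = indicator ((\<Union>i. X i) \<inter> open_box n R) x"
          unfolding eq
        proof (rule eventually_mono[OF eventually_gt_at_top[of i]])
          fix j assume "i < j"
          with i have "x \<in> (\<Union>i<j. X i)" by blast
          with True show "indicator ((\<Union>i<j. X i) \<inter> open_box n R) x = (indicator ((\<Union>i. X i) \<inter> open_box n R) x :: complex)"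
            by (simp only: indicator_inter_arith indicator_simps)
        qed
      next
        case False
        then have "x \<notin> (\<Union>i<j. X i)" for j by blast
        with False show "\<forall>\<^sub>F j in sequentially. (\<Sum>i<j. indicator (X i \<inter> open_box n R) x :: complex) = indicator ((\<Union>i. X i) \<inter> open_box n R) x"
          unfolding eq by (simp only: indicator_inter_arith indicator_simps simp_thms if_False eventually_True mult_zero_left)
      qed
    qed (use integrable_box in auto)
  qed
qed

text \<open>
  A square integrable function is the dominated limit of simple functions, and these may be cut off by
  growing boxes.
\<close>

lemma L2_test_limit:
  assumes w: "w \<in> L2 n"
  shows "test_limit n w"
proof -
  have [measurable]: "w \<in> borel_measurable (leb n)" using w by (rule L2_measurable)
  obtain s where s: "(\<forall>i. simple_function (leb n) (s i)) \<and> (\<forall>x\<in>space (leb n). (\<lambda>i. s i x) \<longlonglongrightarrow> w x) \<and>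
      (\<forall>i. \<forall>x\<in>space (leb n). dist (s i x) 0 \<le> 2 * dist (w x) 0)"
    using borel_measurable_implies_sequence_metric[OF L2_measurable[OF w], of 0] by (elim exE)
  have s1: "simple_function (leb n) (s j)" for j using s by blast
  have s2: "(\<lambda>j. s j x) \<longlonglongrightarrow> w x" if "x \<in> Rn n" for x
    using s that unfolding space_leb by blast
  have s3: "norm (s j x) \<le> 2 * norm (w x)" if "x \<in> Rn n" for x j
    using s that unfolding space_leb dist_norm diff_zero by blast
  let ?v = "\<lambda>j x. indicator (open_box n (real j)) x * s j x"
  show ?thesis
  proof (rule test_limit_dominated[where v = ?v and G = "\<lambda>x. 4 * (norm (w x))\<^sup>2"])
    show "test_limit n (?v j)" for j
    proof -
      have fin: "finite (s j ` Rn n)" using simple_functionD(1)[OF s1[of j]] by simp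
      have "test_limit n (\<lambda>x. \<Sum>y\<in>s j ` Rn n. y * indicator ((s j -` {y} \<inter> Rn n) \<inter> open_box n (real j)) x)"
      proof (rule test_limit_sum[OF fin], rule test_limit_cmult, rule test_limit_indicator)
        fix y show "s j -` {y} \<inter> Rn n \<in> sets (leb n)"
          using simple_functionD(2)[OF s1[of j], of "{y}"] by (simp only: space_leb)
      qed
      also have "(\<lambda>x. \<Sum>y\<in>s j ` Rn n. y * indicator ((s j -` {y} \<inter> Rn n) \<inter> open_box n (real j)) x) = ?v j"
      proof
        fix x
        show "(\<Sum>y\<in>s j ` Rn n. y * indicator ((s j -` {y} \<inter> Rn n) \<inter> open_box n (real j)) x) = ?v j x"
        proof (cases "x \<in> open_box n (real j)")
          case True
          then have x: "x \<in> Rn n" by (rule rev_subsetD) (rule PiE_mono, auto)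
          have "(\<Sum>y\<in>s j ` Rn n. y * indicator ((s j -` {y} \<inter> Rn n) \<inter> open_box n (real j)) x)
              = (\<Sum>y\<in>s j ` Rn n. if y = s j x then y else 0)"
          proof (rule sum.cong[OF refl])
            fix y show "y * indicator ((s j -` {y} \<inter> Rn n) \<inter> open_box n (real j)) x = (if y = s j x then y else 0)"
              using True x by (cases "y = s j x") (simp_all add: indicator_inter_arith indicator_simps)
          qed
          also have "\<dots> = s j x" using fin x by (subst sum.delta) auto
          finally show ?thesis using True by (simp only: indicator_simps mult_1_left)
        next
          case False
          then show ?thesis by (simp add: indicator_inter_arith indicator_simps(2)[OF False])
        qed
      qed
      finally show ?thesis .
    qed
    show "(norm (?v j x))\<^sup>2 \<le> 4 * (norm (w x))\<^sup>2" if "x \<in> Rn n" for j x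
    proof -
      have "(norm (?v j x))\<^sup>2 \<le> (norm (s j x))\<^sup>2" by (cases "x \<in> open_box n (real j)") simp_all
      also have "\<dots> \<le> (2 * norm (w x))\<^sup>2" using s3[OF that] by (intro power_mono) auto
      finally show ?thesis by (simp add: power_mult_distrib)
    qed
    show "(\<lambda>j. ?v j x) \<longlonglongrightarrow> w x" if x: "x \<in> Rn n" for x
    proof -
      obtain Q where Q: "\<forall>i<n. \<bar>x i\<bar> \<le> Q" using bound_finite by blast
      obtain N :: nat where N: "Q < real N" using reals_Archimedean2 by blast
      have "s j x = ?v j x" if "j \<ge> N" for j
      proof -
        have "x \<in> open_box n (real j)"
        proof (intro PiE_I)
          fix i assume "i \<in> {..<n}"
          then have "\<bar>x i\<bar> < real j" using Q N that by (smt (verit) lessThan_iff of_nat_mono)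
          then show "x i \<in> {- real j<..<real j}" by auto
        next
          fix i assume "i \<notin> {..<n}" then show "x i = undefined" using x by (rule PiE_arb[rotated])
        qed
        then show ?thesis by (simp only: indicator_simps mult_1_left)
      qed
      then show ?thesis
        using s2[OF x] by (elim Lim_transform_eventually) (auto simp: eventually_sequentially)
    qed
  qed (use w in \<open>auto simp: L2_iff\<close>)
qed

text \<open>
  The linearised form of \<open>|\<integral> w \<psi>| \<le> B\<^sup>1\<^sup>/\<^sup>2 \<parallel>\<psi>\<parallel>\<close>: letting \<open>\<psi>\<close> tend to \<open>cnj w\<close> the hypothesis becomes
  \<open>2 \<parallel>w\<parallel>\<^sup>2 \<le> B + \<parallel>w\<parallel>\<^sup>2\<close>. It is stated without square roots since it is always verified through
  \<open>2 x y \<le> x\<^sup>2 + y\<^sup>2\<close>.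
\<close>

lemma L2_bound_by_duality:
  assumes w: "w \<in> L2 n"
    and B: "\<And>\<psi>. \<psi> \<in> test n \<Longrightarrow> 2 * Re (\<integral>x. w x * \<psi> x \<partial>leb n) \<le> B + L2sq n \<psi>"
  shows "L2sq n w \<le> B"
proof (rule field_le_epsilon)
  fix e :: real assume "e > 0"
  then obtain \<psi> where p: "\<psi> \<in> test n" "L2sq n (\<lambda>x. cnj (w x) - \<psi> x) < e"
    using L2_test_limit[OF L2_cnj[OF w]] unfolding test_limit_def by blast
  have "(norm (cnj z - u))\<^sup>2 = (norm z)\<^sup>2 - 2 * Re (z * u) + (norm u)\<^sup>2" for z u
    unfolding cmod_power2 by (simp add: power2_eq_square algebra_simps)
  then have "L2sq n (\<lambda>x. cnj (w x) - \<psi> x)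
      = (\<integral>x. (norm (w x))\<^sup>2 - 2 * Re (w x * \<psi> x) + (norm (\<psi> x))\<^sup>2 \<partial>leb n)" by presburger
  also have "\<dots> = L2sq n w - 2 * Re (\<integral>x. w x * \<psi> x \<partial>leb n) + L2sq n \<psi>"
    using L2_integrable[OF w] L2_integrable[OF L2_test[OF p(1)]] L2_prod_integrable[OF w L2_test[OF p(1)]]
    by (simp del: times_complex.simps)
  finally show "L2sq n w \<le> B + e" using B[OF p(1)] p(2) by linarith
qed

lemma AE_zero_if_integral_sq_le_0:
  assumes "w \<in> L2 n" "L2sq n w \<le> 0"
  shows "AE x in leb n. w x = 0"
proof -
  have "L2sq n w = 0" using assms(2) by (intro antisym integral_nonneg) auto
  then show ?thesis
    using integral_nonneg_eq_0_iff_AE[OF L2_integrable[OF assms(1)]] by auto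
qed

lemma weak_partial_unique:
  assumes "weak_partial n i w g" "weak_partial n i w h" "g \<in> L2 n" "h \<in> L2 n"
  shows "AE x in leb n. g x = h x"
proof -
  have d: "(\<lambda>x. g x - h x) \<in> L2 n" using assms by (intro L2_diff)
  have "L2sq n (\<lambda>x. g x - h x) \<le> 0"
  proof (rule L2_bound_by_duality[OF d])
    fix \<psi> assume p: "\<psi> \<in> test n"
    have "(\<integral>x. g x * \<psi> x \<partial>leb n) = (\<integral>x. h x * \<psi> x \<partial>leb n)"
      using assms(1,2) p unfolding weak_partial_def by fastforce
    then have "(\<integral>x. (g x - h x) * \<psi> x \<partial>leb n) = 0"
      using L2_prod_integrable[OF assms(3) L2_test[OF p]] L2_prod_integrable[OF assms(4) L2_test[OF p]]
      by (simp add: left_diff_distrib)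
    then show "2 * Re (\<integral>x. (g x - h x) * \<psi> x \<partial>leb n) \<le> 0 + L2sq n \<psi>" by simp
  qed
  from AE_zero_if_integral_sq_le_0[OF d this] show ?thesis by simp
qed

section \<open>Sobolev functions with a chosen gradient\<close>

text \<open>
  Weak gradients are specified up to null sets only, so the functions below are paired with a
  gradient of the caller's choice; \<open>weak_grad_AE\<close> identifies it with the one used in the norm and in the equation.
\<close>

definition sob :: "nat \<Rightarrow> ((nat \<Rightarrow> real) \<Rightarrow> complex) \<Rightarrow> (nat \<Rightarrow> (nat \<Rightarrow> real) \<Rightarrow> complex) \<Rightarrow> bool" where
  "sob n v G \<longleftrightarrow> v \<in> L2 n \<and> (\<forall>i<n. G i \<in> L2 n \<and> weak_partial n i v (G i))"

lemma sob_imp_H1: "sob n v G \<Longrightarrow> v \<in> H1 n"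
  unfolding sob_def H1_def by blast

lemma H1_weak_grad:
  assumes "v \<in> H1 n"
  shows "sob n v (weak_grad n v)"
  unfolding sob_def
proof (intro conjI allI impI)
  fix i assume "i < n"
  then have "\<exists>g. g \<in> L2 n \<and> weak_partial n i v g" using assms by (auto simp: H1_def)
  from someI_ex[OF this] show "weak_grad n v i \<in> L2 n" "weak_partial n i v (weak_grad n v i)"
    unfolding weak_grad_def by auto
qed (use assms in \<open>simp add: H1_def\<close>)

lemma weak_grad_AE:
  assumes "sob n v G" "i < n"
  shows "AE x in leb n. weak_grad n v i x = G i x"
proof -
  have "sob n v (weak_grad n v)" using assms by (intro H1_weak_grad sob_imp_H1)
  then show ?thesis using assms by (auto simp: sob_def intro: weak_partial_unique)
qed

lemma H1_norm_sob:
  assumes "sob n v G"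
  shows "H1_norm n v = sqrt ((\<integral>x. (cmod (v x))\<^sup>2 \<partial>leb n) + (\<Sum>i<n. \<integral>x. (cmod (G i x))\<^sup>2 \<partial>leb n))"
proof -
  have s: "sob n v (weak_grad n v)" using assms by (intro H1_weak_grad sob_imp_H1)
  have "(\<integral>x. (cmod (weak_grad n v i x))\<^sup>2 \<partial>leb n) = (\<integral>x. (cmod (G i x))\<^sup>2 \<partial>leb n)" if "i < n" for i
  proof (rule integral_cong_AE)
    show "(\<lambda>x. (cmod (weak_grad n v i x))\<^sup>2) \<in> borel_measurable (leb n)" "(\<lambda>x. (cmod (G i x))\<^sup>2) \<in> borel_measurable (leb n)"
      using s assms that by (auto simp: sob_def L2_iff)
    show "AE x in leb n. (cmod (weak_grad n v i x))\<^sup>2 = (cmod (G i x))\<^sup>2"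
      using weak_grad_AE[OF assms that] by (rule AE_mp) simp
  qed
  then have "(\<Sum>i<n. \<integral>x. (cmod (weak_grad n v i x))\<^sup>2 \<partial>leb n) = (\<Sum>i<n. \<integral>x. (cmod (G i x))\<^sup>2 \<partial>leb n)"
    by (intro sum.cong) auto
  then show ?thesis unfolding H1_norm_def by simp
qed

lemma sob_add_cmult:
  assumes v: "sob n v G" and w: "sob n w H"
  shows "sob n (\<lambda>x. v x + c * w x) (\<lambda>i x. G i x + c * H i x)"
  unfolding sob_def
proof (intro conjI allI impI)
  show "(\<lambda>x. v x + c * w x) \<in> L2 n" using v w by (intro L2_add L2_cmult) (auto simp: sob_def)
  fix i assume i: "i < n"
  show "(\<lambda>x. G i x + c * H i x) \<in> L2 n" using v w i by (intro L2_add L2_cmult) (auto simp: sob_def)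
  show "weak_partial n i (\<lambda>x. v x + c * w x) (\<lambda>x. G i x + c * H i x)"
    unfolding weak_partial_def
  proof
    fix \<psi> assume p: "\<psi> \<in> test n"
    note q = L2_test[OF test_partial[OF p i]] L2_test[OF p]
    have L: "v \<in> L2 n" "w \<in> L2 n" "G i \<in> L2 n" "H i \<in> L2 n" using v w i by (auto simp: sob_def)
    have "(\<integral>x. (v x + c * w x) * partial_deriv i \<psi> x \<partial>leb n)
        = (\<integral>x. v x * partial_deriv i \<psi> x \<partial>leb n) + c * (\<integral>x. w x * partial_deriv i \<psi> x \<partial>leb n)"
      using L2_prod_integrable[OF L(1) q(1)] L2_prod_integrable[OF L(2) q(1)]
      by (simp add: distrib_right mult.assoc)
    also have "\<dots> = - (\<integral>x. G i x * \<psi> x \<partial>leb n) + c * - (\<integral>x. H i x * \<psi> x \<partial>leb n)"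
      using v w i p unfolding sob_def weak_partial_def by simp
    also have "\<dots> = - (\<integral>x. (G i x + c * H i x) * \<psi> x \<partial>leb n)"
      using L2_prod_integrable[OF L(3) q(2)] L2_prod_integrable[OF L(4) q(2)]
      by (simp add: distrib_right mult.assoc)
    finally show "(\<integral>x. (v x + c * w x) * partial_deriv i \<psi> x \<partial>leb n) = - (\<integral>x. (G i x + c * H i x) * \<psi> x \<partial>leb n)" .
  qed
qed

text \<open>
  The product of the smooth factor and a test function is again a test function, so the Leibniz rule for
  smooth functions transfers to the weak derivative.
\<close>

lemma sob_smooth_mult:
  assumes v: "sob n v G" and \<eta>: "Csmooth n \<eta>"
    and C: "\<And>x. x \<in> Rn n \<Longrightarrow> norm (\<eta> x) \<le> C"
    and D: "\<And>i x. i < n \<Longrightarrow> x \<in> Rn n \<Longrightarrow> norm (partial_deriv i \<eta> x) \<le> D"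
  shows "sob n (\<lambda>x. \<eta> x * v x) (\<lambda>i x. \<eta> x * G i x + partial_deriv i \<eta> x * v x)"
  unfolding sob_def
proof (intro conjI allI impI)
  have vL: "v \<in> L2 n" using v by (simp add: sob_def)
  show "(\<lambda>x. \<eta> x * v x) \<in> L2 n" by (rule L2_mult[OF Csmooth_measurable[OF \<eta>] C vL])
  fix i assume i: "i < n"
  have GL: "G i \<in> L2 n" and wp: "weak_partial n i v (G i)" using v i by (auto simp: sob_def)
  have \<eta>': "Csmooth n (partial_deriv i \<eta>)" by (rule Csmooth_partial[OF \<eta> i])
  have L1: "(\<lambda>x. \<eta> x * G i x) \<in> L2 n" by (rule L2_mult[OF Csmooth_measurable[OF \<eta>] C GL])
  have L2: "(\<lambda>x. partial_deriv i \<eta> x * v x) \<in> L2 n" by (rule L2_mult[OF Csmooth_measurable[OF \<eta>'] D[OF i] vL])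
  show "(\<lambda>x. \<eta> x * G i x + partial_deriv i \<eta> x * v x) \<in> L2 n" by (rule L2_add[OF L1 L2])
  show "weak_partial n i (\<lambda>x. \<eta> x * v x) (\<lambda>x. \<eta> x * G i x + partial_deriv i \<eta> x * v x)"
    unfolding weak_partial_def
  proof
    fix \<psi> assume p: "\<psi> \<in> test n"
    have ps: "Csmooth n \<psi>" using p by (simp add: test_iff)
    have t1: "(\<lambda>x. \<eta> x * \<psi> x) \<in> test n" by (rule test_mult[OF \<eta> p])
    have t2: "(\<lambda>x. partial_deriv i \<eta> x * \<psi> x) \<in> test n" by (rule test_mult[OF \<eta>' p])
    have "(\<integral>x. v x * partial_deriv i (\<lambda>x. \<eta> x * \<psi> x) x \<partial>leb n) = - (\<integral>x. G i x * (\<eta> x * \<psi> x) \<partial>leb n)"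
      using wp t1 unfolding weak_partial_def by blast
    moreover have "(\<integral>x. v x * partial_deriv i (\<lambda>x. \<eta> x * \<psi> x) x \<partial>leb n)
        = (\<integral>x. (\<eta> x * v x) * partial_deriv i \<psi> x + v x * (partial_deriv i \<eta> x * \<psi> x) \<partial>leb n)"
      by (intro Bochner_Integration.integral_cong)
         (simp_all add: partial_deriv_mult[OF \<eta> ps i] algebra_simps)
    moreover have "\<dots> = (\<integral>x. (\<eta> x * v x) * partial_deriv i \<psi> x \<partial>leb n) + (\<integral>x. v x * (partial_deriv i \<eta> x * \<psi> x) \<partial>leb n)"
      by (intro Bochner_Integration.integral_add L2_prod_integrable vL L2_test[OF t2] L2_test[OF test_partial[OF p i]]
          L2_mult[OF Csmooth_measurable[OF \<eta>] C vL])
    moreover have "(\<integral>x. (\<eta> x * G i x + partial_deriv i \<eta> x * v x) * \<psi> x \<partial>leb n)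
        = (\<integral>x. G i x * (\<eta> x * \<psi> x) + v x * (partial_deriv i \<eta> x * \<psi> x) \<partial>leb n)"
      by (intro Bochner_Integration.integral_cong) (simp_all add: algebra_simps)
    moreover have "\<dots> = (\<integral>x. G i x * (\<eta> x * \<psi> x) \<partial>leb n) + (\<integral>x. v x * (partial_deriv i \<eta> x * \<psi> x) \<partial>leb n)"
      by (intro Bochner_Integration.integral_add L2_prod_integrable vL GL L2_test[OF t2] L2_test[OF t1])
    ultimately show "(\<integral>x. \<eta> x * v x * partial_deriv i \<psi> x \<partial>leb n)
        = - (\<integral>x. (\<eta> x * G i x + partial_deriv i \<eta> x * v x) * \<psi> x \<partial>leb n)"
      by (simp add: algebra_simps eq_neg_iff_add_eq_0)
  qed
qed

lemma sob_test: "\<psi> \<in> test n \<Longrightarrow> sob n \<psi> (\<lambda>i. partial_deriv i \<psi>)"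
  unfolding sob_def using L2_test test_partial weak_partial_smooth test_iff by blast

section \<open>Translations\<close>

lemma L2_aff:
  assumes "w \<in> L2 n" "s = 1 \<or> s = - 1"
  shows "(\<lambda>x. w (aff n s c x)) \<in> L2 n" "L2sq n (\<lambda>x. w (aff n s c x)) = L2sq n w"
proof -
  have m: "w \<in> borel_measurable (leb n)" using assms(1) by (rule L2_measurable)
  have "(\<lambda>x. w (aff n s c x)) \<in> borel_measurable (leb n)"
    using measurable_aff m by (rule measurable_compose)
  moreover have "integrable (leb n) (\<lambda>x. (norm (w (aff n s c x)))\<^sup>2)"
    using integrable_aff_iff[OF assms(2), of "\<lambda>x. (norm (w x))\<^sup>2" n c] L2_integrable[OF assms(1)] m by simp
  ultimately show "(\<lambda>x. w (aff n s c x)) \<in> L2 n" by (simp add: L2_iff)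
  show "L2sq n (\<lambda>x. w (aff n s c x)) = L2sq n w"
    using m by (intro integral_aff[OF assms(2)]) auto
qed

lemma two_mult_le_sq: "2 * (a * b) \<le> a\<^sup>2 + (b::real)\<^sup>2"
  using zero_le_power2[of "a - b"] by (simp add: power2_eq_square algebra_simps)

lemma norm_integral_prod_le:
  assumes "f \<in> L2 n" "g \<in> L2 n"
  shows "2 * (h * norm (\<integral>x. f x * g x \<partial>leb n)) \<le> h\<^sup>2 * L2sq n f + L2sq n g"
proof (cases "h \<ge> 0")
  case True
  have "2 * (h * norm (\<integral>x. f x * g x \<partial>leb n)) \<le> 2 * (h * L1norm n (\<lambda>x. f x * g x))"
    using True by (intro mult_left_mono integral_norm_bound) auto
  also have "\<dots> = (\<integral>x. 2 * (h * norm (f x) * norm (g x)) \<partial>leb n)"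
    by (simp add: norm_mult mult.assoc)
  also have "\<dots> \<le> (\<integral>x. h\<^sup>2 * (norm (f x))\<^sup>2 + (norm (g x))\<^sup>2 \<partial>leb n)"
  proof (rule integral_mono)
    show "integrable (leb n) (\<lambda>x. 2 * (h * norm (f x) * norm (g x)))"
      using integrable_norm[OF L2_prod_integrable[OF assms]] by (simp add: norm_mult mult.assoc)
    show "integrable (leb n) (\<lambda>x. h\<^sup>2 * (norm (f x))\<^sup>2 + (norm (g x))\<^sup>2)"
      using L2_integrable[OF assms(1)] L2_integrable[OF assms(2)] by simp
    show "2 * (h * norm (f x) * norm (g x)) \<le> h\<^sup>2 * (norm (f x))\<^sup>2 + (norm (g x))\<^sup>2" for x
      using two_mult_le_sq[of "h * norm (f x)" "norm (g x)"] by (simp add: power_mult_distrib)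
  qed
  also have "\<dots> = h\<^sup>2 * L2sq n f + L2sq n g"
    using L2_integrable[OF assms(1)] L2_integrable[OF assms(2)] by simp
  finally show ?thesis .
next
  case False
  then have "2 * (h * norm (\<integral>x. f x * g x \<partial>leb n)) \<le> 0" by (simp add: mult_nonpos_nonneg)
  also have "0 \<le> h\<^sup>2 * L2sq n f + L2sq n g" by simp
  finally show ?thesis .
qed

text \<open>
  By duality it suffices to pair with a test function \<open>\<psi>\<close>. The pairings with \<open>w (x + h e\<^sub>i)\<close> and with
  \<open>w\<close> are the values at \<open>h\<close> and at \<open>0\<close>, on the \<open>i\<close>-th axis, of the convolution of \<open>w\<close> with the reflected
  \<open>\<psi>\<close>. Along that axis this smooth function has the convolution with \<open>g\<close> as its derivative,
  so the mean value inequality applies.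
\<close>

lemma translation_bound_coord:
  assumes w: "w \<in> L2 n" and g: "g \<in> L2 n" and wp: "weak_partial n i w g" and i: "i < n"
  shows "L2sq n (\<lambda>x. w (aff n 1 (\<lambda>j. if j = i then h else 0) x) - w x) \<le> h\<^sup>2 * L2sq n g"
proof (rule L2_bound_by_duality)
  let ?c = "\<lambda>j. if j = i then h else 0"
  have wt: "(\<lambda>x. w (aff n 1 ?c x)) \<in> L2 n" by (rule L2_aff(1)[OF w]) simp
  then show "(\<lambda>x. w (aff n 1 ?c x) - w x) \<in> L2 n" using w by (rule L2_diff)
  fix \<psi> assume p: "\<psi> \<in> test n"
  define k where "k = (\<lambda>z. \<psi> (aff n (- 1) (\<lambda>_. 0) z))"
  have k: "k \<in> test n" unfolding k_def by (rule test_aff[OF _ p]) simp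
  define o' :: "nat \<Rightarrow> real" where "o' = (\<lambda>j\<in>{..<n}. 0)"
  have o': "o' \<in> Rn n" by (simp add: o'_def)
  have c1: "(\<integral>x. w (aff n 1 ?c x) * \<psi> x \<partial>leb n) = conv n k w (o'(i := h))"
  proof -
    let ?f = "\<lambda>y. w y * k (aff n (- 1) (o'(i := h)) y)"
    have "(\<integral>x. ?f (aff n 1 ?c x) \<partial>leb n) = (\<integral>x. ?f x \<partial>leb n)"
      using measurable_compose[OF measurable_aff test_measurable[OF k]] L2_measurable[OF w]
      by (intro integral_aff borel_measurable_times) auto
    moreover have "?f (aff n 1 ?c x) = w (aff n 1 ?c x) * \<psi> x" if x: "x \<in> Rn n" for x
    proof -
      have "aff n (- 1) (\<lambda>_. 0) (aff n (- 1) (o'(i := h)) (aff n 1 ?c x)) = x"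
        by (rule Rn_eqI[OF aff_in_Rn x]) (auto simp: o'_def)
      then show ?thesis by (simp add: k_def)
    qed
    then have "(\<integral>x. ?f (aff n 1 ?c x) \<partial>leb n) = (\<integral>x. w (aff n 1 ?c x) * \<psi> x \<partial>leb n)"
      by (intro Bochner_Integration.integral_cong) auto
    ultimately show ?thesis by (simp add: conv_def)
  qed
  have c0: "(\<integral>x. w x * \<psi> x \<partial>leb n) = conv n k w (o'(i := 0))"
    unfolding conv_def
  proof (rule Bochner_Integration.integral_cong[OF refl])
    fix x assume "x \<in> space (leb n)"
    then have x: "x \<in> Rn n" by simp
    have "aff n (- 1) (\<lambda>_. 0) (aff n (- 1) (o'(i := 0)) x) = x"
      by (rule Rn_eqI[OF aff_in_Rn x]) (auto simp: o'_def)
    then show "w x * \<psi> x = w x * k (aff n (- 1) (o'(i := 0)) x)" by (simp add: k_def)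
  qed
  have kn: "L2sq n (\<lambda>y. k (aff n (- 1) x y)) = L2sq n \<psi>" for x
    using L2_aff(2)[OF L2_test[OF k], of "- 1" x] L2_aff(2)[OF L2_test[OF p], of "- 1" "\<lambda>_. 0"] by (simp add: k_def)
  let ?B = "h\<^sup>2 * L2sq n g + L2sq n \<psi>"
  have der: "((\<lambda>t. conv n k w (o'(i := t))) has_vector_derivative conv n k g (o'(i := t0))) (at t0)" for t0
  proof -
    have "partial_deriv i (conv n k w) (o'(i := t0)) = conv n k g (o'(i := t0))"
      by (rule partial_deriv_conv_weak[OF L2_loc_int[OF w] k i Rn_upd[OF o' i] wp])
    moreover have "partial_deriv i (conv n k w) (o'(i := t0)) = conv n (partial_deriv i k) w (o'(i := t0))"
      by (rule partial_deriv_conv[OF L2_loc_int[OF w] k i Rn_upd[OF o' i]])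
    ultimately show ?thesis using conv_has_vd[OF L2_loc_int[OF w] k i o', of t0] by simp
  qed
  have bd: "2 * (\<bar>h\<bar> * norm (conv n k g (o'(i := t)))) \<le> ?B" for t
    using norm_integral_prod_le[OF g L2_aff(1)[OF L2_test[OF k], of "- 1" "o'(i := t)"], of "\<bar>h\<bar>"]
    unfolding conv_def[symmetric] kn by simp
  have "2 * norm (conv n k w (o'(i := h)) - conv n k w (o'(i := 0))) \<le> ?B"
  proof (cases "h = 0")
    case False
    have "norm (conv n k w (o'(i := h)) - conv n k w (o'(i := 0))) \<le> ?B / (2 * \<bar>h\<bar>) * \<bar>h - 0\<bar>"
    proof (rule vector_derivative_bound[OF convex_UNIV der])
      show "norm (conv n k g (o'(i := t))) \<le> ?B / (2 * \<bar>h\<bar>)" for t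
        using bd[of t] False by (simp add: pos_le_divide_eq mult_ac)
    qed auto
    moreover have "?B / (2 * \<bar>h\<bar>) * \<bar>h - 0\<bar> = ?B / 2" using False by simp
    ultimately have "norm (conv n k w (o'(i := h)) - conv n k w (o'(i := 0))) \<le> ?B / 2" by (simp only:)
    moreover have "a \<le> b / 2 \<Longrightarrow> 2 * a \<le> b" for a b :: real by simp
    ultimately show ?thesis by blast
  qed (simp add: integral_nonneg)
  moreover have "(\<integral>x. (w (aff n 1 ?c x) - w x) * \<psi> x \<partial>leb n) = conv n k w (o'(i := h)) - conv n k w (o'(i := 0))"
    using L2_prod_integrable[OF wt L2_test[OF p]] L2_prod_integrable[OF w L2_test[OF p]]
    by (simp add: left_diff_distrib c1 c0)
  ultimately show "2 * Re (\<integral>x. (w (aff n 1 ?c x) - w x) * \<psi> x \<partial>leb n) \<le> ?B"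
    using complex_Re_le_cmod[of "conv n k w (o'(i := h)) - conv n k w (o'(i := 0))"] by simp
qed

text \<open>
  A general translation is a composition of translations along the axes; the factor \<open>n\<close> comes from squaring
  the telescoping sum.
\<close>

lemma translation_bound:
  assumes "sob n w G"
  shows "L2sq n (\<lambda>x. w (aff n 1 c x) - w x) \<le> n * (\<Sum>i<n. (c i)\<^sup>2 * L2sq n (G i))"
proof -
  have w: "w \<in> L2 n" using assms by (simp add: sob_def)
  define q where "q m = (\<lambda>j. if j < m then c j else 0)" for m :: nat
  define d where "d m x = w (aff n 1 (q (Suc m)) x) - w (aff n 1 (q m) x)" for m x
  let ?e = "\<lambda>m j. if j = m then c m else 0 :: real"
  have step: "aff n 1 (q (Suc m)) x = aff n 1 (?e m) (aff n 1 (q m) x)" for m x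
    by (rule Rn_eqI[OF aff_in_Rn aff_in_Rn]) (auto simp: q_def)
  have L: "(\<lambda>x. w (aff n 1 b x)) \<in> L2 n" for b by (rule L2_aff(1)[OF w]) simp
  have dL: "d m \<in> L2 n" for m unfolding d_def by (intro L2_diff L)
  have bd: "L2sq n (d m) \<le> (c m)\<^sup>2 * L2sq n (G m)" if m: "m < n" for m
  proof -
    have "L2sq n (d m) = L2sq n (\<lambda>x. w (aff n 1 (?e m) x) - w x)"
      unfolding d_def step using L2_diff[OF L w]
      by (intro L2_aff(2)[of "\<lambda>x. w (aff n 1 (?e m) x) - w x"]) auto
    also have "\<dots> \<le> (c m)\<^sup>2 * L2sq n (G m)"
      using assms m by (intro translation_bound_coord[OF w]) (auto simp: sob_def)
    finally show ?thesis .
  qed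
  have tel: "w (aff n 1 c x) - w x = (\<Sum>m<n. d m x)" if x: "x \<in> Rn n" for x
  proof -
    have "(\<Sum>m<n. d m x) = w (aff n 1 (q n) x) - w (aff n 1 (q 0) x)"
      unfolding d_def by (rule sum_lessThan_telescope)
    moreover have "aff n 1 (q n) x = aff n 1 c x"
      by (rule Rn_eqI[OF aff_in_Rn aff_in_Rn]) (simp add: q_def)
    moreover have "aff n 1 (q 0) x = x"
      by (rule Rn_eqI[OF aff_in_Rn x]) (simp add: q_def)
    ultimately show ?thesis by simp
  qed
  have "(norm (w (aff n 1 c x) - w x))\<^sup>2 \<le> (\<Sum>m<n. (norm (d m x))\<^sup>2) * n" if x: "x \<in> Rn n" for x
  proof -
    have "(norm (w (aff n 1 c x) - w x))\<^sup>2 \<le> (\<Sum>m<n. norm (d m x))\<^sup>2"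
      unfolding tel[OF x] by (intro power_mono norm_sum) auto
    also have "\<dots> \<le> (\<Sum>m<n. (norm (d m x))\<^sup>2) * n"
      using sum_squared_le_sum_of_squares[of "\<lambda>m. norm (d m x)" "{..<n}"] by simp
    finally show ?thesis .
  qed
  then have "L2sq n (\<lambda>x. w (aff n 1 c x) - w x) \<le> (\<integral>x. (\<Sum>m<n. (norm (d m x))\<^sup>2) * n \<partial>leb n)"
    using L2_integrable[OF dL] L2_integrable[OF L2_diff[OF L w]]
    by (intro integral_mono integrable_mult_left Bochner_Integration.integrable_sum) auto
  also have "\<dots> = n * (\<Sum>m<n. L2sq n (d m))"
    using L2_integrable[OF dL] by (simp add: Bochner_Integration.integral_sum mult.commute)
  also have "\<dots> \<le> n * (\<Sum>i<n. (c i)\<^sup>2 * L2sq n (G i))"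
    by (intro mult_left_mono sum_mono bd) auto
  finally show ?thesis .
qed

lemma translation_bound_box:
  assumes "sob n w G" "\<And>i. i < n \<Longrightarrow> \<bar>c i\<bar> \<le> \<delta>"
  shows "L2sq n (\<lambda>x. w (aff n 1 c x) - w x) \<le> n * (\<delta>\<^sup>2 * (\<Sum>i<n. L2sq n (G i)))"
proof -
  have "(\<Sum>i<n. (c i)\<^sup>2 * L2sq n (G i)) \<le> (\<Sum>i<n. \<delta>\<^sup>2 * L2sq n (G i))"
  proof (intro sum_mono mult_right_mono integral_nonneg)
    fix i assume "i \<in> {..<n}"
    then have "\<bar>c i\<bar> \<le> \<delta>" using assms(2) by simp
    then have "\<bar>c i\<bar>\<^sup>2 \<le> \<delta>\<^sup>2" by (intro power_mono) auto
    then show "(c i)\<^sup>2 \<le> \<delta>\<^sup>2" by simp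
  qed auto
  then have "n * (\<Sum>i<n. (c i)\<^sup>2 * L2sq n (G i)) \<le> n * (\<delta>\<^sup>2 * (\<Sum>i<n. L2sq n (G i)))"
    by (intro mult_left_mono) (simp_all add: sum_distrib_left)
  with translation_bound[OF assms(1), of c] show ?thesis by linarith
qed

text \<open>
  Translations act isometrically on \<open>L\<^sup>2\<close>, so it suffices to treat a test function close to \<open>w\<close>, to which the
  gradient bound applies.
\<close>

lemma L2_translation_continuous:
  assumes w: "w \<in> L2 n" and e: "e > 0"
  shows "\<exists>\<delta>>0. \<forall>c. (\<forall>i<n. \<bar>c i\<bar> \<le> \<delta>) \<longrightarrow> L2sq n (\<lambda>x. w (aff n 1 c x) - w x) < e"
proof -
  \<comment> \<open>The distance to the test function enters the final estimate eight times, its translation twice.\<close>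
  have "e / 32 > 0" using e by simp
  then obtain \<psi> where p: "\<psi> \<in> test n" "L2sq n (\<lambda>x. w x - \<psi> x) < e / 32"
    using L2_test_limit[OF w] unfolding test_limit_def by blast
  define S where "S = n * (\<Sum>i<n. L2sq n (\<lambda>x. partial_deriv i \<psi> x))"
  have S0: "S \<ge> 0" unfolding S_def by (intro mult_nonneg_nonneg sum_nonneg integral_nonneg) auto
  define \<delta> where "\<delta> = sqrt (e / (4 * (S + 1)))"
  have d0: "\<delta> > 0" using e S0 by (simp add: \<delta>_def)
  have d2: "\<delta>\<^sup>2 = e / (4 * (S + 1))" using e S0 by (simp add: \<delta>_def)
  show ?thesis
  proof (intro exI[of _ \<delta>] conjI d0 allI impI)
    fix c :: "nat \<Rightarrow> real" assume c: "\<forall>i<n. \<bar>c i\<bar> \<le> \<delta>"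
    let ?f = "\<lambda>x. w x - \<psi> x"
    have pL: "\<psi> \<in> L2 n" by (rule L2_test[OF p(1)])
    have fL: "?f \<in> L2 n" by (rule L2_diff[OF w pL])
    have fc: "(\<lambda>x. ?f (aff n 1 c x)) \<in> L2 n" "L2sq n (\<lambda>x. ?f (aff n 1 c x)) = L2sq n ?f"
      using L2_aff[OF fL, of 1 c] by auto
    have "L2sq n (\<lambda>x. \<psi> (aff n 1 c x) - \<psi> x) \<le> \<delta>\<^sup>2 * S"
      using translation_bound_box[OF sob_test[OF p(1)], of c \<delta>] c by (simp add: S_def mult_ac)
    also have "\<dots> \<le> e / 4"
      unfolding d2 using e S0 by (simp add: field_simps)
    finally have 1: "L2sq n (\<lambda>x. \<psi> (aff n 1 c x) - \<psi> x) \<le> e / 4" .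
    have "L2sq n (\<lambda>x. ?f (aff n 1 c x) + (- 1) * ?f x)
        \<le> 2 * L2sq n (\<lambda>x. ?f (aff n 1 c x)) + 2 * L2sq n (\<lambda>x. (- 1) * ?f x)"
      by (rule L2_integral_add_le[OF fc(1) L2_cmult[OF fL]])
    also have "\<dots> = 4 * L2sq n ?f" unfolding fc(2) by (simp add: norm_minus_commute)
    finally have 2: "L2sq n (\<lambda>x. ?f (aff n 1 c x) + (- 1) * ?f x) \<le> 4 * L2sq n ?f" .
    have "L2sq n (\<lambda>x. (?f (aff n 1 c x) + (- 1) * ?f x) + (\<psi> (aff n 1 c x) - \<psi> x))
        \<le> 2 * L2sq n (\<lambda>x. ?f (aff n 1 c x) + (- 1) * ?f x) + 2 * L2sq n (\<lambda>x. \<psi> (aff n 1 c x) - \<psi> x)"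
      by (intro L2_integral_add_le L2_add fc(1) L2_cmult fL L2_diff pL L2_aff(1)) simp
    also have "\<dots> < e" using 1 2 p(2) e by simp
    finally show "L2sq n (\<lambda>x. w (aff n 1 c x) - w x) < e" by (simp add: algebra_simps)
  qed
qed

section \<open>Mollification and Nash's inequality\<close>

definition bump :: "real \<Rightarrow> real \<Rightarrow> real" where
  "bump e t = ramp 0 (1 + t / e) * ramp 0 (1 - t / e)"

lemma bump_bounds: "0 \<le> bump e t" "bump e t \<le> 1"
  unfolding bump_def by (auto intro!: mult_nonneg_nonneg mult_le_one ramp_0_bounds)

lemma bump_zero: "e > 0 \<Longrightarrow> \<bar>t\<bar> \<ge> e \<Longrightarrow> bump e t = 0"
proof -
  assume "e > 0" "\<bar>t\<bar> \<ge> e"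
  then have "1 + t / e \<le> 0 \<or> 1 - t / e \<le> 0" by (auto simp: field_simps abs_if split: if_splits)
  then show "bump e t = 0" by (auto simp: bump_def)
qed

lemma bump_lower: "e > 0 \<Longrightarrow> \<bar>t\<bar> \<le> e / 2 \<Longrightarrow> exp (- 4) \<le> bump e t"
proof -
  assume e: "e > 0" "\<bar>t\<bar> \<le> e / 2"
  have r: "exp (- 2) \<le> ramp 0 s" if "s \<ge> 1 / 2" for s
  proof -
    have "1 / s \<le> 2" using that by (simp add: field_simps)
    then show ?thesis using that by (simp add: ramp_0)
  qed
  have "1 + t / e \<ge> 1 / 2" "1 - t / e \<ge> 1 / 2" using e by (auto simp: field_simps abs_if split: if_splits)
  from mult_mono[OF r[OF this(1)] r[OF this(2)]] show "exp (- 4) \<le> bump e t"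
    by (simp add: bump_def ramp_0_bounds flip: exp_add)
qed

lemma bump_measurable [measurable]: "bump e \<in> borel_measurable borel"
proof -
  have [measurable]: "ramp 0 \<in> borel_measurable borel"
    by (intro borel_measurable_continuous_onI derivs_cont derivs_ramp)
  show ?thesis unfolding bump_def[abs_def] by measurable
qed

lemma bump_integral:
  assumes e: "e > 0"
  shows "integrable lborel (bump e)" "e * exp (- 4) \<le> (\<integral>t. bump e t \<partial>lborel)"
proof -
  show i: "integrable lborel (bump e)"
  proof (rule Bochner_Integration.integrable_bound)
    show "integrable lborel (indicator {- e..e} :: real \<Rightarrow> real)"
      by (intro integrable_real_indicator) (auto simp: emeasure_lborel_Icc_eq)
    show "AE t in lborel. norm (bump e t) \<le> norm (indicator {- e..e} t :: real)"
    proof (rule AE_I2)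
      fix t show "norm (bump e t) \<le> norm (indicator {- e..e} t :: real)"
        using bump_zero[OF e, of t] bump_bounds[of e t] by (cases "t \<in> {- e..e}") auto
    qed
  qed simp
  have "e * exp (- 4) = (\<integral>t. exp (- 4) * indicator {- (e / 2)..e / 2} t \<partial>lborel)"
    using e by simp
  also have "\<dots> \<le> (\<integral>t. bump e t \<partial>lborel)"
  proof (rule integral_mono[OF _ i])
    show "integrable lborel (\<lambda>t. exp (- 4) * indicator {- (e / 2)..e / 2} t :: real)"
      by (intro integrable_mult_right integrable_real_indicator) (auto simp: emeasure_lborel_Icc_eq)
    show "exp (- 4) * indicator {- (e / 2)..e / 2} t \<le> bump e t" for t
      using bump_lower[OF e, of t] bump_bounds[of e t] by (cases "t \<in> {- (e / 2)..e / 2}") auto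
  qed
  finally show "e * exp (- 4) \<le> (\<integral>t. bump e t \<partial>lborel)" .
qed

definition bump_n :: "nat \<Rightarrow> real \<Rightarrow> (nat \<Rightarrow> real) \<Rightarrow> real" where
  "bump_n n e x = (\<Prod>i<n. bump e (x i))"

lemma bump_n_bounds: "0 \<le> bump_n n e x" "bump_n n e x \<le> 1"
  unfolding bump_n_def by (auto intro!: prod_nonneg prod_le_1 bump_bounds)

lemma bump_n_off_box: "e > 0 \<Longrightarrow> off_box n e (\<lambda>x. complex_of_real (bump_n n e x))"
  unfolding off_box_def
proof (intro ballI impI)
  fix x assume "e > 0" "\<exists>i<n. e < \<bar>x i\<bar>"
  then obtain i where i: "i < n" "bump e (x i) = 0" using bump_zero less_imp_le by blast
  then have "bump_n n e x = 0" unfolding bump_n_def by (intro prod_zero) auto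
  then show "complex_of_real (bump_n n e x) = 0" by simp
qed

lemma bump_n_smooth: "Csmooth n (\<lambda>x. complex_of_real (bump_n n e x))"
proof -
  have "Csmooth n (\<lambda>x. \<Prod>i<n. complex_of_real (ramp 0 (1 + x i / e)) * complex_of_real (ramp 0 (1 - x i / e)))"
  proof (intro Csmooth_prod Csmooth_mult finite_lessThan)
    fix i assume "i \<in> {..<n}"
    then have i: "i < n" by simp
    show "Csmooth n (\<lambda>x. complex_of_real (ramp 0 (1 + x i / e)))"
      using Csmooth_ramp[OF i, of "1 / e" 1] by (simp add: add.commute)
    show "Csmooth n (\<lambda>x. complex_of_real (ramp 0 (1 - x i / e)))"
      using Csmooth_ramp[OF i, of "- 1 / e" 1] by simp
  qed
  then show ?thesis by (simp add: bump_n_def bump_def)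
qed

lemma bump_n_test: "e > 0 \<Longrightarrow> (\<lambda>x. complex_of_real (bump_n n e x)) \<in> test n"
  unfolding test_iff using bump_n_smooth bump_n_off_box by blast

text \<open>
  Besides the radius of the support, Nash's inequality needs the upper bound on the kernel. It comes
  from \<open>bump e \<ge> exp (-4)\<close> on an interval of length \<open>e\<close>.
\<close>

lemma mollifier_exists:
  assumes e: "e > 0"
  obtains k :: "(nat \<Rightarrow> real) \<Rightarrow> real" where
    "(\<lambda>x. complex_of_real (k x)) \<in> test n" "off_box n e (\<lambda>x. complex_of_real (k x))"
    "\<And>x. 0 \<le> k x" "\<And>x. k x \<le> (exp 4 / e) ^ n" "integrable (leb n) k" "(\<integral>x. k x \<partial>leb n) = 1"
proof
  define Z where "Z = (\<integral>t. bump e t \<partial>lborel)"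
  have Z: "0 < e * exp (- 4)" "e * exp (- 4) \<le> Z" using bump_integral(2)[OF e] e by (auto simp: Z_def)
  then have Z0: "Z > 0" by linarith
  let ?k = "\<lambda>x. bump_n n e x / Z ^ n"
  have eq: "(\<lambda>x. complex_of_real (?k x)) = (\<lambda>x. (1 / complex_of_real (Z ^ n)) * complex_of_real (bump_n n e x))" by simp
  show "(\<lambda>x. complex_of_real (?k x)) \<in> test n"
    unfolding eq by (rule test_cmult[OF bump_n_test[OF e]])
  show "off_box n e (\<lambda>x. complex_of_real (?k x))"
    using bump_n_off_box[OF e, of n] by (simp add: off_box_def)
  show "0 \<le> ?k x" for x using Z0 bump_n_bounds by simp
  show "?k x \<le> (exp 4 / e) ^ n" for x
  proof -
    have "?k x \<le> 1 / Z ^ n" using Z0 bump_n_bounds by (intro divide_right_mono) auto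
    also have "\<dots> = (1 / Z) ^ n" by (simp add: power_divide)
    also have "\<dots> \<le> (1 / (e * exp (- 4))) ^ n" using Z Z0 by (intro power_mono frac_le) auto
    also have "1 / (e * exp (- 4)) = exp 4 / e" by (simp add: exp_minus field_simps)
    finally show ?thesis .
  qed
  show "integrable (leb n) ?k"
    unfolding bump_n_def by (intro integrable_divide lebp.product_integrable_prod bump_integral e) auto
  show "(\<integral>x. ?k x \<partial>leb n) = 1"
    unfolding bump_n_def using Z0
    by (simp add: lebp.product_integral_prod[OF finite_lessThan bump_integral(1)[OF e]] Z_def[symmetric])
qed

lemma pair_sigma_finite_leb: "pair_sigma_finite (leb n) (leb n)"
  by (intro pair_sigma_finite.intro sigma_finite_leb)

lemma aff_diff_measurable [measurable]:
  "(\<lambda>(x, y). aff n (- 1) x y) \<in> measurable (leb n \<Otimes>\<^sub>M leb n) (leb n)"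
  unfolding aff_def case_prod_beta by measurable

lemma conv_measurable:
  assumes "loc_int n w" "k \<in> test n"
  shows "conv n k w \<in> borel_measurable (leb n)"
  by (rule measurable_continuous_Rn[OF continuous_on_conv[OF assms]])

lemma aff_swap: "x \<in> Rn n \<Longrightarrow> aff n (- 1) x (aff n (- 1) x y) = y" if "y \<in> Rn n"
  by (rule Rn_eqI[OF aff_in_Rn that]) simp

lemma aff_minus_eq: "aff n (- 1) x y = aff n 1 (\<lambda>i. - y i) x"
  by (rule Rn_eqI[OF aff_in_Rn aff_in_Rn]) simp

lemma conv_swap:
  assumes w: "w \<in> borel_measurable (leb n)" and k: "k \<in> test n" and x: "x \<in> Rn n"
  shows "conv n k w x = (\<integral>z. w (aff n (- 1) x z) * k z \<partial>leb n)"
proof -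
  let ?f = "\<lambda>y. w y * k (aff n (- 1) x y)"
  have "(\<integral>z. ?f (aff n (- 1) x z) \<partial>leb n) = (\<integral>z. ?f z \<partial>leb n)"
    using measurable_compose[OF measurable_aff test_measurable[OF k]] w
    by (intro integral_aff borel_measurable_times) auto
  moreover have "(\<integral>z. ?f (aff n (- 1) x z) \<partial>leb n) = (\<integral>z. w (aff n (- 1) x z) * k z \<partial>leb n)"
    by (intro Bochner_Integration.integral_cong refl) (simp add: aff_swap[OF _ x])
  ultimately show ?thesis by (simp add: conv_def)
qed

lemma conv_swap_integrable:
  assumes w: "loc_int n w" and k: "k \<in> test n" and x: "x \<in> Rn n"
  shows "integrable (leb n) (\<lambda>z. w (aff n (- 1) x z) * k z)"
proof -
  let ?f = "\<lambda>y. w y * k (aff n (- 1) x y)"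
  have "?f \<in> borel_measurable (leb n)"
    using measurable_compose[OF measurable_aff test_measurable[OF k]] w
    by (intro borel_measurable_times) (auto simp: loc_int_def)
  then have "integrable (leb n) (\<lambda>z. ?f (aff n (- 1) x z))"
    using integrable_aff_iff[of "- 1" ?f n x] test_loc_int_integrable[OF w k, of x] by simp
  also have "?this \<longleftrightarrow> integrable (leb n) (\<lambda>z. w (aff n (- 1) x z) * k z)"
    by (intro Bochner_Integration.integrable_cong refl) (simp add: aff_swap[OF _ x])
  finally show ?thesis .
qed

text \<open>
  Jensen's inequality for the square of the norm and a probability density \<open>k\<close>, from
  \<open>2 |m| |d| \<le> |m|\<^sup>2 + |d|\<^sup>2\<close> with \<open>m\<close> the average of \<open>d\<close>. The bound is extended real valued so that
  Tonelli's theorem applies to it directly.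
\<close>

lemma norm_weighted_average_le:
  fixes k :: "'a \<Rightarrow> real" and d :: "'a \<Rightarrow> complex"
  assumes k: "\<And>z. 0 \<le> k z" "integrable M k" "(\<integral>z. k z \<partial>M) = 1"
    and kd: "integrable M (\<lambda>z. d z * complex_of_real (k z))" and dm: "d \<in> borel_measurable M"
  shows "ennreal ((norm (\<integral>z. d z * complex_of_real (k z) \<partial>M))\<^sup>2) \<le> (\<integral>\<^sup>+z. ennreal (k z * (norm (d z))\<^sup>2) \<partial>M)"
proof (cases "(\<integral>\<^sup>+z. ennreal (k z * (norm (d z))\<^sup>2) \<partial>M) = \<infinity>")
  case False
  have km: "k \<in> borel_measurable M" using k(2) by auto
  have i: "integrable M (\<lambda>z. k z * (norm (d z))\<^sup>2)"
    using False k(1) km dm by (intro integrableI_nonneg) (auto simp: top.not_eq_extremum)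
  let ?m = "norm (\<integral>z. d z * complex_of_real (k z) \<partial>M)"
  have kd': "integrable M (\<lambda>z. norm (d z) * k z)"
    using integrable_norm[OF kd] k(1) by (simp add: norm_mult)
  have "?m \<le> (\<integral>z. norm (d z) * k z \<partial>M)"
    using integral_norm_bound[of M "\<lambda>z. d z * complex_of_real (k z)"] k(1) by (simp add: norm_mult)
  then have "2 * (?m * ?m) \<le> 2 * (?m * (\<integral>z. norm (d z) * k z \<partial>M))"
    by (intro mult_left_mono) auto
  also have "\<dots> = (\<integral>z. 2 * (?m * (norm (d z) * k z)) \<partial>M)" by simp
  also have "\<dots> \<le> (\<integral>z. ?m\<^sup>2 * k z + k z * (norm (d z))\<^sup>2 \<partial>M)"
  proof (rule integral_mono)
    fix z
    have "k z * (2 * (?m * norm (d z))) \<le> k z * (?m\<^sup>2 + (norm (d z))\<^sup>2)"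
      by (intro mult_left_mono two_mult_le_sq k(1))
    then show "2 * (?m * (norm (d z) * k z)) \<le> ?m\<^sup>2 * k z + k z * (norm (d z))\<^sup>2"
      by (simp add: algebra_simps)
  qed (use i kd' k(2) in auto)
  also have "\<dots> = ?m\<^sup>2 + (\<integral>z. k z * (norm (d z))\<^sup>2 \<partial>M)" using i k by simp
  finally have "?m\<^sup>2 \<le> (\<integral>z. k z * (norm (d z))\<^sup>2 \<partial>M)" by (simp add: power2_eq_square)
  then have "ennreal (?m\<^sup>2) \<le> ennreal (\<integral>z. k z * (norm (d z))\<^sup>2 \<partial>M)" by (rule ennreal_leI)
  also have "\<dots> = (\<integral>\<^sup>+z. ennreal (k z * (norm (d z))\<^sup>2) \<partial>M)"
    using i k(1) by (intro nn_integral_eq_integral[symmetric]) auto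
  finally show ?thesis .
qed simp

text \<open>
  \<open>conv n k w - w\<close> is an average, with weight \<open>k\<close>, of the differences between \<open>w\<close> and its translates.
  Jensen's inequality and Tonelli's theorem reduce the claim to the translates.
\<close>

lemma conv_close:
  assumes w: "w \<in> L2 n" and k: "(\<lambda>x. complex_of_real (k x)) \<in> test n" "off_box n e (\<lambda>x. complex_of_real (k x))"
      "\<And>x. 0 \<le> k x" "integrable (leb n) k" "(\<integral>x. k x \<partial>leb n) = 1"
    and B: "\<And>c. (\<forall>i<n. \<bar>c i\<bar> \<le> e) \<Longrightarrow> (L2sq n (\<lambda>x. w (aff n 1 c x) - w x)) \<le> B"
  shows "(\<lambda>x. conv n (\<lambda>x. complex_of_real (k x)) w x - w x) \<in> L2 n"
    and "L2sq n (\<lambda>x. conv n (\<lambda>x. complex_of_real (k x)) w x - w x) \<le> B"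
proof -
  interpret P: pair_sigma_finite "leb n" "leb n" by (rule pair_sigma_finite_leb)
  let ?c = "conv n (\<lambda>x. complex_of_real (k x)) w"
  have wm [measurable]: "w \<in> borel_measurable (leb n)" using w by (rule L2_measurable)
  have km [measurable]: "k \<in> borel_measurable (leb n)" using k(4) by auto
  have wl: "loc_int n w" by (rule L2_loc_int[OF w])
  have cm [measurable]: "?c \<in> borel_measurable (leb n)" by (rule conv_measurable[OF wl k(1)])
  have pt: "ennreal ((norm (?c x - w x))\<^sup>2) \<le> (\<integral>\<^sup>+z. ennreal (k z * (norm (w (aff n (- 1) x z) - w x))\<^sup>2) \<partial>leb n)"
    if x: "x \<in> Rn n" for x
  proof -
    have i1: "integrable (leb n) (\<lambda>z. w (aff n (- 1) x z) * complex_of_real (k z))"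
      by (rule conv_swap_integrable[OF wl k(1) x])
    have i2: "integrable (leb n) (\<lambda>z. w x * complex_of_real (k z))" using k(4) by simp
    have "(\<integral>z. (w (aff n (- 1) x z) - w x) * complex_of_real (k z) \<partial>leb n) = ?c x - w x"
      using i1 i2 k(5) unfolding conv_swap[OF wm k(1) x] by (simp add: left_diff_distrib)
    moreover have "integrable (leb n) (\<lambda>z. (w (aff n (- 1) x z) - w x) * complex_of_real (k z))"
      using i1 i2 by (simp add: left_diff_distrib)
    moreover have "(\<lambda>z. w (aff n (- 1) x z) - w x) \<in> borel_measurable (leb n)" by measurable
    ultimately show ?thesis
      using norm_weighted_average_le[of k "leb n" "\<lambda>z. w (aff n (- 1) x z) - w x"] k by simp
  qed
  have B0: "0 \<le> B" if "k z \<noteq> 0" "z \<in> Rn n" for z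
  proof -
    have "0 \<le> L2sq n (\<lambda>x. w (aff n 1 (\<lambda>i. - z i) x) - w x)" by simp
    also have "\<dots> \<le> B" using k(2) that by (intro B) (auto simp: off_box_def not_le[symmetric])
    finally show ?thesis .
  qed
  have Bpos: "0 \<le> B"
  proof -
    have "\<exists>z\<in>Rn n. k z \<noteq> 0"
    proof (rule ccontr)
      assume "\<not> (\<exists>z\<in>Rn n. k z \<noteq> 0)"
      then have "(\<integral>x. k x \<partial>leb n) = (\<integral>x. 0 \<partial>leb n)" by (intro Bochner_Integration.integral_cong) auto
      with k(5) show False by simp
    qed
    with B0 show ?thesis by blast
  qed
  have "(\<integral>\<^sup>+x. ennreal ((norm (?c x - w x))\<^sup>2) \<partial>leb n)
      \<le> (\<integral>\<^sup>+x. \<integral>\<^sup>+z. ennreal (k z * (norm (w (aff n (- 1) x z) - w x))\<^sup>2) \<partial>leb n \<partial>leb n)"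
    using pt by (intro nn_integral_mono) simp
  also have "\<dots> = (\<integral>\<^sup>+z. \<integral>\<^sup>+x. ennreal (k z * (norm (w (aff n (- 1) x z) - w x))\<^sup>2) \<partial>leb n \<partial>leb n)"
    by (rule P.Fubini'[symmetric]) measurable
  also have "\<dots> \<le> (\<integral>\<^sup>+z. ennreal (k z * B) \<partial>leb n)"
  proof (rule nn_integral_mono)
    fix z assume "z \<in> space (leb n)"
    then have z: "z \<in> Rn n" by simp
    show "(\<integral>\<^sup>+x. ennreal (k z * (norm (w (aff n (- 1) x z) - w x))\<^sup>2) \<partial>leb n) \<le> ennreal (k z * B)"
    proof (cases "k z = 0")
      case False
      then have "L2sq n (\<lambda>x. w (aff n 1 (\<lambda>i. - z i) x) - w x) \<le> B"
        using k(2) z by (intro B) (auto simp: off_box_def not_le[symmetric])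
      moreover have d: "(\<lambda>x. w (aff n 1 (\<lambda>i. - z i) x) - w x) \<in> L2 n"
        by (intro L2_diff w L2_aff(1)) simp
      have "(\<integral>\<^sup>+x. ennreal (k z * (norm (w (aff n (- 1) x z) - w x))\<^sup>2) \<partial>leb n)
          = ennreal (\<integral>x. k z * (norm (w (aff n (- 1) x z) - w x))\<^sup>2 \<partial>leb n)"
        using L2_integrable[OF d] k(3) unfolding aff_minus_eq by (intro nn_integral_eq_integral) auto
      ultimately show ?thesis
        unfolding aff_minus_eq using k(3)[of z] by (simp add: mult_left_mono ennreal_leI)
    qed simp
  qed
  also have "\<dots> = ennreal (\<integral>z. k z * B \<partial>leb n)"
    using k(3,4) Bpos by (intro nn_integral_eq_integral) auto
  also have "\<dots> = ennreal B" using k(5) by simp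
  finally have le: "(\<integral>\<^sup>+x. ennreal ((norm (?c x - w x))\<^sup>2) \<partial>leb n) \<le> ennreal B" .
  have i: "integrable (leb n) (\<lambda>x. (norm (?c x - w x))\<^sup>2)"
    using le by (intro integrableI_nonneg) (auto simp: order_le_less_trans[OF _ ennreal_less_top])
  then show "(\<lambda>x. ?c x - w x) \<in> L2 n" by (simp add: L2_iff)
  have "ennreal (L2sq n (\<lambda>x. ?c x - w x)) \<le> ennreal B"
    using le i by (subst (asm) nn_integral_eq_integral) auto
  then show "L2sq n (\<lambda>x. ?c x - w x) \<le> B" using Bpos by (simp add: ennreal_le_iff)
qed

lemma L1_loc_int: "integrable (leb n) w \<Longrightarrow> loc_int n w"
  unfolding loc_int_def
proof (intro conjI allI)
  fix R assume w: "integrable (leb n) w"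
  show "integrable (leb n) (\<lambda>x. indicator (box_n n R) x * norm (w x))"
    using integrable_mult_indicator[OF sets_box_n[of n R] integrable_norm[OF w]] by (simp add: real_scaleR_def)
qed auto

lemma conv_L1:
  assumes w: "integrable (leb n) w" and k: "(\<lambda>x. complex_of_real (k x)) \<in> test n"
      "\<And>x. 0 \<le> k x" "integrable (leb n) k" "(\<integral>x. k x \<partial>leb n) = 1"
  shows "integrable (leb n) (conv n (\<lambda>x. complex_of_real (k x)) w)"
    and "L1norm n (\<lambda>x. conv n (\<lambda>x. complex_of_real (k x)) w x) \<le> L1norm n w"
proof -
  interpret P: pair_sigma_finite "leb n" "leb n" by (rule pair_sigma_finite_leb)
  let ?c = "conv n (\<lambda>x. complex_of_real (k x)) w"
  have wl: "loc_int n w" by (rule L1_loc_int[OF w])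
  have wm [measurable]: "w \<in> borel_measurable (leb n)" using w by auto
  have km [measurable]: "k \<in> borel_measurable (leb n)" using k(3) by auto
  have cm [measurable]: "?c \<in> borel_measurable (leb n)" by (rule conv_measurable[OF wl k(1)])
  have k1: "(\<integral>\<^sup>+x. ennreal (k x) \<partial>leb n) = 1"
    using k by (subst nn_integral_eq_integral) auto
  have "(\<integral>\<^sup>+x. ennreal (norm (?c x)) \<partial>leb n) \<le> (\<integral>\<^sup>+x. \<integral>\<^sup>+y. ennreal (norm (w y)) * ennreal (k (aff n (- 1) x y)) \<partial>leb n \<partial>leb n)"
  proof (rule nn_integral_mono)
    fix x
    have "ennreal (norm (?c x)) \<le> (\<integral>\<^sup>+y. ennreal (norm (w y * complex_of_real (k (aff n (- 1) x y)))) \<partial>leb n)"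
      unfolding conv_def by (rule integral_norm_bound_ennreal[OF test_loc_int_integrable[OF wl k(1)]])
    then show "ennreal (norm (?c x)) \<le> (\<integral>\<^sup>+y. ennreal (norm (w y)) * ennreal (k (aff n (- 1) x y)) \<partial>leb n)"
      using k(2) by (simp add: norm_mult ennreal_mult)
  qed
  also have "\<dots> = (\<integral>\<^sup>+y. \<integral>\<^sup>+x. ennreal (norm (w y)) * ennreal (k (aff n (- 1) x y)) \<partial>leb n \<partial>leb n)"
    by (rule P.Fubini'[symmetric]) measurable
  also have "\<dots> = (\<integral>\<^sup>+y. ennreal (norm (w y)) \<partial>leb n)"
  proof (rule nn_integral_cong)
    fix y
    have "(\<integral>\<^sup>+x. ennreal (k (aff n (- 1) x y)) \<partial>leb n) = (\<integral>\<^sup>+x. ennreal (k x) \<partial>leb n)"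
      unfolding aff_minus_eq by (rule nn_integral_aff) auto
    then show "(\<integral>\<^sup>+x. ennreal (norm (w y)) * ennreal (k (aff n (- 1) x y)) \<partial>leb n) = ennreal (norm (w y))"
      using k1 unfolding aff_minus_eq by (subst nn_integral_cmult) auto
  qed
  also have "\<dots> = ennreal (L1norm n w)"
    using w by (intro nn_integral_eq_integral) auto
  finally have le: "(\<integral>\<^sup>+x. ennreal (norm (?c x)) \<partial>leb n) \<le> ennreal (L1norm n w)" .
  then show i: "integrable (leb n) ?c"
    by (intro integrableI_bounded cm) (auto simp: order_le_less_trans[OF _ ennreal_less_top])
  have "ennreal (L1norm n ?c) \<le> ennreal (L1norm n w)"
    using le i by (subst (asm) nn_integral_eq_integral) auto
  then show "L1norm n ?c \<le> L1norm n w" by (simp add: ennreal_le_iff)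
qed

lemma conv_sup:
  assumes w: "integrable (leb n) w" and k: "(\<lambda>x. complex_of_real (k x)) \<in> test n" "\<And>x. 0 \<le> k x" "\<And>x. k x \<le> S"
  shows "norm (conv n (\<lambda>x. complex_of_real (k x)) w x) \<le> S * L1norm n w"
proof -
  have "norm (conv n (\<lambda>x. complex_of_real (k x)) w x) \<le> L1norm n (\<lambda>y. w y * complex_of_real (k (aff n (- 1) x y)))"
    unfolding conv_def by (rule integral_norm_bound)
  also have "\<dots> \<le> (\<integral>y. S * norm (w y) \<partial>leb n)"
  proof (rule integral_mono)
    show "integrable (leb n) (\<lambda>y. norm (w y * complex_of_real (k (aff n (- 1) x y))))"
      by (intro integrable_norm test_loc_int_integrable[OF L1_loc_int[OF w] k(1)])
    show "norm (w y * complex_of_real (k (aff n (- 1) x y))) \<le> S * norm (w y)" for y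
      using mult_right_mono[OF k(3)[of "aff n (- 1) x y"], of "norm (w y)"] k(2) by (simp add: norm_mult mult.commute)
  qed (use w in auto)
  also have "\<dots> = S * L1norm n w" by simp
  finally show ?thesis .
qed

text \<open>
  Compare \<open>v\<close> with its average over distance \<open>l\<close>. The average is bounded by \<open>(exp 4 / l)\<^sup>n \<parallel>v\<parallel>\<^sub>1\<close> and has
  no larger \<open>L\<^sup>1\<close> norm, which bounds its square integral; the error is bounded by the
  translation estimate. Optimising over \<open>l\<close> would give the multiplicative form of Nash's inequality.
\<close>

lemma nash_inequality:
  assumes v: "sob n v G" and v1: "integrable (leb n) v" and l: "l > 0"
  shows "L2sq n v \<le> 2 * ((exp 4 / l) ^ n * (L1norm n v)\<^sup>2)
     + 2 * (n * (l\<^sup>2 * (\<Sum>i<n. L2sq n (G i))))"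
proof -
  have vL: "v \<in> L2 n" using v by (simp add: sob_def)
  obtain k where k: "(\<lambda>x. complex_of_real (k x)) \<in> test n" "off_box n l (\<lambda>x. complex_of_real (k x))"
    "\<And>x. 0 \<le> k x" "\<And>x. k x \<le> (exp 4 / l) ^ n" "integrable (leb n) k" "(\<integral>x. k x \<partial>leb n) = 1"
    using mollifier_exists[OF l] by blast
  let ?c = "conv n (\<lambda>x. complex_of_real (k x)) v" and ?N = "L1norm n v"
  let ?B = "n * (l\<^sup>2 * (\<Sum>i<n. L2sq n (G i)))" and ?S = "(exp 4 / l) ^ n"
  have S0: "?S \<ge> 0" using l by simp
  have B: "L2sq n (\<lambda>x. v (aff n 1 c x) - v x) \<le> ?B" if "\<forall>i<n. \<bar>c i\<bar> \<le> l" for c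
    by (rule translation_bound_box[OF v]) (use that in auto)
  have cl: "(\<lambda>x. ?c x - v x) \<in> L2 n" "L2sq n (\<lambda>x. ?c x - v x) \<le> ?B"
    by (rule conv_close[OF vL k(1,2,3,5,6) B]; simp)+
  note c1 = conv_L1[OF v1 k(1,3,5,6)]
  have sup: "norm (?c x) \<le> ?S * ?N" for x by (rule conv_sup[OF v1 k(1,3,4)])
  have "?c \<in> L2 n" using L2_add[OF cl(1) vL] by simp
  have "L2sq n ?c \<le> (\<integral>x. ?S * ?N * norm (?c x) \<partial>leb n)"
  proof (rule integral_mono)
    show "(norm (?c x))\<^sup>2 \<le> ?S * ?N * norm (?c x)" for x
      unfolding power2_eq_square by (intro mult_right_mono sup) auto
  qed (use L2_integrable[OF \<open>?c \<in> L2 n\<close>] c1(1) in auto)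
  also have "\<dots> \<le> ?S * ?N * ?N"
    using c1(2) S0 by (auto intro!: mult_left_mono mult_nonneg_nonneg)
  finally have 1: "L2sq n ?c \<le> ?S * ?N\<^sup>2" by (simp add: power2_eq_square mult.assoc)
  have "L2sq n (\<lambda>x. ?c x + (- 1) * (?c x - v x))
      \<le> 2 * L2sq n ?c + 2 * L2sq n (\<lambda>x. (- 1) * (?c x - v x))"
    by (rule L2_integral_add_le[OF \<open>?c \<in> L2 n\<close> L2_cmult[OF cl(1)]])
  moreover have "(\<lambda>x. (norm ((- 1) * (?c x - v x)))\<^sup>2) = (\<lambda>x. (norm (?c x - v x))\<^sup>2)"
    by (simp only: norm_mult norm_minus_cancel norm_one mult_1_left)
  moreover have "?c x + (- 1) * (?c x - v x) = v x" for x by simp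
  ultimately have "L2sq n v \<le> 2 * L2sq n ?c + 2 * L2sq n (\<lambda>x. ?c x - v x)"
    by (simp only:)
  moreover have "c \<le> 2 * a + 2 * b \<Longrightarrow> a \<le> x \<Longrightarrow> b \<le> y \<Longrightarrow> c \<le> 2 * x + 2 * y" for a b c x y :: real by linarith
  ultimately show ?thesis using 1 cl(2) by blast
qed

section \<open>Approximation by test functions\<close>

text \<open>
  The square of the \<open>H\<^sup>1\<close> norm, for a gradient of the caller's choice.
\<close>

definition energy :: "nat \<Rightarrow> ((nat \<Rightarrow> real) \<Rightarrow> complex) \<Rightarrow> (nat \<Rightarrow> (nat \<Rightarrow> real) \<Rightarrow> complex) \<Rightarrow> real" where
  "energy n v G = L2sq n v + (\<Sum>i<n. L2sq n (G i))"

lemma H1_norm_energy: "sob n v G \<Longrightarrow> H1_norm n v = sqrt (energy n v G)"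
  by (simp add: H1_norm_sob energy_def)

lemma energy_nonneg: "0 \<le> energy n v G"
  unfolding energy_def by (intro add_nonneg_nonneg sum_nonneg) auto

lemma sob_L2: "sob n v G \<Longrightarrow> v \<in> L2 n" "sob n v G \<Longrightarrow> i < n \<Longrightarrow> G i \<in> L2 n"
  by (auto simp: sob_def)

lemma energy_add:
  assumes "sob n v G" "sob n w H"
  shows "energy n (\<lambda>x. v x + w x) (\<lambda>i x. G i x + H i x) \<le> 2 * energy n v G + 2 * energy n w H"
proof -
  have 1: "L2sq n (\<lambda>x. v x + w x) \<le> 2 * L2sq n v + 2 * L2sq n w"
    using assms by (intro L2_integral_add_le sob_L2)
  have "(\<Sum>i<n. L2sq n (\<lambda>x. G i x + H i x))
      \<le> (\<Sum>i<n. 2 * L2sq n (G i) + 2 * L2sq n (H i))"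
    using assms by (intro sum_mono L2_integral_add_le sob_L2) auto
  also have "\<dots> = 2 * (\<Sum>i<n. L2sq n (G i)) + 2 * (\<Sum>i<n. L2sq n (H i))"
    by (simp add: sum.distrib sum_distrib_left)
  finally show ?thesis using 1 unfolding energy_def by (simp only: distrib_left)
qed

lemma common_delta:
  fixes P :: "nat \<Rightarrow> real \<Rightarrow> bool"
  assumes "\<And>i. i < m \<Longrightarrow> \<exists>\<delta>>0. P i \<delta>" "\<And>i \<delta> \<delta>'. P i \<delta> \<Longrightarrow> 0 < \<delta>' \<Longrightarrow> \<delta>' \<le> \<delta> \<Longrightarrow> P i \<delta>'"
  shows "\<exists>\<delta>>0. \<forall>i<m. P i \<delta>"
  using assms(1)
proof (induction m)
  case 0 then show ?case by (auto intro: exI[of _ 1])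
next
  case (Suc m)
  then obtain d1 d2 where d: "d1 > 0" "\<forall>i<m. P i d1" "d2 > 0" "P m d2" by (metis less_Suc_eq)
  have "P i (min d1 d2)" if "i < Suc m" for i
  proof (cases "i = m")
    case True then show ?thesis using assms(2)[OF d(4), of "min d1 d2"] d by simp
  next
    case False
    then have "P i d1" using d that by simp
    from assms(2)[OF this, of "min d1 d2"] d show ?thesis by simp
  qed
  then show ?case using d by (intro exI[of _ "min d1 d2"]) auto
qed

lemma conv_off_box:
  assumes w: "off_box n R w" and k: "off_box n e k"
  shows "off_box n (R + e) (conv n k w)"
  unfolding off_box_def
proof (intro ballI impI)
  fix x assume x: "x \<in> Rn n" "\<exists>i<n. R + e < \<bar>x i\<bar>"
  then obtain i where i: "i < n" "R + e < \<bar>x i\<bar>" by blast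
  have "w y * k (aff n (- 1) x y) = 0" if y: "y \<in> Rn n" for y
  proof (cases "\<bar>y i\<bar> > R")
    case True then show ?thesis using w y i(1) unfolding off_box_def by auto
  next
    case False
    then have "\<bar>aff n (- 1) x y i\<bar> > e" using i by auto
    then have "k (aff n (- 1) x y) = 0" using k i(1) aff_in_Rn[of n "- 1" x y] unfolding off_box_def by blast
    then show ?thesis by simp
  qed
  then have "conv n k w x = (\<integral>y. 0 \<partial>leb n)"
    unfolding conv_def by (intro Bochner_Integration.integral_cong) auto
  then show "conv n k w x = 0" by simp
qed

lemma conv_half_space:
  assumes w: "AE x in leb n. s * x i < \<rho> \<longrightarrow> w x = 0" and k: "off_box n e k" and i: "i < n" and s: "s = 1 \<or> s = - 1"
    and x: "x \<in> Rn n" "s * x i < \<rho> - e"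
  shows "conv n k w x = 0"
proof -
  have "AE y in leb n. w y * k (aff n (- 1) x y) = 0"
    using w
  proof (rule AE_mp, intro AE_I2 impI)
    fix y assume y: "s * y i < \<rho> \<longrightarrow> w y = 0"
    show "w y * k (aff n (- 1) x y) = 0"
    proof (cases "s * y i < \<rho>")
      case False
      then have "\<bar>aff n (- 1) x y i\<bar> > e" using x(2) i s by auto
      then have "k (aff n (- 1) x y) = 0" using k i aff_in_Rn[of n "- 1" x y] unfolding off_box_def by blast
      then show ?thesis by simp
    qed (use y in simp)
  qed
  then show ?thesis unfolding conv_def by (rule integral_eq_zero_AE)
qed

text \<open>
  Mollification commutes with weak derivatives, so one kernel of small radius approximates \<open>w\<close> and its
  finitely many derivatives at once.
\<close>

lemma sob_mollify:
  assumes w: "sob n w H" and w1: "integrable (leb n) w" and R: "off_box n R w" and e: "e > 0" and d: "d > 0"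
  obtains k where "off_box n d k" "conv n k w \<in> test n" "L1norm n (conv n k w) \<le> L1norm n w"
    "energy n (\<lambda>x. w x - conv n k w x) (\<lambda>i x. H i x - partial_deriv i (conv n k w) x) < e"
proof -
  \<comment> \<open>Index \<open>n\<close> stands for the function itself, so that one common radius serves for all.\<close>
  define f where "f i = (if i < n then H i else w)" for i
  have fL: "f i \<in> L2 n" for i using sob_L2[OF w] by (auto simp: f_def)
  \<comment> \<open>The sum of the \<open>n + 1\<close> square integrals has to stay strictly below \<open>e\<close>.\<close>
  define e' where "e' = e / (n + 2)"
  have e': "e' > 0" using e by (simp add: e'_def)
  have "\<exists>\<delta>>0. \<forall>i<Suc n. \<forall>c. (\<forall>j<n. \<bar>c j\<bar> \<le> \<delta>) \<longrightarrow> L2sq n (\<lambda>x. f i (aff n 1 c x) - f i x) < e'"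
    by (rule common_delta[where P = "\<lambda>i \<delta>. \<forall>c. (\<forall>j<n. \<bar>c j\<bar> \<le> \<delta>) \<longrightarrow> L2sq n (\<lambda>x. f i (aff n 1 c x) - f i x) < e'"])
       (use L2_translation_continuous[OF fL e'] order_trans in \<open>blast+\<close>)
  then obtain \<delta> where \<delta>: "\<delta> > 0" "\<And>i c. i < Suc n \<Longrightarrow> \<forall>j<n. \<bar>c j\<bar> \<le> \<delta> \<Longrightarrow> (L2sq n (\<lambda>x. f i (aff n 1 c x) - f i x)) < e'"
    by blast
  define d' where "d' = min d \<delta>"
  have d': "d' > 0" "d' \<le> d" "d' \<le> \<delta>" using d \<delta>(1) by (auto simp: d'_def)
  obtain k where k: "(\<lambda>x. complex_of_real (k x)) \<in> test n" "off_box n d' (\<lambda>x. complex_of_real (k x))"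
    "\<And>x. 0 \<le> k x" "integrable (leb n) k" "(\<integral>x. k x \<partial>leb n) = 1"
    using mollifier_exists[OF d'(1)] by blast
  let ?k = "\<lambda>x. complex_of_real (k x)"
  have wl: "loc_int n w" by (rule L2_loc_int[OF sob_L2(1)[OF w]])
  have close: "L2sq n (\<lambda>x. f i x - conv n ?k (f i) x) \<le> e'" if "i < Suc n" for i
  proof -
    have "L2sq n (\<lambda>x. conv n ?k (f i) x - f i x) \<le> e'"
    proof (rule conv_close(2)[OF fL k(1,2,3,4,5)])
      fix c :: "nat \<Rightarrow> real" assume "\<forall>i<n. \<bar>c i\<bar> \<le> d'"
      then have "\<forall>i<n. \<bar>c i\<bar> \<le> \<delta>" using d'(3) order_trans by blast
      from \<delta>(2)[OF that this] show "L2sq n (\<lambda>x. f i (aff n 1 c x) - f i x) \<le> e'" by simp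
    qed
    then show ?thesis by (simp only: norm_minus_commute)
  qed
  show ?thesis
  proof (rule that[of ?k])
    show "off_box n d ?k" by (rule off_box_mono[OF k(2) d'(2)])
    show "conv n ?k w \<in> test n"
      unfolding test_iff using Csmooth_conv[OF wl k(1)] conv_off_box[OF R k(2)] by blast
    show "L1norm n (conv n ?k w) \<le> L1norm n w"
      by (rule conv_L1(2)[OF w1 k(1,3,4,5)])
    have "L2sq n (\<lambda>x. w x - conv n ?k w x) \<le> e'"
      using close[of n] by (simp add: f_def)
    moreover have "L2sq n (\<lambda>x. H i x - partial_deriv i (conv n ?k w) x) \<le> e'" if i: "i < n" for i
    proof -
      have "weak_partial n i w (H i)" using w i by (simp add: sob_def)
      then have "L2sq n (\<lambda>x. H i x - partial_deriv i (conv n ?k w) x) = L2sq n (\<lambda>x. H i x - conv n ?k (H i) x)"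
        using partial_deriv_conv_weak[OF wl k(1) i] by (intro Bochner_Integration.integral_cong) auto
      then show ?thesis using close[of i] i by (simp add: f_def)
    qed
    then have "(\<Sum>i<n. L2sq n (\<lambda>x. H i x - partial_deriv i (conv n ?k w) x)) \<le> (\<Sum>i<n. e')"
      by (intro sum_mono) auto
    ultimately have "energy n (\<lambda>x. w x - conv n ?k w x) (\<lambda>i x. H i x - partial_deriv i (conv n ?k w) x) \<le> (n + 1) * e'"
      unfolding energy_def by (simp add: algebra_simps)
    also have "\<dots> < e" using e by (simp add: e'_def field_simps)
    finally show "energy n (\<lambda>x. w x - conv n ?k w x) (\<lambda>i x. H i x - partial_deriv i (conv n ?k w) x) < e" .
  qed
qed

text \<open>
  A bump function normalised to \<open>1\<close> at the origin and dilated by the factor \<open>j + 1\<close>. It need not equal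
  \<open>1\<close> near the origin, since its dilations tend to \<open>1\<close> pointwise.
\<close>

definition cutoff :: "nat \<Rightarrow> nat \<Rightarrow> (nat \<Rightarrow> real) \<Rightarrow> complex" where
  "cutoff n j x = complex_of_real (exp 2 ^ n * bump_n n 1 (aff n (1 / real (Suc j)) (\<lambda>_. 0) x))"

lemma bump_le_centre: "bump 1 t \<le> exp (- 2)"
proof (cases "\<bar>t\<bar> < 1")
  case True
  then have t: "1 + t > 0" "1 - t > 0" by auto
  have "0 < (1 + t) * (1 - t)" using t by simp
  moreover have "(1 + t) * (1 - t) \<le> 1" by (simp add: algebra_simps)
  ultimately have "1 / 1 \<le> 1 / ((1 + t) * (1 - t))" by (intro frac_le) auto
  moreover have "1 / (1 + t) + 1 / (1 - t) = 2 * (1 / ((1 + t) * (1 - t)))"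
    using t by (simp add: field_simps)
  ultimately have "1 / (1 + t) + 1 / (1 - t) \<ge> 2" by linarith
  then show ?thesis using t by (simp add: bump_def ramp_0 flip: exp_add)
next
  case False
  then show ?thesis using bump_zero[of 1 t] by simp
qed

lemma cutoff_bounds: "norm (cutoff n j x) \<le> 1"
proof -
  have "bump_n n 1 y \<le> exp (- 2) ^ n" for y
    unfolding bump_n_def using prod_mono[of "{..<n}" "\<lambda>i. bump 1 (y i)" "\<lambda>_. exp (- 2)"]
    by (simp add: bump_bounds bump_le_centre)
  then have "exp 2 ^ n * bump_n n 1 y \<le> exp 2 ^ n * exp (- 2) ^ n" for y by (intro mult_left_mono) auto
  also have "exp 2 ^ n * exp (- 2) ^ n = (1::real)" by (simp flip: power_mult_distrib exp_add)
  finally show ?thesis unfolding cutoff_def norm_of_real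
    using bump_n_bounds(1)[of n 1] by (simp add: abs_mult)
qed

lemma cutoff_smooth: "Csmooth n (cutoff n j)"
proof -
  have "Csmooth n (\<lambda>x. complex_of_real (exp 2 ^ n) * complex_of_real (bump_n n 1 (aff n (1 / real (Suc j)) (\<lambda>_. 0) x)))"
    by (intro Csmooth_mult Csmooth_const Csmooth_aff[OF bump_n_smooth])
  then show ?thesis by (simp add: cutoff_def[abs_def])
qed

lemma cutoff_off_box: "off_box n (real (Suc j)) (cutoff n j)"
  unfolding off_box_def
proof (intro ballI impI)
  fix x assume "x \<in> Rn n" "\<exists>i<n. real (Suc j) < \<bar>x i\<bar>"
  then obtain i where i: "i < n" "real (Suc j) < \<bar>x i\<bar>" by blast
  then have "1 < \<bar>aff n (1 / real (Suc j)) (\<lambda>_. 0) x i\<bar>" by (simp add: abs_mult)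
  with bump_n_off_box[of 1 n] i(1) aff_in_Rn
  have "complex_of_real (bump_n n 1 (aff n (1 / real (Suc j)) (\<lambda>_. 0) x)) = 0" unfolding off_box_def by (metis zero_less_one)
  then show "cutoff n j x = 0" by (simp add: cutoff_def)
qed

lemma cutoff_deriv: "\<exists>C\<ge>0. \<forall>j. \<forall>i<n. \<forall>x\<in>Rn n. norm (partial_deriv i (cutoff n j) x) \<le> C / real (Suc j)"
proof -
  define b where "b = (\<lambda>x. complex_of_real (exp 2 ^ n) * complex_of_real (bump_n n 1 x))"
  have b: "b \<in> test n" unfolding b_def by (intro test_cmult bump_n_test) simp
  have "\<forall>i. \<exists>C. i < n \<longrightarrow> (\<forall>x\<in>Rn n. norm (partial_deriv i b x) \<le> C)"
    using test_bounded[OF test_partial[OF b]] by blast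
  then obtain C where C: "\<And>i x. i < n \<Longrightarrow> x \<in> Rn n \<Longrightarrow> norm (partial_deriv i b x) \<le> C i" by metis
  obtain Q where Q: "\<forall>i<n. \<bar>C i\<bar> \<le> Q" using bound_finite by blast
  have cb: "cutoff n j = (\<lambda>x. b (aff n (1 / real (Suc j)) (\<lambda>_. 0) x))" for j
    by (simp add: cutoff_def[abs_def] b_def)
  show ?thesis
  proof (intro exI[of _ "max Q 0"] conjI allI impI ballI)
    fix j i x assume i: "i < n" and x: "x \<in> Rn n"
    have "partial_deriv i (cutoff n j) x = (1 / real (Suc j)) * partial_deriv i b (aff n (1 / real (Suc j)) (\<lambda>_. 0) x)"
      unfolding cb using b by (subst partial_deriv_aff[OF _ i x]) (auto simp: test_iff)
    then have "norm (partial_deriv i (cutoff n j) x) = norm (partial_deriv i b (aff n (1 / real (Suc j)) (\<lambda>_. 0) x)) / real (Suc j)"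
      by (simp only: norm_mult norm_of_real) simp
    also have "\<dots> \<le> max Q 0 / real (Suc j)"
    proof (rule divide_right_mono)
      have "norm (partial_deriv i b (aff n (1 / real (Suc j)) (\<lambda>_. 0) x)) \<le> C i" by (rule C[OF i aff_in_Rn])
      moreover have "\<bar>C i\<bar> \<le> Q" using Q i by blast
      ultimately show "norm (partial_deriv i b (aff n (1 / real (Suc j)) (\<lambda>_. 0) x)) \<le> max Q 0" by linarith
    qed simp
    finally show "norm (partial_deriv i (cutoff n j) x) \<le> max Q 0 / real (Suc j)" .
  qed auto
qed

lemma cutoff_tendsto: "(\<lambda>j. cutoff n j x) \<longlonglongrightarrow> 1"
proof -
  have rc: "isCont (ramp 0) 1"
    using derivs_cont[OF derivs_ramp, of UNIV 0] by (simp add: continuous_on_eq_continuous_at)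
  have b: "(\<lambda>j. bump 1 (1 / real (Suc j) * x i + 0)) \<longlonglongrightarrow> exp (- 2)" for i
  proof -
    have z: "(\<lambda>j. 1 / real (Suc j)) \<longlonglongrightarrow> 0" using lim_1_over_n[THEN LIMSEQ_Suc] by simp
    have "(\<lambda>j. 1 + (1 / real (Suc j) * x i + 0) / 1) \<longlonglongrightarrow> 1 + (0 * x i + 0) / 1"
      "(\<lambda>j. 1 - (1 / real (Suc j) * x i + 0) / 1) \<longlonglongrightarrow> 1 - (0 * x i + 0) / 1"
      by (intro tendsto_intros z; simp)+
    then have "(\<lambda>j. bump 1 (1 / real (Suc j) * x i + 0)) \<longlonglongrightarrow> ramp 0 1 * ramp 0 1"
      unfolding bump_def by (intro tendsto_mult isCont_tendsto_compose[OF rc]) simp_all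
    also have "ramp 0 1 * ramp 0 1 = exp (- 2)" by (simp add: ramp_0 flip: exp_add)
    finally show ?thesis .
  qed
  have "(\<lambda>j. cutoff n j x) \<longlonglongrightarrow> complex_of_real (exp 2 ^ n * (\<Prod>i<n. exp (- 2)))"
    unfolding cutoff_def bump_n_def
    by (intro tendsto_intros tendsto_of_real tendsto_prod) (use b in simp)
  also have "complex_of_real (exp 2 ^ n * (\<Prod>i<n. exp (- 2))) = 1" by (simp flip: power_mult_distrib exp_add)
  finally show ?thesis .
qed

lemma cutoff_L2_tendsto:
  assumes f: "f \<in> L2 n"
  shows "(\<lambda>j. L2sq n (\<lambda>x. f x - cutoff n j x * f x)) \<longlonglongrightarrow> 0"
proof -
  have m: "f \<in> borel_measurable (leb n)" "cutoff n j \<in> borel_measurable (leb n)" for j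
    using L2_measurable[OF f] Csmooth_measurable[OF cutoff_smooth] by auto
  have "(\<lambda>j. L2sq n (\<lambda>x. f x - cutoff n j x * f x)) \<longlonglongrightarrow> (\<integral>x. 0 \<partial>leb n)"
  proof (rule integral_dominated_convergence[where w = "\<lambda>x. 4 * (norm (f x))\<^sup>2"])
    show "integrable (leb n) (\<lambda>x. 4 * (norm (f x))\<^sup>2)" using L2_integrable[OF f] by simp
    show "AE x in leb n. (\<lambda>j. (norm (f x - cutoff n j x * f x))\<^sup>2) \<longlonglongrightarrow> 0"
    proof (rule AE_I2)
      fix x
      have "(\<lambda>j. (norm (f x - cutoff n j x * f x))\<^sup>2) \<longlonglongrightarrow> (norm (f x - 1 * f x))\<^sup>2"
        by (intro tendsto_intros cutoff_tendsto)
      then show "(\<lambda>j. (norm (f x - cutoff n j x * f x))\<^sup>2) \<longlonglongrightarrow> 0" by simp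
    qed
    show "AE x in leb n. norm ((norm (f x - cutoff n j x * f x))\<^sup>2) \<le> 4 * (norm (f x))\<^sup>2" for j
    proof (rule AE_I2)
      fix x
      have "norm (cutoff n j x * f x) \<le> norm (f x)"
        using mult_right_mono[OF cutoff_bounds, of "norm (f x)" n j x] by (simp add: norm_mult)
      then have "(norm (cutoff n j x * f x))\<^sup>2 \<le> (norm (f x))\<^sup>2" by (intro power_mono) auto
      with norm_diff_sq[of "f x" "cutoff n j x * f x"]
      have "(norm (f x - cutoff n j x * f x))\<^sup>2 \<le> 4 * (norm (f x))\<^sup>2" by linarith
      then show "norm ((norm (f x - cutoff n j x * f x))\<^sup>2) \<le> 4 * (norm (f x))\<^sup>2" by simp
    qed
  qed (use m in measurable)
  then show ?thesis by simp
qed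

lemma sob_truncate:
  assumes v: "sob n v G" and e: "e > 0"
  shows "\<exists>j H. sob n (\<lambda>x. cutoff n j x * v x) H \<and> energy n (\<lambda>x. v x - cutoff n j x * v x) (\<lambda>i x. G i x - H i x) < e"
proof -
  obtain C where C0: "C \<ge> 0 \<and> (\<forall>j. \<forall>i<n. \<forall>x\<in>Rn n. norm (partial_deriv i (cutoff n j) x) \<le> C / real (Suc j))"
    using cutoff_deriv[of n] by (elim exE)
  have C: "norm (partial_deriv i (cutoff n j) x) \<le> C / real (Suc j)" if "i < n" "x \<in> Rn n" for i j x
    using conjunct2[OF C0] that by (elim allE[of _ j] allE[of _ i] impE bspec)
  define H where "H j i x = cutoff n j x * G i x + partial_deriv i (cutoff n j) x * v x" for j i x
  have vL: "v \<in> L2 n" by (rule sob_L2[OF v])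
  have s: "sob n (\<lambda>x. cutoff n j x * v x) (H j)" for j
    unfolding H_def by (rule sob_smooth_mult[OF v cutoff_smooth cutoff_bounds]) (rule C)
  let ?V = "L2sq n v"
  have bd: "L2sq n (\<lambda>x. G i x - H j i x)
      \<le> 2 * L2sq n (\<lambda>x. G i x - cutoff n j x * G i x) + 2 * ((C / real (Suc j))\<^sup>2 * ?V)" if i: "i < n" for i j
  proof -
    have GL: "G i \<in> L2 n" by (rule sob_L2(2)[OF v i])
    have L1: "(\<lambda>x. G i x - cutoff n j x * G i x) \<in> L2 n"
      by (intro L2_diff GL L2_mult[OF Csmooth_measurable[OF cutoff_smooth] cutoff_bounds])
    have L2: "(\<lambda>x. partial_deriv i (cutoff n j) x * v x) \<in> L2 n"
      by (rule L2_mult[OF Csmooth_measurable[OF Csmooth_partial[OF cutoff_smooth i]] C[OF i] vL])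
    have "L2sq n (\<lambda>x. partial_deriv i (cutoff n j) x * v x) \<le> (\<integral>x. (C / real (Suc j))\<^sup>2 * (norm (v x))\<^sup>2 \<partial>leb n)"
    proof (rule integral_mono[OF L2_integrable[OF L2]])
      fix x assume "x \<in> space (leb n)"
      then have "norm (partial_deriv i (cutoff n j) x) \<le> C / real (Suc j)" using C[OF i] by simp
      then show "(norm (partial_deriv i (cutoff n j) x * v x))\<^sup>2 \<le> (C / real (Suc j))\<^sup>2 * (norm (v x))\<^sup>2"
        unfolding norm_mult power_mult_distrib by (intro mult_right_mono power_mono) auto
    qed (use L2_integrable[OF vL] in simp)
    also have "\<dots> = (C / real (Suc j))\<^sup>2 * ?V" by simp
    finally have "L2sq n (\<lambda>x. (- 1) * (partial_deriv i (cutoff n j) x * v x)) \<le> (C / real (Suc j))\<^sup>2 * ?V"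
      by (simp add: norm_mult)
    moreover have "L2sq n (\<lambda>x. G i x - cutoff n j x * G i x + (- 1) * (partial_deriv i (cutoff n j) x * v x))
        \<le> 2 * L2sq n (\<lambda>x. G i x - cutoff n j x * G i x) + 2 * L2sq n (\<lambda>x. (- 1) * (partial_deriv i (cutoff n j) x * v x))"
      by (rule L2_integral_add_le[OF L1 L2_cmult[OF L2]])
    moreover have "G i x - cutoff n j x * G i x + (- 1) * (partial_deriv i (cutoff n j) x * v x) = G i x - H j i x" for x
      by (simp add: H_def)
    moreover have "a \<le> 2 * b + 2 * c \<Longrightarrow> c \<le> d \<Longrightarrow> a \<le> 2 * b + 2 * d" for a b c d :: real by linarith
    ultimately show ?thesis by (simp only:)
  qed
  have "(\<lambda>j. (L2sq n (\<lambda>x. v x - cutoff n j x * v x)) +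
      (\<Sum>i<n. 2 * L2sq n (\<lambda>x. G i x - cutoff n j x * G i x) + 2 * ((C / real (Suc j))\<^sup>2 * ?V)))
      \<longlonglongrightarrow> 0 + (\<Sum>i<n. 2 * 0 + 2 * (0\<^sup>2 * ?V))"
  proof (intro tendsto_add tendsto_sum tendsto_mult tendsto_const tendsto_power)
    show "(\<lambda>j. C / real (Suc j)) \<longlonglongrightarrow> 0"
      using tendsto_mult[OF tendsto_const[of C] lim_1_over_n[THEN LIMSEQ_Suc]] by simp
    show "(\<lambda>j. L2sq n (\<lambda>x. v x - cutoff n j x * v x)) \<longlonglongrightarrow> 0" by (rule cutoff_L2_tendsto[OF vL])
    show "(\<lambda>j. L2sq n (\<lambda>x. G i x - cutoff n j x * G i x)) \<longlonglongrightarrow> 0" if "i \<in> {..<n}" for i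
      using that by (intro cutoff_L2_tendsto sob_L2(2)[OF v]) simp
  qed
  then have "\<forall>\<^sub>F j in sequentially. (L2sq n (\<lambda>x. v x - cutoff n j x * v x)) +
      (\<Sum>i<n. 2 * L2sq n (\<lambda>x. G i x - cutoff n j x * G i x) + 2 * ((C / real (Suc j))\<^sup>2 * ?V)) < e"
    using e by (intro order_tendstoD(2)) auto
  then obtain j where j: "L2sq n (\<lambda>x. v x - cutoff n j x * v x) +
      (\<Sum>i<n. 2 * L2sq n (\<lambda>x. G i x - cutoff n j x * G i x) + 2 * ((C / real (Suc j))\<^sup>2 * ?V)) < e"
    using eventually_happens by force
  have "energy n (\<lambda>x. v x - cutoff n j x * v x) (\<lambda>i x. G i x - H j i x) \<le> L2sq n (\<lambda>x. v x - cutoff n j x * v x) +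
      (\<Sum>i<n. 2 * L2sq n (\<lambda>x. G i x - cutoff n j x * G i x) + 2 * ((C / real (Suc j))\<^sup>2 * ?V))"
    unfolding energy_def by (intro add_left_mono sum_mono bd) auto
  with j s show ?thesis by (meson le_less_trans)
qed

lemma sob_diff: "sob n v G \<Longrightarrow> sob n w H \<Longrightarrow> sob n (\<lambda>x. v x - w x) (\<lambda>i x. G i x - H i x)"
  using sob_add_cmult[of n v G w H "- 1"] by simp

text \<open>
  Truncation by \<open>cutoff\<close> keeps the zero set, and mollification with radius at most \<open>\<rho> - r\<close>
  moves the boundary of the half-space by no more than that. Neither increases the \<open>L\<^sup>1\<close> norm, which makes the
  resulting bound on \<open>F\<close> independent of the dimension.
\<close>

lemma sob_half_space_approx:
  assumes v: "sob n v G" and v1: "integrable (leb n) v" and i: "i < n" and s: "s = 1 \<or> s = - 1"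
    and z: "AE x in leb n. s * x i < \<rho> \<longrightarrow> v x = 0" and r: "r < \<rho>" and e: "e > 0"
  obtains \<psi> where "\<psi> \<in> test n" "\<forall>x\<in>Rn n. s * x i < r \<longrightarrow> \<psi> x = 0"
    "L1norm n \<psi> \<le> L1norm n v" "(\<lambda>x. v x - \<psi> x) \<in> H1 n" "H1_norm n (\<lambda>x. v x - \<psi> x) < e"
proof -
  have e4: "e\<^sup>2 / 4 > 0" using e by simp
  obtain j H where H: "sob n (\<lambda>x. cutoff n j x * v x) H" "energy n (\<lambda>x. v x - cutoff n j x * v x) (\<lambda>i x. G i x - H i x) < e\<^sup>2 / 4"
    using sob_truncate[OF v e4] by blast
  let ?w = "\<lambda>x. cutoff n j x * v x"
  have w1: "integrable (leb n) ?w"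
    by (rule Bochner_Integration.integrable_bound[OF v1])
       (use cutoff_bounds Csmooth_measurable[OF cutoff_smooth] v1 in \<open>auto simp: norm_mult intro!: AE_I2 mult_left_le_one_le\<close>)
  have wv: "L1norm n ?w \<le> L1norm n v"
  proof (rule integral_mono[OF integrable_norm[OF w1] integrable_norm[OF v1]])
    show "norm (?w x) \<le> norm (v x)" for x
      using mult_right_mono[OF cutoff_bounds, of "norm (v x)" n j x] by (simp add: norm_mult)
  qed
  have wo: "off_box n (real (Suc j)) ?w"
    using cutoff_off_box[of n j] unfolding off_box_def by auto
  have wz: "AE x in leb n. s * x i < \<rho> \<longrightarrow> ?w x = 0" using z by (rule AE_mp) simp
  have d: "\<rho> - r > 0" using r by simp
  obtain k where k: "off_box n (\<rho> - r) k" "conv n k ?w \<in> test n" "L1norm n (conv n k ?w) \<le> L1norm n ?w"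
    "energy n (\<lambda>x. ?w x - conv n k ?w x) (\<lambda>i x. H i x - partial_deriv i (conv n k ?w) x) < e\<^sup>2 / 4"
    using sob_mollify[OF H(1) w1 wo e4 d] by blast
  have s1: "sob n (\<lambda>x. v x - ?w x) (\<lambda>i x. G i x - H i x)" by (rule sob_diff[OF v H(1)])
  have s2: "sob n (\<lambda>x. ?w x - conv n k ?w x) (\<lambda>i x. H i x - partial_deriv i (conv n k ?w) x)"
    by (rule sob_diff[OF H(1) sob_test[OF k(2)]])
  have s3: "sob n (\<lambda>x. v x - conv n k ?w x) (\<lambda>i x. G i x - partial_deriv i (conv n k ?w) x)"
    by (rule sob_diff[OF v sob_test[OF k(2)]])
  have "energy n (\<lambda>x. (v x - ?w x) + (?w x - conv n k ?w x)) (\<lambda>i x. (G i x - H i x) + (H i x - partial_deriv i (conv n k ?w) x))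
      \<le> 2 * energy n (\<lambda>x. v x - ?w x) (\<lambda>i x. G i x - H i x) + 2 * energy n (\<lambda>x. ?w x - conv n k ?w x) (\<lambda>i x. H i x - partial_deriv i (conv n k ?w) x)"
    by (rule energy_add[OF s1 s2])
  then have "energy n (\<lambda>x. v x - conv n k ?w x) (\<lambda>i x. G i x - partial_deriv i (conv n k ?w) x)
      \<le> 2 * energy n (\<lambda>x. v x - ?w x) (\<lambda>i x. G i x - H i x) + 2 * energy n (\<lambda>x. ?w x - conv n k ?w x) (\<lambda>i x. H i x - partial_deriv i (conv n k ?w) x)"
    by simp
  with H(2) k(4) have "energy n (\<lambda>x. v x - conv n k ?w x) (\<lambda>i x. G i x - partial_deriv i (conv n k ?w) x) < e\<^sup>2" by linarith
  then have "H1_norm n (\<lambda>x. v x - conv n k ?w x) < e"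
    unfolding H1_norm_energy[OF s3] using e by (simp add: real_less_lsqrt energy_nonneg)
  moreover have "\<forall>x\<in>Rn n. s * x i < r \<longrightarrow> conv n k ?w x = 0"
  proof (intro ballI impI)
    fix x assume "x \<in> Rn n" "s * x i < r"
    then show "conv n k ?w x = 0" by (intro conv_half_space[OF wz k(1) i s]) auto
  qed
  ultimately show ?thesis
    using that[OF k(2)] sob_imp_H1[OF s3] order_trans[OF k(3) wv] by blast
qed

section \<open>The right-hand side on a half-space\<close>

lemma compact_sets_leb:
  assumes "compact K"
  shows "K \<inter> Rn n \<in> sets (leb n)"
proof -
  have "(\<lambda>x. x) \<in> borel_measurable (leb n)" by (rule measurable_continuous_Rn) (rule continuous_on_id)
  then have "(\<lambda>x. x) -` K \<inter> space (leb n) \<in> sets (leb n)"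
    using compact_imp_closed[OF assms] by (intro measurable_sets[of _ _ borel]) auto
  then show ?thesis by simp
qed

lemma functional_bound_test:
  assumes co: "coincides_on n (Rn n - K) F f" and K: "compact K" "K \<subseteq> Rn n"
    and fm: "AE x in restrict_space (leb n) (Rn n - K). norm (f x) \<le> m" and m: "0 \<le> m"
    and \<psi>: "\<psi> \<in> test_functions n (Rn n - K)" and \<psi>': "\<psi> \<in> test n"
  shows "F \<psi> \<le> m * L1norm n \<psi>"
proof -
  let ?M = "restrict_space (leb n) (Rn n - K)"
  have "Rn n - K \<inter> Rn n \<in> sets (leb n)"
    using sets.compl_sets[OF compact_sets_leb[OF K(1), of n]] by simp
  moreover have "(Rn n - K) \<inter> space (leb n) = Rn n - K \<inter> Rn n" by auto
  ultimately have \<Omega>: "(Rn n - K) \<inter> space (leb n) \<in> sets (leb n)" by simp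
  have pi: "integrable (leb n) (\<lambda>x. norm (\<psi> x))"
    using loc_int_test_integrable[OF loc_int_const[of n 1] \<psi>'] by (intro integrable_norm) simp
  have "integrable (leb n) (\<lambda>x. indicator ((Rn n - K) \<inter> space (leb n)) x *\<^sub>R norm (\<psi> x))"
    by (rule integrable_mult_indicator[OF \<Omega> pi])
  also have "?this \<longleftrightarrow> integrable (leb n) (\<lambda>x. indicator (Rn n - K) x *\<^sub>R norm (\<psi> x))"
    by (intro Bochner_Integration.integrable_cong refl) (simp add: indicator_def)
  finally have pi': "integrable (leb n) (\<lambda>x. indicator (Rn n - K) x *\<^sub>R norm (\<psi> x))" .
  have "F \<psi> = Re (\<integral>x. f x * cnj (\<psi> x) \<partial>?M)"
    using co \<psi> unfolding coincides_on_def pairing_def by blast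
  also have "\<dots> \<le> norm (\<integral>x. f x * cnj (\<psi> x) \<partial>?M)" by (rule complex_Re_le_cmod)
  also have "\<dots> \<le> (\<integral>x. norm (f x * cnj (\<psi> x)) \<partial>?M)" by (rule integral_norm_bound)
  also have "\<dots> \<le> (\<integral>x. m * norm (\<psi> x) \<partial>?M)"
  proof (rule integral_mono_AE')
    show "integrable ?M (\<lambda>x. m * norm (\<psi> x))"
      using pi' \<Omega> by (intro integrable_mult_right) (simp add: integrable_restrict_space)
    show "AE x in ?M. norm (f x * cnj (\<psi> x)) \<le> m * norm (\<psi> x)"
      using fm by (rule AE_mp) (auto simp: norm_mult intro!: AE_I2 mult_right_mono)
  qed (use m in auto)
  also have "\<dots> = m * (\<integral>x. indicator (Rn n - K) x *\<^sub>R norm (\<psi> x) \<partial>leb n)"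
    using \<Omega> by (simp add: integral_restrict_space)
  also have "\<dots> \<le> m * L1norm n \<psi>"
    using pi pi' m by (intro mult_left_mono integral_mono) (auto simp: indicator_def)
  finally show ?thesis .
qed

lemma H1_norm_nonneg: "0 \<le> H1_norm n v"
  unfolding H1_norm_def by (intro real_sqrt_ge_zero add_nonneg_nonneg sum_nonneg) auto

lemma H_minus1_add:
  "F \<in> H_minus1 n \<Longrightarrow> u \<in> H1 n \<Longrightarrow> v \<in> H1 n \<Longrightarrow> F (\<lambda>x. u x + v x) = F u + F v"
  by (simp add: H_minus1_def)

lemma H_minus1_bounded: "F \<in> H_minus1 n \<Longrightarrow> \<exists>C. \<forall>w\<in>H1 n. \<bar>F w\<bar> \<le> C * H1_norm n w"
  by (simp add: H_minus1_def)

text \<open>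
  The hypothesis on \<open>f\<close> speaks about test functions only. It extends to \<open>H\<^sup>1\<close> functions vanishing on a
  half-space that contains \<open>K\<close> in its interior, since \<open>F\<close> is continuous for the \<open>H\<^sup>1\<close> norm and the approximating test
  functions do not have larger \<open>L\<^sup>1\<close> norm.
\<close>

lemma functional_bound:
  assumes F: "F \<in> H_minus1 n" and co: "coincides_on n (Rn n - K) F f" and K: "compact K" "K \<subseteq> Rn n"
    and fm: "AE x in restrict_space (leb n) (Rn n - K). norm (f x) \<le> m" and m: "0 \<le> m"
    and i: "i < n" and s: "s = 1 \<or> s = - 1" and Kr: "\<And>x. x \<in> K \<Longrightarrow> s * x i \<le> r0" and r: "r0 < \<rho>"
    and v: "sob n v G" "integrable (leb n) v" "AE x in leb n. s * x i < \<rho> \<longrightarrow> v x = 0"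
  shows "F v \<le> m * L1norm n v"
proof (rule field_le_epsilon)
  fix e :: real assume e: "e > 0"
  obtain C where C: "\<And>w. w \<in> H1 n \<Longrightarrow> \<bar>F w\<bar> \<le> C * H1_norm n w" using H_minus1_bounded[OF F] by metis
  define e' where "e' = e / (\<bar>C\<bar> + 1)"
  have e': "e' > 0" using e by (simp add: e'_def)
  define r where "r = (r0 + \<rho>) / 2"
  have r1: "r0 < r" "r < \<rho>" using r by (auto simp: r_def)
  obtain \<psi> where p: "\<psi> \<in> test n" "\<forall>x\<in>Rn n. s * x i < r \<longrightarrow> \<psi> x = 0"
    "L1norm n \<psi> \<le> L1norm n v" "(\<lambda>x. v x - \<psi> x) \<in> H1 n" "H1_norm n (\<lambda>x. v x - \<psi> x) < e'"
    using sob_half_space_approx[OF v(1,2) i s v(3) r1(2) e'] by blast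
  obtain R where R: "off_box n R \<psi>" and ps: "Csmooth n \<psi>" using p(1) unfolding test_iff by blast
  define S where "S = box_n n R \<inter> {x. r \<le> s * x i}"
  have "closed {x::nat \<Rightarrow> real. r \<le> s * x i}"
  proof (rule closed_Collect_le)
    show "continuous_on UNIV (\<lambda>x::nat \<Rightarrow> real. s * x i)" by (rule continuous_on_mult_left) simp
  qed (rule continuous_on_const)
  then have "compact S" unfolding S_def by (intro compact_Int_closed compact_box_n)
  moreover have "S \<subseteq> Rn n - K"
  proof
    fix x assume x: "x \<in> S"
    then have "x \<in> Rn n" unfolding S_def Int_iff box_n_iff by blast
    moreover have "x \<notin> K" using x Kr[of x] r1(1) unfolding S_def by force
    ultimately show "x \<in> Rn n - K" by blast
  qed
  moreover have "\<psi> x = 0" if x: "x \<in> Rn n - S" for x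
  proof (cases "x \<in> box_n n R")
    case True
    then have "s * x i < r" using x unfolding S_def by auto
    then show ?thesis using p(2) x by blast
  next
    case False
    then have "\<exists>i<n. R < \<bar>x i\<bar>" using x unfolding box_n_iff by (meson DiffD1 not_le)
    then show ?thesis using R x unfolding off_box_def by blast
  qed
  ultimately have p': "\<psi> \<in> test_functions n (Rn n - K)"
    using ps unfolding test_functions_def Csmooth_def by blast
  have "F \<psi> \<le> m * L1norm n \<psi>" by (rule functional_bound_test[OF co K fm m p' p(1)])
  also have "\<dots> \<le> m * L1norm n v" using p(3) m by (rule mult_left_mono)
  finally have 1: "F \<psi> \<le> m * L1norm n v" .
  have "F (\<lambda>x. v x - \<psi> x) \<le> C * H1_norm n (\<lambda>x. v x - \<psi> x)" using C[OF p(4)] by linarith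
  also have "\<dots> \<le> (\<bar>C\<bar> + 1) * e'"
    using p(5) H1_norm_nonneg by (intro mult_mono) auto
  also have "\<dots> = e" by (simp add: e'_def)
  finally have 2: "F (\<lambda>x. v x - \<psi> x) \<le> e" .
  have "F (\<lambda>x. \<psi> x + (v x - \<psi> x)) = F \<psi> + F (\<lambda>x. v x - \<psi> x)"
    by (rule H_minus1_add[OF F sob_imp_H1[OF sob_test[OF p(1)]] p(4)])
  then have "F v = F \<psi> + F (\<lambda>x. v x - \<psi> x)" by simp
  with 1 2 show "F v \<le> m * L1norm n v + e" by linarith
qed

section \<open>The energy inequality\<close>

text \<open>
  The cutoff in the variable \<open>s x\<^sub>i\<close>: it vanishes for \<open>s x\<^sub>i \<le> \<rho>\<close> and is at least \<open>1\<close> for \<open>s x\<^sub>i \<ge> \<rho> + h\<close>.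
  Its derivative is of order \<open>1/h\<close>, but not restricted to the transition layer.
\<close>

definition hcut :: "real \<Rightarrow> nat \<Rightarrow> real \<Rightarrow> real \<Rightarrow> (nat \<Rightarrow> real) \<Rightarrow> real" where
  "hcut s i \<rho> h x = exp 1 * ramp 0 ((s * x i - \<rho>) / h)"

lemma hcut_bounds: "0 \<le> hcut s i \<rho> h x" "hcut s i \<rho> h x \<le> exp 1"
  using ramp_0_bounds by (auto simp: hcut_def)

lemma hcut_zero: "h > 0 \<Longrightarrow> s * x i \<le> \<rho> \<Longrightarrow> hcut s i \<rho> h x = 0"
  by (simp add: hcut_def divide_nonpos_pos)

lemma hcut_ge_1: "h > 0 \<Longrightarrow> \<rho> + h \<le> s * x i \<Longrightarrow> 1 \<le> hcut s i \<rho> h x"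
proof -
  assume h: "h > 0" "\<rho> + h \<le> s * x i"
  then have t: "(s * x i - \<rho>) / h \<ge> 1" by (simp add: field_simps)
  then have "1 / ((s * x i - \<rho>) / h) \<le> 1 / 1" by (intro frac_le) auto
  then have "exp (- 1) \<le> ramp 0 ((s * x i - \<rho>) / h)" using t by (simp add: ramp_0)
  then have "exp 1 * exp (- 1) \<le> hcut s i \<rho> h x" unfolding hcut_def by (intro mult_left_mono) auto
  then show ?thesis by (simp flip: exp_add)
qed

definition hcut' :: "real \<Rightarrow> nat \<Rightarrow> real \<Rightarrow> real \<Rightarrow> (nat \<Rightarrow> real) \<Rightarrow> real" where
  "hcut' s i \<rho> h x = exp 1 * (s / h * ramp (Suc 0) ((s * x i - \<rho>) / h))"

lemma hcut_smooth:
  assumes i: "i < n"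
  shows "Csmooth n (\<lambda>x. c * complex_of_real (hcut s i \<rho> h x))"
    and "j < n \<Longrightarrow> x \<in> Rn n \<Longrightarrow> partial_deriv j (\<lambda>x. c * complex_of_real (hcut s i \<rho> h x)) x
      = (if j = i then c * complex_of_real (hcut' s i \<rho> h x) else 0)"
proof -
  let ?D = "\<lambda>k t. (s / h) ^ k * ramp k (s / h * t + - \<rho> / h)"
  have D: "derivs ?D" by (rule derivs_affine[OF derivs_ramp])
  have eq: "(\<lambda>x. c * complex_of_real (hcut s i \<rho> h x)) = (\<lambda>x. (c * exp 1) * complex_of_real (?D 0 (x i)))"
    by (simp add: hcut_def fun_eq_iff diff_divide_distrib exp_of_real[symmetric])
  show "Csmooth n (\<lambda>x. c * complex_of_real (hcut s i \<rho> h x))"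
    unfolding eq by (intro Csmooth_mult Csmooth_const Csmooth_coord[OF D i])
  assume j: "j < n" "x \<in> Rn n"
  have c0: "partial_deriv j (\<lambda>_. c * exp 1) x = 0" by (rule partial_derivI(1)) simp
  show "partial_deriv j (\<lambda>x. c * complex_of_real (hcut s i \<rho> h x)) x
      = (if j = i then c * complex_of_real (hcut' s i \<rho> h x) else 0)"
    unfolding eq partial_deriv_mult[OF Csmooth_const Csmooth_coord[OF D i] j] partial_deriv_coord[OF D] c0
    by (simp add: hcut'_def diff_divide_distrib exp_of_real[symmetric])
qed

abbreviation hind :: "real \<Rightarrow> nat \<Rightarrow> real \<Rightarrow> (nat \<Rightarrow> real) \<Rightarrow> real" where
  "hind s i \<rho> \<equiv> indicator {x. \<rho> < s * x i}"

lemma hcut'_bound: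
  assumes "h > 0" "s = 1 \<or> s = - 1"
  shows "\<bar>hcut' s i \<rho> h x\<bar> \<le> 2 * exp 1 / h * hind s i \<rho> x"
proof (cases "\<rho> < s * x i")
  case True
  have "\<bar>hcut' s i \<rho> h x\<bar> = exp 1 * (1 / h * ramp (Suc 0) ((s * x i - \<rho>) / h))"
    using assms ramp_1_bounds by (auto simp: hcut'_def abs_mult)
  also have "\<dots> \<le> exp 1 * (1 / h * 2)"
    using assms ramp_1_bounds by (intro mult_left_mono) auto
  finally show ?thesis using True by (simp add: mult.commute)
next
  case False
  then show ?thesis using assms by (simp add: hcut'_def divide_nonpos_pos)
qed

lemma hcut_le_hind: "h > 0 \<Longrightarrow> hcut s i \<rho> h x \<le> exp 1 * hind s i \<rho> x"
  using hcut_bounds[of s i \<rho> h x] hcut_zero[of h s x i \<rho>] by (cases "\<rho> < s * x i") auto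

lemma hind_le_hcut: "h > 0 \<Longrightarrow> hind s i (\<rho> + h) x \<le> hcut s i \<rho> h x"
  using hcut_ge_1[of h \<rho> s x i] hcut_bounds[of s i \<rho> h x] by (cases "\<rho> + h < s * x i") auto

lemma coordinate_measurable: "i < n \<Longrightarrow> (\<lambda>x. x i) \<in> borel_measurable (leb n)"
  using measurable_component_singleton[of i "{..<n}" "\<lambda>_. lborel"] by simp

lemma ramp_measurable: "ramp k \<in> borel_measurable borel"
  by (intro borel_measurable_continuous_onI derivs_cont derivs_ramp)

lemma
  assumes "i < n"
  shows hind_measurable: "hind s i \<rho> \<in> borel_measurable (leb n)"
    and hcut_measurable: "hcut s i \<rho> h \<in> borel_measurable (leb n)"
    and hcut'_measurable: "hcut' s i \<rho> h \<in> borel_measurable (leb n)"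
proof -
  note [measurable] = coordinate_measurable[OF assms] ramp_measurable
  have "{x \<in> space (leb n). \<rho> < s * x i} \<in> sets (leb n)" by measurable
  then have "indicator {x \<in> space (leb n). \<rho> < s * x i} \<in> borel_measurable (leb n)" by (rule borel_measurable_indicator)
  then show "hind s i \<rho> \<in> borel_measurable (leb n)"
    by (rule measurable_cong[THEN iffD1, rotated]) (simp add: indicator_def)
  show "hcut s i \<rho> h \<in> borel_measurable (leb n)" unfolding hcut_def[abs_def] by measurable
  show "hcut' s i \<rho> h \<in> borel_measurable (leb n)" unfolding hcut'_def[abs_def] by measurable
qed

lemma integrable_bounded_mult:
  fixes g :: "'a \<Rightarrow> 'b::{banach, second_countable_topology, real_normed_algebra}"
  assumes "integrable M g" "h \<in> borel_measurable M" "\<And>x. norm (h x) \<le> C"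
  shows "integrable M (\<lambda>x. h x * g x)"
proof (rule Bochner_Integration.integrable_bound)
  show "integrable M (\<lambda>x. C * norm (g x))" using assms(1) by simp
  show "AE x in M. norm (h x * g x) \<le> norm (C * norm (g x))"
  proof (rule AE_I2)
    fix x
    have C: "0 \<le> C" using assms(3)[of x] norm_ge_zero order_trans by blast
    have "norm (h x * g x) \<le> norm (h x) * norm (g x)" by (rule norm_mult_ineq)
    also have "\<dots> \<le> C * norm (g x)" by (intro mult_right_mono assms(3)) simp
    finally show "norm (h x * g x) \<le> norm (C * norm (g x))" using C by simp
  qed
qed (use assms in auto)

abbreviation L2w :: "nat \<Rightarrow> ((nat \<Rightarrow> real) \<Rightarrow> real) \<Rightarrow> ((nat \<Rightarrow> real) \<Rightarrow> complex) \<Rightarrow> real" where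
  "L2w n w f \<equiv> \<integral>x. w x * (norm (f x))\<^sup>2 \<partial>leb n"

abbreviation L1w :: "nat \<Rightarrow> ((nat \<Rightarrow> real) \<Rightarrow> real) \<Rightarrow> ((nat \<Rightarrow> real) \<Rightarrow> complex) \<Rightarrow> real" where
  "L1w n w f \<equiv> \<integral>x. w x * norm (f x) \<partial>leb n"

text \<open>
  The test function is \<open>v = cnj l \<sqdot> \<eta> \<sqdot> u\<close>. Since the pairing conjugates its second argument, this multiplies
  the energy densities by \<open>l\<close>, whose choice makes the real parts of \<open>l\<close>, \<open>l a\<close> and \<open>l b\<close> bounded
  below; the term of the gradient of \<open>\<eta>\<close> is the right-hand side. One of the two
  multiples of \<open>\<kappa>\<close> available for \<open>\<integral> \<eta> |u|\<close> absorbs \<open>F v\<close>.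
\<close>

lemma half_space_energy:
  assumes gws: "global_weak_solution n a b \<phi> F u" and \<phi>: "AE x in leb n. 0 \<le> \<phi> x"
    and i: "i < n" and s: "s = 1 \<or> s = - 1" and h: "h > 0" and m: "0 \<le> m"
    and Fb: "\<And>v G. sob n v G \<Longrightarrow> integrable (leb n) v \<Longrightarrow> (AE x in leb n. s * x i < \<rho> \<longrightarrow> v x = 0)
        \<Longrightarrow> F v \<le> m * L1norm n v"
    and l: "norm l \<le> 1" "\<kappa> \<le> Re l" "2 * \<kappa> \<le> Re (l * a)" "\<kappa> \<le> Re (l * b)" "m \<le> \<kappa>" "0 < \<kappa>"
  defines "G \<equiv> weak_grad n u" and "\<eta> \<equiv> hcut s i \<rho> h"
  shows "\<kappa> * ((\<Sum>j<n. L2w n \<eta> (G j)) + L2w n \<eta> u + L1w n \<eta> u)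
      \<le> 2 * exp 1 / h * (\<integral>x. hind s i \<rho> x * (norm (G i x) * norm (u x)) \<partial>leb n)"
proof -
  have uX: "u \<in> H1 n" and u1: "integrable (leb n) u"
    using gws by (auto simp: global_weak_solution_def X_space_def L1_iff)
  obtain U where U: "saturated_section n u U"
    and eq: "\<And>v. v \<in> X_space n \<Longrightarrow> (\<Sum>i<n. pairing (leb n) (G i) (weak_grad n v i))
          + pairing (leb n) (\<lambda>x. a * U x) v + pairing (leb n) (\<lambda>x. b * u x) v
          + pairing (leb n) (\<lambda>x. complex_of_real (\<phi> x) * u x) v = F v"
    using gws unfolding global_weak_solution_def G_def by blast
  have uG: "sob n u G" unfolding G_def by (rule H1_weak_grad[OF uX])
  have uL: "u \<in> L2 n" and GL: "\<And>j. j < n \<Longrightarrow> G j \<in> L2 n" using sob_L2[OF uG] by auto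
  define \<eta>' where "\<eta>' = hcut' s i \<rho> h"
  define c where "c = cnj l"
  define v where "v x = (c * complex_of_real (\<eta> x)) * u x" for x
  define H where "H j x = (c * complex_of_real (\<eta> x)) * G j x
      + (if j = i then c * complex_of_real (\<eta>' x) else 0) * u x" for j x
  have \<eta>b: "0 \<le> \<eta> x" "\<eta> x \<le> exp 1" for x unfolding \<eta>_def by (rule hcut_bounds)+
  have \<eta>'b: "\<bar>\<eta>' x\<bar> \<le> 2 * exp 1 / h * hind s i \<rho> x" for x unfolding \<eta>'_def by (rule hcut'_bound[OF h s])
  have \<eta>'b2: "\<bar>\<eta>' x\<bar> \<le> 2 * exp 1 / h" for x
    using order_trans[OF \<eta>'b[of x], of "2 * exp 1 / h"] h by (simp add: indicator_def)
  have [measurable]: "\<eta> \<in> borel_measurable (leb n)" "\<eta>' \<in> borel_measurable (leb n)"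
    unfolding \<eta>_def \<eta>'_def using hcut_measurable[OF i] hcut'_measurable[OF i] by auto
  have um [measurable]: "u \<in> borel_measurable (leb n)" using u1 by auto
  have c1: "norm c \<le> 1" using l(1) by (simp add: c_def)
  have vH: "sob n v H"
  proof -
    let ?e = "\<lambda>x. c * complex_of_real (hcut s i \<rho> h x)"
    have e1: "norm (?e x) \<le> exp 1" for x
      using mult_mono[OF c1 hcut_bounds(2)[of s i \<rho> h x]] hcut_bounds(1)[of s i \<rho> h x]
      by (simp add: norm_mult)
    have e2: "norm (partial_deriv j ?e x) \<le> 2 * exp 1 / h" if "j < n" "x \<in> Rn n" for j x
    proof -
      have "norm c * \<bar>\<eta>' x\<bar> \<le> 1 * (2 * exp 1 / h)" using c1 \<eta>'b2[of x] by (intro mult_mono) auto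
      then show ?thesis unfolding hcut_smooth(2)[OF i that] using h by (simp add: norm_mult \<eta>'_def)
    qed
    have "sob n (\<lambda>x. ?e x * u x) (\<lambda>j x. ?e x * G j x + partial_deriv j ?e x * u x)"
      by (rule sob_smooth_mult[OF uG hcut_smooth(1)[OF i] e1 e2])
    then have 1: "(\<lambda>x. ?e x * u x) \<in> L2 n"
      and 2: "\<And>j. j < n \<Longrightarrow> (\<lambda>x. ?e x * G j x + partial_deriv j ?e x * u x) \<in> L2 n"
      and 3: "\<And>j. j < n \<Longrightarrow> weak_partial n j (\<lambda>x. ?e x * u x) (\<lambda>x. ?e x * G j x + partial_deriv j ?e x * u x)"
      by (auto simp: sob_def)
    have Heq: "?e x * G j x + partial_deriv j ?e x * u x = H j x" if "j < n" "x \<in> Rn n" for j x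
      unfolding hcut_smooth(2)[OF i that] H_def \<eta>_def \<eta>'_def ..
    have HL: "H j \<in> L2 n" if j: "j < n" for j
    proof -
      have "(\<lambda>x. (c * complex_of_real (\<eta> x)) * G j x) \<in> L2 n"
        using e1 by (intro L2_mult[OF _ _ GL[OF j]]) (auto simp: \<eta>_def[symmetric])
      moreover have "(\<lambda>x. (if j = i then c * complex_of_real (\<eta>' x) else 0) * u x) \<in> L2 n"
      proof (rule L2_mult[OF _ _ uL])
        show "norm (if j = i then c * complex_of_real (\<eta>' x) else 0) \<le> 1 * (2 * exp 1 / h)" for x
          using mult_mono[OF c1 \<eta>'b2[of x]] h by (simp add: norm_mult)
      qed simp
      ultimately show ?thesis unfolding H_def by (rule L2_add)
    qed
    have "weak_partial n j v (H j)" if j: "j < n" for j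
      unfolding weak_partial_def
    proof
      fix \<psi> assume p: "\<psi> \<in> test n"
      have "(\<integral>x. (?e x * G j x + partial_deriv j ?e x * u x) * \<psi> x \<partial>leb n) = (\<integral>x. H j x * \<psi> x \<partial>leb n)"
        by (intro Bochner_Integration.integral_cong) (auto simp: Heq[OF j])
      with 3[OF j] p show "(\<integral>x. v x * partial_deriv j \<psi> x \<partial>leb n) = - (\<integral>x. H j x * \<psi> x \<partial>leb n)"
        unfolding weak_partial_def v_def \<eta>_def by simp
    qed
    with 1 HL show ?thesis unfolding sob_def v_def \<eta>_def by simp
  qed
  have v1: "integrable (leb n) v"
    unfolding v_def by (rule integrable_bounded_mult[OF u1, where C = "1 * exp 1"])
      (use mult_mono[OF c1 \<eta>b(2)] \<eta>b(1) in \<open>auto simp: norm_mult\<close>)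
  have vX: "v \<in> X_space n" using sob_imp_H1[OF vH] v1 by (simp add: X_space_def L1_iff)
  have bd: "integrable (leb n) (\<lambda>x. \<eta> x * g x)" if "integrable (leb n) g" for g :: "(nat \<Rightarrow> real) \<Rightarrow> real"
    by (rule integrable_bounded_mult[OF that, where C = "exp 1"]) (use \<eta>b in auto)
  have iG: "integrable (leb n) (\<lambda>x. \<eta> x * (norm (G j x))\<^sup>2)" if "j < n" for j
    using L2_integrable[OF GL[OF that]] by (rule bd)
  have iu: "integrable (leb n) (\<lambda>x. \<eta> x * norm (u x))" using integrable_norm[OF u1] by (rule bd)
  define A where "A j = L2w n \<eta> (G j)" for j
  define B where "B = L2w n \<eta> u"
  define D where "D = L1w n \<eta> u"
  define J where "J = (\<integral>x. hind s i \<rho> x * (norm (G i x) * norm (u x)) \<partial>leb n)"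
  have nonneg: "0 \<le> A j" "0 \<le> B" "0 \<le> D" for j
    unfolding A_def B_def D_def using \<eta>b by (auto intro!: integral_nonneg)
  \<comment> \<open>Only the \<open>i\<close>-th derivative sees the cutoff, which depends on \<open>x\<^sub>i\<close> alone.\<close>
  have T1: "Re l * A j - (if j = i then 2 * exp 1 / h * J else 0) \<le> pairing (leb n) (G j) (weak_grad n v j)" if j: "j < n" for j
  proof -
    have Gm: "G j \<in> borel_measurable (leb n)" by (rule L2_measurable[OF GL[OF j]])
    have Hm: "H j \<in> borel_measurable (leb n)" using sob_L2(2)[OF vH j] by (rule L2_measurable)
    have wm: "weak_grad n v j \<in> borel_measurable (leb n)"
      using H1_weak_grad[OF sob_imp_H1[OF vH]] j by (auto simp: sob_def L2_iff)
    have cm: "cnj \<in> borel_measurable borel" by (intro borel_measurable_continuous_onI continuous_intros)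
    have "(\<integral>x. G j x * cnj (weak_grad n v j x) \<partial>leb n) = (\<integral>x. G j x * cnj (H j x) \<partial>leb n)"
    proof (rule integral_cong_AE)
      show "AE x in leb n. G j x * cnj (weak_grad n v j x) = G j x * cnj (H j x)"
        using weak_grad_AE[OF vH j] by (rule AE_mp) simp
    qed (use Gm measurable_compose[OF Hm cm] measurable_compose[OF wm cm] in auto)
    also have "\<dots> = (\<integral>x. l * complex_of_real (\<eta> x * (norm (G j x))\<^sup>2)
        + (if j = i then l * (complex_of_real (\<eta>' x) * (G i x * cnj (u x))) else 0) \<partial>leb n)"
    proof (rule Bochner_Integration.integral_cong[OF refl])
      fix x
      show "G j x * cnj (H j x) = l * complex_of_real (\<eta> x * (norm (G j x))\<^sup>2)
        + (if j = i then l * (complex_of_real (\<eta>' x) * (G i x * cnj (u x))) else 0)"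
        by (cases "j = i") (simp_all only: of_real_mult complex_norm_square H_def c_def if_True if_False, simp_all add: algebra_simps)
    qed
    also have "\<dots> = (\<integral>x. l * complex_of_real (\<eta> x * (norm (G j x))\<^sup>2) \<partial>leb n)
        + (\<integral>x. (if j = i then l * (complex_of_real (\<eta>' x) * (G i x * cnj (u x))) else 0) \<partial>leb n)"
    proof (rule Bochner_Integration.integral_add)
      have gu: "integrable (leb n) (\<lambda>x. G i x * cnj (u x))" by (rule L2_prod_integrable[OF GL[OF i] L2_cnj[OF uL]])
      have "integrable (leb n) (\<lambda>x. complex_of_real (\<eta>' x) * (G i x * cnj (u x)))"
        by (rule integrable_bounded_mult[OF gu, where C = "2 * exp 1 / h"]) (use \<eta>'b2 in auto)
      then show "integrable (leb n) (\<lambda>x. if j = i then l * (complex_of_real (\<eta>' x) * (G i x * cnj (u x))) else 0)"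
        by (cases "j = i") auto
      show "integrable (leb n) (\<lambda>x. l * complex_of_real (\<eta> x * (norm (G j x))\<^sup>2))"
        by (intro integrable_mult_right integrable_of_real iG[OF j])
    qed
    also have "(\<integral>x. l * complex_of_real (\<eta> x * (norm (G j x))\<^sup>2) \<partial>leb n) = l * complex_of_real (A j)"
      unfolding A_def integral_mult_right_zero integral_complex_of_real ..
    finally have 1: "pairing (leb n) (G j) (weak_grad n v j) = Re l * A j
        + Re (\<integral>x. (if j = i then l * (complex_of_real (\<eta>' x) * (G i x * cnj (u x))) else 0) \<partial>leb n)"
      by (simp add: pairing_def)
    have "norm (\<integral>x. (if j = i then l * (complex_of_real (\<eta>' x) * (G i x * cnj (u x))) else 0) \<partial>leb n)
        \<le> (if j = i then 2 * exp 1 / h * J else 0)"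
    proof (cases "j = i")
      case True
      have gu: "integrable (leb n) (\<lambda>x. norm (G i x) * norm (u x))"
        using integrable_norm[OF L2_prod_integrable[OF GL[OF i] uL]] by (simp add: norm_mult)
      have "integrable (leb n) (\<lambda>x. hind s i \<rho> x * (norm (G i x) * norm (u x)))"
        by (rule integrable_bounded_mult[OF gu hind_measurable[OF i], where C = 1]) (simp add: indicator_def)
      then have gi: "integrable (leb n) (\<lambda>x. 2 * exp 1 / h * (hind s i \<rho> x * (norm (G i x) * norm (u x))))" by (rule integrable_mult_right)
      have "norm (\<integral>x. l * (complex_of_real (\<eta>' x) * (G i x * cnj (u x))) \<partial>leb n)
          \<le> L1norm n (\<lambda>x. l * (complex_of_real (\<eta>' x) * (G i x * cnj (u x))))" by (rule integral_norm_bound)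
      also have "\<dots> \<le> (\<integral>x. 2 * exp 1 / h * (hind s i \<rho> x * (norm (G i x) * norm (u x))) \<partial>leb n)"
      proof (rule integral_mono_AE'[OF gi])
        show "AE x in leb n. norm (l * (complex_of_real (\<eta>' x) * (G i x * cnj (u x))))
            \<le> 2 * exp 1 / h * (hind s i \<rho> x * (norm (G i x) * norm (u x)))"
        proof (rule AE_I2)
          fix x
          have "norm (l * (complex_of_real (\<eta>' x) * (G i x * cnj (u x)))) = norm l * (\<bar>\<eta>' x\<bar> * (norm (G i x) * norm (u x)))"
            by (simp add: norm_mult)
          also have "\<dots> \<le> 1 * ((2 * exp 1 / h * hind s i \<rho> x) * (norm (G i x) * norm (u x)))"
            using l(1) \<eta>'b[of x] h by (intro mult_mono) auto
          finally show "norm (l * (complex_of_real (\<eta>' x) * (G i x * cnj (u x))))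
            \<le> 2 * exp 1 / h * (hind s i \<rho> x * (norm (G i x) * norm (u x)))" by (simp only: mult_1_left mult.assoc)
        qed
      qed (use h in \<open>auto intro!: AE_I2 divide_nonneg_pos mult_nonneg_nonneg\<close>)
      also have "\<dots> = 2 * exp 1 / h * J" unfolding J_def by (rule integral_mult_right_zero)
      finally show ?thesis using True by simp
    qed simp
    then show ?thesis
      using 1 abs_Re_le_cmod[of "\<integral>x. (if j = i then l * (complex_of_real (\<eta>' x) * (G i x * cnj (u x))) else 0) \<partial>leb n"]
      by linarith
  qed
  \<comment> \<open>Where \<open>u\<close> vanishes both sides are \<open>0\<close>, whatever the value of the saturated section.\<close>
  have T2: "pairing (leb n) (\<lambda>x. a * U x) v = Re (l * a) * D"
  proof -
    have Um: "U \<in> borel_measurable (leb n)" and Ueq: "AE x in leb n. u x \<noteq> 0 \<longrightarrow> U x = u x / complex_of_real (cmod (u x))"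
      using U by (auto simp: saturated_section_def Linf_def)
    have vm: "v \<in> borel_measurable (leb n)" using v1 by auto
    have cm: "cnj \<in> borel_measurable borel" by (intro borel_measurable_continuous_onI continuous_intros)
    have "(\<integral>x. a * U x * cnj (v x) \<partial>leb n) = (\<integral>x. (l * a) * complex_of_real (\<eta> x * norm (u x)) \<partial>leb n)"
    proof (rule integral_cong_AE)
      show "AE x in leb n. a * U x * cnj (v x) = (l * a) * complex_of_real (\<eta> x * norm (u x))"
        using Ueq
      proof (rule AE_mp, intro AE_I2 impI)
        fix x assume x: "u x \<noteq> 0 \<longrightarrow> U x = u x / complex_of_real (cmod (u x))"
        show "a * U x * cnj (v x) = (l * a) * complex_of_real (\<eta> x * norm (u x))"
        proof (cases "u x = 0")
          case False
          have "u x * cnj (u x) = complex_of_real (norm (u x)) * complex_of_real (norm (u x))"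
            by (simp add: complex_norm_square[symmetric] power2_eq_square flip: of_real_mult)
          then have "U x * cnj (u x) = complex_of_real (norm (u x))" using x False by simp
          then show ?thesis by (simp add: v_def c_def algebra_simps)
        qed (simp add: v_def)
      qed
    qed (use Um measurable_compose[OF vm cm] in auto)
    then show ?thesis unfolding pairing_def D_def integral_mult_right_zero integral_complex_of_real by simp
  qed
  have T3: "pairing (leb n) (\<lambda>x. b * u x) v = Re (l * b) * B"
  proof -
    have "(\<lambda>x. b * u x * cnj (v x)) = (\<lambda>x. (l * b) * complex_of_real (\<eta> x * (norm (u x))\<^sup>2))"
    proof
      fix x
      show "b * u x * cnj (v x) = (l * b) * complex_of_real (\<eta> x * (norm (u x))\<^sup>2)"
        by (simp only: of_real_mult complex_norm_square v_def c_def) (simp add: algebra_simps)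
    qed
    then show ?thesis unfolding pairing_def B_def by (simp only: integral_mult_right_zero integral_complex_of_real) simp
  qed
  \<comment> \<open>If the integrand is not integrable then its integral is \<open>0\<close>, so the sign holds in any case.\<close>
  have T4: "0 \<le> pairing (leb n) (\<lambda>x. complex_of_real (\<phi> x) * u x) v"
  proof -
    have "(\<lambda>x. complex_of_real (\<phi> x) * u x * cnj (v x)) = (\<lambda>x. l * complex_of_real (\<phi> x * (\<eta> x * (norm (u x))\<^sup>2)))"
    proof
      fix x
      show "complex_of_real (\<phi> x) * u x * cnj (v x) = l * complex_of_real (\<phi> x * (\<eta> x * (norm (u x))\<^sup>2))"
        by (simp only: of_real_mult complex_norm_square v_def c_def) (simp add: algebra_simps)
    qed
    then have "pairing (leb n) (\<lambda>x. complex_of_real (\<phi> x) * u x) v = Re l * (\<integral>x. \<phi> x * (\<eta> x * (norm (u x))\<^sup>2) \<partial>leb n)"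
      unfolding pairing_def by (simp only: integral_mult_right_zero integral_complex_of_real) simp
    moreover have "0 \<le> (\<integral>x. \<phi> x * (\<eta> x * (norm (u x))\<^sup>2) \<partial>leb n)"
      using \<phi> \<eta>b by (intro integral_nonneg_AE) (auto elim!: AE_mp)
    ultimately show ?thesis using l(2,6) by (simp add: mult_nonneg_nonneg)
  qed
  have T5: "F v \<le> \<kappa> * D"
  proof -
    have "F v \<le> m * L1norm n v"
    proof (rule Fb[OF vH v1])
      show "AE x in leb n. s * x i < \<rho> \<longrightarrow> v x = 0"
        using hcut_zero[OF h] by (intro AE_I2) (auto simp: v_def \<eta>_def)
    qed
    also have "\<dots> \<le> m * D"
    proof (rule mult_left_mono[OF _ m])
      show "L1norm n v \<le> D"
        unfolding D_def
      proof (rule integral_mono[OF integrable_norm[OF v1] iu])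
        fix x
        have "norm (v x) = norm c * (\<eta> x * norm (u x))" using \<eta>b by (simp add: v_def norm_mult)
        also have "\<dots> \<le> 1 * (\<eta> x * norm (u x))" using c1 \<eta>b by (intro mult_right_mono) auto
        finally show "norm (v x) \<le> \<eta> x * norm (u x)" by simp
      qed
    qed
    also have "\<dots> \<le> \<kappa> * D" using l(5) nonneg(3) by (rule mult_right_mono)
    finally show ?thesis .
  qed
  have "(\<Sum>j<n. Re l * A j) - 2 * exp 1 / h * J = (\<Sum>j<n. Re l * A j - (if j = i then 2 * exp 1 / h * J else 0))"
    using i by (simp add: sum_subtractf)
  also have "\<dots> \<le> (\<Sum>j<n. pairing (leb n) (G j) (weak_grad n v j))"
    by (intro sum_mono T1) simp
  finally have S: "(\<Sum>j<n. Re l * A j) - 2 * exp 1 / h * J + Re (l * a) * D + Re (l * b) * B \<le> \<kappa> * D"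
    using eq[OF vX] T2 T3 T4 T5 by linarith
  have "(\<Sum>j<n. \<kappa> * A j) \<le> (\<Sum>j<n. Re l * A j)" by (intro sum_mono mult_right_mono l nonneg)
  moreover have "\<kappa> * B \<le> Re (l * b) * B" "(2 * \<kappa>) * D \<le> Re (l * a) * D" by (intro mult_right_mono l nonneg)+
  ultimately have "(\<Sum>j<n. \<kappa> * A j) + \<kappa> * B + \<kappa> * D \<le> 2 * exp 1 / h * J" using S by linarith
  then show ?thesis
    unfolding A_def[symmetric] B_def[symmetric] D_def[symmetric] J_def[symmetric]
    by (simp add: distrib_left sum_distrib_left)
qed

section \<open>Decay of the energy in a half-space\<close>

text \<open>
  The energy in the half-space \<open>s x\<^sub>i > \<rho>\<close>, including the integral of \<open>|u|\<close> that the saturated term controls.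
\<close>

definition tail :: "nat \<Rightarrow> real \<Rightarrow> nat \<Rightarrow> ((nat \<Rightarrow> real) \<Rightarrow> complex) \<Rightarrow> (nat \<Rightarrow> (nat \<Rightarrow> real) \<Rightarrow> complex) \<Rightarrow> real \<Rightarrow> real" where
  "tail n s i u G \<rho> = (\<Sum>j<n. L2w n (hind s i \<rho>) (G j))
     + L2w n (hind s i \<rho>) u + L1w n (hind s i \<rho>) u"

lemma hind_integrable:
  assumes "i < n" "integrable (leb n) (g :: _ \<Rightarrow> real)"
  shows "integrable (leb n) (\<lambda>x. hind s i \<rho> x * g x)"
  by (rule integrable_bounded_mult[OF assms(2) hind_measurable[OF assms(1)], where C = 1]) (simp add: indicator_def)

lemma hind_integral_mono:
  assumes "i < n" "integrable (leb n) g" "\<And>x. 0 \<le> g x" "\<rho> \<le> \<rho>'"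
  shows "(\<integral>x. hind s i \<rho>' x * g x \<partial>leb n) \<le> (\<integral>x. hind s i \<rho> x * g x \<partial>leb n)"
proof (rule integral_mono[OF hind_integrable[OF assms(1,2)] hind_integrable[OF assms(1,2)]])
  fix x
  have "hind s i \<rho>' x \<le> hind s i \<rho> x" using assms(4) by (simp add: indicator_def)
  then show "hind s i \<rho>' x * g x \<le> hind s i \<rho> x * g x" using assms(3) by (rule mult_right_mono)
qed

lemma hind_integral_tendsto:
  assumes "i < n" "integrable (leb n) g" "\<And>x. 0 \<le> g x"
  shows "(\<lambda>j. \<integral>x. hind s i (real j) x * g x \<partial>leb n) \<longlonglongrightarrow> 0"
proof -
  have "(\<lambda>j. \<integral>x. hind s i (real j) x * g x \<partial>leb n) \<longlonglongrightarrow> (\<integral>x. 0 \<partial>leb n)"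
  proof (rule integral_dominated_convergence[where w = g])
    show "AE x in leb n. (\<lambda>j. hind s i (real j) x * g x) \<longlonglongrightarrow> 0"
    proof (rule AE_I2, rule tendsto_eventually)
      fix x :: "nat \<Rightarrow> real"
      obtain N :: nat where N: "s * x i < real N" using reals_Archimedean2 by blast
      show "\<forall>\<^sub>F j in sequentially. hind s i (real j) x * g x = 0"
      proof (rule eventually_sequentiallyI[of N])
        fix j assume "N \<le> j"
        then have "\<not> real j < s * x i" using N by simp
        then show "hind s i (real j) x * g x = 0" by simp
      qed
    qed
    show "AE x in leb n. norm (hind s i (real j) x * g x) \<le> g x" for j
      using assms(3) by (intro AE_I2) (simp add: indicator_def)
    show "(\<lambda>x. hind s i (real j) x * g x) \<in> borel_measurable (leb n)" for j
      using hind_integrable[OF assms(1,2)] by (rule borel_measurable_integrable)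
  qed (use assms(2) in auto)
  then show ?thesis by simp
qed

locale half_space =
  fixes n :: nat and s :: real and i :: nat and u :: "(nat \<Rightarrow> real) \<Rightarrow> complex" and G :: "nat \<Rightarrow> (nat \<Rightarrow> real) \<Rightarrow> complex"
  assumes uG: "sob n u G" and u1: "integrable (leb n) u" and i: "i < n" and s: "s = 1 \<or> s = - 1"
begin

abbreviation E :: "real \<Rightarrow> real" where "E \<equiv> tail n s i u G"

lemma iG: "j < n \<Longrightarrow> integrable (leb n) (\<lambda>x. (norm (G j x))\<^sup>2)"
  using sob_L2(2)[OF uG] by (rule L2_integrable)

lemma iu2: "integrable (leb n) (\<lambda>x. (norm (u x))\<^sup>2)"
  using sob_L2(1)[OF uG] by (rule L2_integrable)

lemma iu1: "integrable (leb n) (\<lambda>x. norm (u x))"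
  using u1 by simp

lemma parts_nonneg:
  "0 \<le> L2w n (hind s i \<rho>) v" "0 \<le> L1w n (hind s i \<rho>) v"
  by (auto intro!: integral_nonneg)

lemma tail_nonneg: "0 \<le> E \<rho>"
  unfolding tail_def using parts_nonneg by (intro add_nonneg_nonneg sum_nonneg) auto

lemma tail_antimono: "\<rho> \<le> \<rho>' \<Longrightarrow> E \<rho>' \<le> E \<rho>"
  unfolding tail_def using iG iu1 iu2 i by (intro add_mono sum_mono hind_integral_mono) auto

lemma parts_le_tail:
  "(\<Sum>j<n. L2w n (hind s i \<rho>) (G j)) \<le> E \<rho>"
  "L2w n (hind s i \<rho>) u \<le> E \<rho>"
  "L1w n (hind s i \<rho>) u \<le> E \<rho>"
  "j < n \<Longrightarrow> L2w n (hind s i \<rho>) (G j) \<le> E \<rho>"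
proof -
  let ?S = "\<Sum>j<n. L2w n (hind s i \<rho>) (G j)"
  have S: "0 \<le> ?S" using parts_nonneg by (intro sum_nonneg) auto
  show 1: "?S \<le> E \<rho>" unfolding tail_def using parts_nonneg[of \<rho> u] by linarith
  show "L2w n (hind s i \<rho>) u \<le> E \<rho>" "L1w n (hind s i \<rho>) u \<le> E \<rho>"
    unfolding tail_def using parts_nonneg[of \<rho> u] S by linarith+
  assume "j < n"
  then have "L2w n (hind s i \<rho>) (G j) \<le> ?S"
    using parts_nonneg by (intro member_le_sum) auto
  with 1 show "L2w n (hind s i \<rho>) (G j) \<le> E \<rho>" by linarith
qed

lemma tail_small:
  assumes "0 < e" shows "\<exists>\<rho>>r. E \<rho> \<le> e"
proof -
  have "(\<lambda>j. E (real j)) \<longlonglongrightarrow> (\<Sum>j<n. 0) + 0 + 0"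
    unfolding tail_def using iG iu1 iu2 i by (intro tendsto_add tendsto_sum hind_integral_tendsto) auto
  then have "\<forall>\<^sub>F j in sequentially. E (real j) < e" using assms by (intro order_tendstoD(2)) auto
  then obtain N where N: "\<And>j. j \<ge> N \<Longrightarrow> E (real j) < e" unfolding eventually_sequentially by blast
  obtain N' :: nat where "r < real N'" using reals_Archimedean2 by blast
  then show ?thesis using N[of "max N N'"] by (intro exI[of _ "real (max N N')"]) auto
qed

definition nash_const :: real where
  "nash_const = 2 * exp 4 ^ n * (exp 1)\<^sup>2 + 2 * n * (2 * (exp 1)\<^sup>2 + 8 * n * (exp 1)\<^sup>2)"

text \<open>
  Nash's inequality for the cut off function \<open>\<eta> u\<close>: all its norms are controlled by the energy
  beyond \<open>\<rho>\<close>, at the cost of a factor \<open>h\<^sup>-\<^sup>2\<close> for the gradient of \<open>\<eta>\<close>.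
\<close>

lemma nash_half_space:
  assumes h: "0 < h" "h \<le> 1" and l: "0 < l"
  shows "L2w n (hind s i (\<rho> + h)) u
      \<le> nash_const * ((1 / l) ^ n * (E \<rho>)\<^sup>2 + l\<^sup>2 / h\<^sup>2 * E \<rho>)"
proof -
  let ?e = "\<lambda>x. 1 * complex_of_real (hcut s i \<rho> h x)"
  let ?H = "\<lambda>j x. ?e x * G j x + partial_deriv j ?e x * u x"
  have e1: "norm (?e x) \<le> exp 1 * hind s i \<rho> x" for x
    using hcut_le_hind[OF h(1), of s i \<rho> x] hcut_bounds(1)[of s i \<rho> h x] by (simp add: norm_mult)
  have e2: "norm (partial_deriv j ?e x) \<le> 2 * exp 1 / h * hind s i \<rho> x" if "j < n" "x \<in> Rn n" for j x
    unfolding hcut_smooth(2)[OF i that] using hcut'_bound[OF h(1) s, of i \<rho> x] h(1)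
    by (simp add: norm_mult)
  have ind1: "hind s i \<rho> x \<le> 1" for x by (simp add: indicator_def)
  have ind2: "(hind s i \<rho> x)\<^sup>2 = hind s i \<rho> x" for x by (simp add: indicator_def)
  have b1: "norm (?e x) \<le> exp 1" for x
    using hcut_bounds[of s i \<rho> h x] by (simp add: norm_mult)
  have b2: "norm (partial_deriv j ?e x) \<le> 2 * exp 1 / h" if "j < n" "x \<in> Rn n" for j x
    using order_trans[OF e2[OF that], of "2 * exp 1 / h"] h(1) by (simp add: indicator_def)
  have vH: "sob n (\<lambda>x. ?e x * u x) ?H"
    by (rule sob_smooth_mult[OF uG hcut_smooth(1)[OF i] b1 b2])
  have v1: "integrable (leb n) (\<lambda>x. ?e x * u x)"
    by (rule integrable_bounded_mult[OF u1 Csmooth_measurable[OF hcut_smooth(1)[OF i]] b1])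
  have N: "L2sq n (\<lambda>x. ?e x * u x) \<le> 2 * ((exp 4 / l) ^ n * (L1norm n (\<lambda>x. ?e x * u x))\<^sup>2)
     + 2 * (n * (l\<^sup>2 * (\<Sum>j<n. L2sq n (?H j))))"
    by (rule nash_inequality[OF vH v1 l])
  have lower: "L2w n (hind s i (\<rho> + h)) u \<le> L2sq n (\<lambda>x. ?e x * u x)"
  proof (rule integral_mono[OF hind_integrable[OF i iu2] L2_integrable[OF sob_L2(1)[OF vH]]])
    fix x
    have "hind s i (\<rho> + h) x = (hind s i (\<rho> + h) x)\<^sup>2" by (simp add: indicator_def)
    also have "\<dots> \<le> (hcut s i \<rho> h x)\<^sup>2" using hind_le_hcut[OF h(1)] by (intro power_mono) auto
    finally show "hind s i (\<rho> + h) x * (norm (u x))\<^sup>2 \<le> (norm (?e x * u x))\<^sup>2"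
      by (simp add: norm_mult power_mult_distrib mult_right_mono)
  qed
  have L1: "L1norm n (\<lambda>x. ?e x * u x) \<le> exp 1 * E \<rho>"
  proof -
    have "L1norm n (\<lambda>x. ?e x * u x) \<le> (\<integral>x. exp 1 * (hind s i \<rho> x * norm (u x)) \<partial>leb n)"
    proof (rule integral_mono[OF integrable_norm[OF v1] integrable_mult_right[OF hind_integrable[OF i iu1]]])
      show "norm (?e x * u x) \<le> exp 1 * (hind s i \<rho> x * norm (u x))" for x
        using mult_right_mono[OF e1[of x], of "norm (u x)"] by (simp only: norm_mult mult.assoc norm_ge_zero)
    qed
    also have "\<dots> = exp 1 * L1w n (hind s i \<rho>) u" by (rule integral_mult_right_zero)
    also have "\<dots> \<le> exp 1 * E \<rho>" by (intro mult_left_mono parts_le_tail) auto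
    finally show ?thesis .
  qed
  have L1': "(L1norm n (\<lambda>x. ?e x * u x))\<^sup>2 \<le> (exp 1 * E \<rho>)\<^sup>2"
    by (intro power_mono L1 integral_nonneg) auto
  have gr: "L2sq n (?H j) \<le> 2 * (exp 1)\<^sup>2 * L2w n (hind s i \<rho>) (G j)
      + 8 * (exp 1)\<^sup>2 / h\<^sup>2 * L2w n (hind s i \<rho>) u" if j: "j < n" for j
  proof -
    have "L2sq n (?H j) \<le> (\<integral>x. 2 * (exp 1)\<^sup>2 * (hind s i \<rho> x * (norm (G j x))\<^sup>2)
        + 8 * (exp 1)\<^sup>2 / h\<^sup>2 * (hind s i \<rho> x * (norm (u x))\<^sup>2) \<partial>leb n)"
    proof (rule integral_mono[OF L2_integrable[OF sob_L2(2)[OF vH j]]])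
      show "integrable (leb n) (\<lambda>x. 2 * (exp 1)\<^sup>2 * (hind s i \<rho> x * (norm (G j x))\<^sup>2)
        + 8 * (exp 1)\<^sup>2 / h\<^sup>2 * (hind s i \<rho> x * (norm (u x))\<^sup>2))"
        by (intro Bochner_Integration.integrable_add integrable_mult_right hind_integrable i iG[OF j] iu2)
      fix x assume "x \<in> space (leb n)"
      then have x: "x \<in> Rn n" by simp
      have "(norm (?e x * G j x))\<^sup>2 \<le> (exp 1 * hind s i \<rho> x * norm (G j x))\<^sup>2"
        unfolding norm_mult[of "?e x"] by (intro power_mono mult_right_mono e1) auto
      then have 1: "(norm (?e x * G j x))\<^sup>2 \<le> (exp 1)\<^sup>2 * (hind s i \<rho> x * (norm (G j x))\<^sup>2)"
        by (simp only: power_mult_distrib ind2 mult.assoc)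
      have "(norm (partial_deriv j ?e x * u x))\<^sup>2 \<le> (2 * exp 1 / h * hind s i \<rho> x * norm (u x))\<^sup>2"
        unfolding norm_mult[of "partial_deriv j ?e x"] by (intro power_mono mult_right_mono e2 j x) auto
      then have 2: "(norm (partial_deriv j ?e x * u x))\<^sup>2 \<le> 4 * (exp 1)\<^sup>2 / h\<^sup>2 * (hind s i \<rho> x * (norm (u x))\<^sup>2)"
        by (simp only: power_mult_distrib power_divide ind2 mult.assoc) simp
      have "a \<le> 2 * p + 2 * q \<Longrightarrow> p \<le> A \<Longrightarrow> q \<le> 4 * B \<Longrightarrow> a \<le> 2 * A + 8 * B" for a p q A B :: real by linarith
      from this[OF norm_add_sq[of "?e x * G j x" "partial_deriv j ?e x * u x"] 1, of "(exp 1)\<^sup>2 / h\<^sup>2 * (hind s i \<rho> x * (norm (u x))\<^sup>2)"] 2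
      show "(norm (?H j x))\<^sup>2 \<le> 2 * (exp 1)\<^sup>2 * (hind s i \<rho> x * (norm (G j x))\<^sup>2)
        + 8 * (exp 1)\<^sup>2 / h\<^sup>2 * (hind s i \<rho> x * (norm (u x))\<^sup>2)" by (simp add: mult.assoc)
    qed
    also have "\<dots> = 2 * (exp 1)\<^sup>2 * L2w n (hind s i \<rho>) (G j)
      + 8 * (exp 1)\<^sup>2 / h\<^sup>2 * L2w n (hind s i \<rho>) u"
      using hind_integrable[OF i iG[OF j]] hind_integrable[OF i iu2]
      by (subst Bochner_Integration.integral_add) simp_all
    finally show ?thesis .
  qed
  have "(\<Sum>j<n. L2sq n (?H j))
      \<le> (\<Sum>j<n. 2 * (exp 1)\<^sup>2 * L2w n (hind s i \<rho>) (G j) + 8 * (exp 1)\<^sup>2 / h\<^sup>2 * E \<rho>)"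
  proof (rule sum_mono)
    fix j assume "j \<in> {..<n}"
    then have j: "j < n" by simp
    have "8 * (exp 1)\<^sup>2 / h\<^sup>2 * L2w n (hind s i \<rho>) u \<le> 8 * (exp 1)\<^sup>2 / h\<^sup>2 * E \<rho>"
      by (intro mult_left_mono parts_le_tail) auto
    with gr[OF j] show "L2sq n (?H j)
      \<le> 2 * (exp 1)\<^sup>2 * L2w n (hind s i \<rho>) (G j) + 8 * (exp 1)\<^sup>2 / h\<^sup>2 * E \<rho>" by linarith
  qed
  also have "\<dots> = 2 * (exp 1)\<^sup>2 * (\<Sum>j<n. L2w n (hind s i \<rho>) (G j)) + n * (8 * (exp 1)\<^sup>2 / h\<^sup>2 * E \<rho>)"
    by (simp add: sum.distrib sum_distrib_left)
  also have "\<dots> \<le> 2 * (exp 1)\<^sup>2 * E \<rho> + n * (8 * (exp 1)\<^sup>2 / h\<^sup>2 * E \<rho>)"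
    by (intro add_right_mono mult_left_mono parts_le_tail) auto
  also have "\<dots> \<le> 2 * (exp 1)\<^sup>2 * (E \<rho> / h\<^sup>2) + n * (8 * (exp 1)\<^sup>2 / h\<^sup>2 * E \<rho>)"
  proof (intro add_right_mono mult_left_mono)
    have "h\<^sup>2 \<le> 1" using h by (simp add: power_le_one)
    then show "E \<rho> \<le> E \<rho> / h\<^sup>2" using h(1) tail_nonneg[of \<rho>] by (simp add: le_divide_eq mult_left_le)
  qed auto
  also have "\<dots> = (2 * (exp 1)\<^sup>2 + 8 * n * (exp 1)\<^sup>2) * (E \<rho> / h\<^sup>2)" by (simp add: algebra_simps)
  finally have gr': "(\<Sum>j<n. L2sq n (?H j)) \<le> (2 * (exp 1)\<^sup>2 + 8 * n * (exp 1)\<^sup>2) * (E \<rho> / h\<^sup>2)" .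
  let ?P = "(1 / l) ^ n * (E \<rho>)\<^sup>2" and ?Q = "l\<^sup>2 / h\<^sup>2 * E \<rho>"
  have PQ: "0 \<le> ?P" "0 \<le> ?Q" using l tail_nonneg[of \<rho>] by auto
  have "2 * ((exp 4 / l) ^ n * (L1norm n (\<lambda>x. ?e x * u x))\<^sup>2) \<le> 2 * ((exp 4 / l) ^ n * (exp 1 * E \<rho>)\<^sup>2)"
    using l by (intro mult_left_mono L1') auto
  also have "\<dots> = (2 * exp 4 ^ n * (exp 1)\<^sup>2) * ?P" by (simp add: power_divide power_mult_distrib)
  finally have F1: "2 * ((exp 4 / l) ^ n * (L1norm n (\<lambda>x. ?e x * u x))\<^sup>2) \<le> (2 * exp 4 ^ n * (exp 1)\<^sup>2) * ?P" .
  have "2 * (n * (l\<^sup>2 * (\<Sum>j<n. L2sq n (?H j)))) \<le> 2 * (n * (l\<^sup>2 * ((2 * (exp 1)\<^sup>2 + 8 * n * (exp 1)\<^sup>2) * (E \<rho> / h\<^sup>2))))"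
    by (intro mult_left_mono gr') auto
  also have "\<dots> = (2 * n * (2 * (exp 1)\<^sup>2 + 8 * n * (exp 1)\<^sup>2)) * ?Q" by (simp add: algebra_simps)
  finally have F2: "2 * (n * (l\<^sup>2 * (\<Sum>j<n. L2sq n (?H j)))) \<le> (2 * n * (2 * (exp 1)\<^sup>2 + 8 * n * (exp 1)\<^sup>2)) * ?Q" .
  have "a \<le> b \<Longrightarrow> b \<le> c + d \<Longrightarrow> c \<le> k1 * P \<Longrightarrow> d \<le> k2 * Q \<Longrightarrow> 0 \<le> k1 * Q \<Longrightarrow> 0 \<le> k2 * P \<Longrightarrow> a \<le> (k1 + k2) * (P + Q)"
    for a b c d k1 k2 P Q :: real by (simp add: algebra_simps)
  note combine = this[OF lower N F1 F2]
  show ?thesis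
    unfolding nash_const_def
  proof (rule combine)
    show "0 \<le> 2 * exp 4 ^ n * (exp 1)\<^sup>2 * ?Q" by (intro mult_nonneg_nonneg PQ) auto
    show "0 \<le> 2 * n * (2 * (exp 1)\<^sup>2 + 8 * n * (exp 1)\<^sup>2) * ?P" by (intro mult_nonneg_nonneg PQ) auto
  qed
qed

end

text \<open>
  De Giorgi's iteration. With \<open>h = 2\<^sup>-\<^sup>k\<close>, \<open>t = \<alpha> h\<close> and \<open>l = \<beta> h\<^sup>2\<close> the step inequality bounds
  \<open>E (\<rho> (k + 1))\<close> by \<open>E (\<rho> k)\<close> times \<open>C \<alpha> + (C\<^sup>2 / \<alpha>) (\<beta>\<^sup>-\<^sup>n 4\<^sup>k\<^sup>(\<^sup>n\<^sup>+\<^sup>1\<^sup>) E (\<rho> k) + \<beta>\<^sup>2)\<close>.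
  If \<open>E (\<rho> k) \<le> \<epsilon> \<theta>\<^sup>k\<close> with \<open>\<theta> = 4\<^sup>-\<^sup>(\<^sup>n\<^sup>+\<^sup>1\<^sup>)\<close> then the power of \<open>4\<close> is compensated, and \<open>\<alpha>\<close>, \<open>\<beta>\<close> and \<open>\<epsilon>\<close> are
  chosen such that each of the three summands is at most \<open>\<theta> / 3\<close>. The levels stay bounded by \<open>\<rho>\<^sub>0 + 4\<close>.
\<close>

lemma de_giorgi:
  fixes E :: "real \<Rightarrow> real"
  assumes nonneg: "\<And>\<rho>. 0 \<le> E \<rho>" and anti: "\<And>\<rho> \<rho>'. \<rho> \<le> \<rho>' \<Longrightarrow> E \<rho>' \<le> E \<rho>"
    and small: "\<And>e. 0 < e \<Longrightarrow> \<exists>\<rho>>r0. E \<rho> \<le> e" and C: "0 < C"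
    and step: "\<And>\<rho> h t l. \<rho> > r0 \<Longrightarrow> 0 < h \<Longrightarrow> h \<le> 1 \<Longrightarrow> 0 < t \<Longrightarrow> 0 < l \<Longrightarrow>
        E (\<rho> + 2 * h) \<le> C / h * (t * E \<rho> + C / t * ((1 / l) ^ n * (E \<rho>)\<^sup>2 + l\<^sup>2 / h\<^sup>2 * E \<rho>))"
  shows "\<exists>R. E R = 0"
proof -
  define \<theta> where "\<theta> = (1 / 4 :: real) ^ (n + 1)"
  have \<theta>: "0 < \<theta>" "\<theta> < 1" unfolding \<theta>_def by (simp_all add: power_Suc_less_one del: power_Suc)
  define \<alpha> where "\<alpha> = \<theta> / (3 * C)"
  define \<beta> where "\<beta> = sqrt (\<theta> * \<alpha> / (3 * C\<^sup>2))"
  have \<alpha>: "\<alpha> > 0" and \<beta>: "\<beta> > 0" using \<theta> C by (auto simp: \<alpha>_def \<beta>_def)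
  have \<beta>2: "\<beta>\<^sup>2 = \<theta> * \<alpha> / (3 * C\<^sup>2)" using \<theta> C \<alpha> by (simp add: \<beta>_def)
  define \<epsilon> where "\<epsilon> = \<theta> * \<alpha> * \<beta> ^ n / (3 * C\<^sup>2)"
  have \<epsilon>: "\<epsilon> > 0" using \<theta> C \<alpha> \<beta> by (simp add: \<epsilon>_def)
  obtain \<rho>0 where \<rho>0: "\<rho>0 > r0" "E \<rho>0 \<le> \<epsilon>" using small[OF \<epsilon>] by blast
  define h where "h k = (1 / 2 :: real) ^ k" for k
  \<comment> \<open>The gaps \<open>2 h k\<close> add up to \<open>4\<close>.\<close>
  define \<rho> where "\<rho> k = \<rho>0 + 4 * (1 - h k)" for k
  have h: "0 < h k" "h k \<le> 1" for k by (auto simp: h_def power_le_one)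
  have \<rho>S: "\<rho> (Suc k) = \<rho> k + 2 * h k" for k by (simp add: \<rho>_def h_def)
  have \<rho>gt: "\<rho> k > r0" for k using \<rho>0(1) h(2)[of k] by (simp add: \<rho>_def)
  have main: "E (\<rho> k) \<le> \<epsilon> * \<theta> ^ k" for k
  proof (induction k)
    case 0 then show ?case using \<rho>0(2) by (simp add: \<rho>_def h_def)
  next
    case (Suc k)
    let ?e = "E (\<rho> k)" and ?h = "h k"
    have h2: "(1 / ?h) ^ n * (1 / ?h) ^ n * (1 / ?h)\<^sup>2 = (4 ^ (n + 1)) ^ k"
    proof -
      have "1 / ?h = 2 ^ k" by (simp add: h_def power_divide)
      then have "(1 / ?h) ^ n * (1 / ?h) ^ n * (1 / ?h)\<^sup>2 = (2 ^ k * 2 ^ k) ^ n * (2 ^ k * 2 ^ k :: real)"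
        by (simp add: power_mult_distrib power2_eq_square)
      also have "(2::real) ^ k * 2 ^ k = 4 ^ k" by (simp flip: power_mult_distrib)
      also have "((4::real) ^ k) ^ n * 4 ^ k = (4 ^ (n + 1)) ^ k"
        by (simp add: power_mult_distrib mult.commute flip: power_mult)
      finally show ?thesis .
    qed
    have "E (\<rho> (Suc k)) \<le> C / ?h * (\<alpha> * ?h * ?e + C / (\<alpha> * ?h) * ((1 / (\<beta> * ?h\<^sup>2)) ^ n * ?e\<^sup>2 + (\<beta> * ?h\<^sup>2)\<^sup>2 / ?h\<^sup>2 * ?e))"
      unfolding \<rho>S using h \<alpha> \<beta> by (intro step \<rho>gt mult_pos_pos zero_less_power) auto
    also have "\<dots> = ?e * (C * \<alpha> + C\<^sup>2 / \<alpha> * ((1 / \<beta>) ^ n * ((1 / ?h) ^ n * (1 / ?h) ^ n * (1 / ?h)\<^sup>2) * ?e + \<beta>\<^sup>2))"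
    proof -
      let ?P = "(1 / \<beta>) ^ n * ((1 / ?h) ^ n * (1 / ?h) ^ n)"
      have P: "(1 / (\<beta> * ?h\<^sup>2)) ^ n = ?P"
        by (simp add: power2_eq_square power_mult_distrib power_divide)
      have B: "(\<beta> * ?h\<^sup>2)\<^sup>2 / ?h\<^sup>2 = \<beta>\<^sup>2 * ?h\<^sup>2" using h(1)[of k] by (simp add: power2_eq_square)
      have "C / ?h * (\<alpha> * ?h * ?e + C / (\<alpha> * ?h) * (P * ?e\<^sup>2 + \<beta>\<^sup>2 * ?h\<^sup>2 * ?e))
          = ?e * (C * \<alpha> + C\<^sup>2 / \<alpha> * (P * (1 / ?h)\<^sup>2 * ?e + \<beta>\<^sup>2))" for P
        using h(1)[of k] \<alpha> by (simp add: field_simps power2_eq_square)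
      from this[of ?P] show ?thesis unfolding P B by (simp only: mult.assoc)
    qed
    also have "\<dots> \<le> ?e * \<theta>"
    proof (rule mult_left_mono[OF _ nonneg])
      have "(1 / \<beta>) ^ n * ((1 / ?h) ^ n * (1 / ?h) ^ n * (1 / ?h)\<^sup>2) * ?e
          \<le> (1 / \<beta>) ^ n * ((1 / ?h) ^ n * (1 / ?h) ^ n * (1 / ?h)\<^sup>2) * (\<epsilon> * \<theta> ^ k)"
        using Suc.IH \<beta> h(1)[of k] by (intro mult_left_mono) auto
      also have "\<dots> = (1 / \<beta>) ^ n * \<epsilon> * ((4 ^ (n + 1)) ^ k * \<theta> ^ k)" unfolding h2 by simp
      also have "(4 ^ (n + 1)) ^ k * \<theta> ^ k = 1"
        unfolding power_mult_distrib[symmetric] \<theta>_def by simp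
      also have "(1 / \<beta>) ^ n * \<epsilon> * 1 = \<theta> * \<alpha> / (3 * C\<^sup>2)"
        using \<beta> by (simp add: \<epsilon>_def power_divide)
      finally have X: "(1 / \<beta>) ^ n * ((1 / ?h) ^ n * (1 / ?h) ^ n * (1 / ?h)\<^sup>2) * ?e \<le> \<theta> * \<alpha> / (3 * C\<^sup>2)" .
      have "C\<^sup>2 / \<alpha> * ((1 / \<beta>) ^ n * ((1 / ?h) ^ n * (1 / ?h) ^ n * (1 / ?h)\<^sup>2) * ?e + \<beta>\<^sup>2)
          \<le> C\<^sup>2 / \<alpha> * (\<theta> * \<alpha> / (3 * C\<^sup>2) + \<theta> * \<alpha> / (3 * C\<^sup>2))"
        unfolding \<beta>2 using \<alpha> by (intro mult_left_mono add_right_mono X) auto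
      also have "\<dots> = 2 * \<theta> / 3" using \<alpha> C by (simp add: field_simps)
      finally show "C * \<alpha> + C\<^sup>2 / \<alpha> * ((1 / \<beta>) ^ n * ((1 / ?h) ^ n * (1 / ?h) ^ n * (1 / ?h)\<^sup>2) * ?e + \<beta>\<^sup>2) \<le> \<theta>"
        using C by (simp add: \<alpha>_def)
    qed
    also have "\<dots> \<le> \<epsilon> * \<theta> ^ k * \<theta>" using Suc.IH \<theta> by (intro mult_right_mono) auto
    finally show ?case by (simp only: power_Suc mult_ac)
  qed
  have "E (\<rho>0 + 4) \<le> \<epsilon> * \<theta> ^ k" for k
  proof -
    have "\<rho> k \<le> \<rho>0 + 4" using h(1)[of k] by (simp add: \<rho>_def)
    from order_trans[OF anti[OF this] main[of k]] show ?thesis .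
  qed
  moreover have "(\<lambda>k. \<epsilon> * \<theta> ^ k) \<longlonglongrightarrow> \<epsilon> * 0"
    using \<theta> by (intro tendsto_intros LIMSEQ_realpow_zero) auto
  ultimately have "E (\<rho>0 + 4) \<le> \<epsilon> * 0"
    by (intro LIMSEQ_le_const) auto
  then show ?thesis using nonneg[of "\<rho>0 + 4"] by (intro exI[of _ "\<rho>0 + 4"]) auto
qed

lemma mult_le_weighted_sq:
  assumes "0 < t" shows "x * y \<le> t * x\<^sup>2 + 1 / t * (y::real)\<^sup>2"
proof -
  have "t * (2 * (x * y)) \<le> t * (t * x\<^sup>2 + 1 / t * y\<^sup>2)"
    using two_mult_le_sq[of "t * x" y] assms by (simp add: power_mult_distrib algebra_simps power2_eq_square)
  then have "2 * (x * y) \<le> t * x\<^sup>2 + 1 / t * y\<^sup>2" using assms by simp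
  moreover have "0 \<le> t * x\<^sup>2 + 1 / t * y\<^sup>2" using assms by simp
  ultimately show ?thesis by linarith
qed

context half_space
begin

text \<open>
  From level \<open>\<rho>\<close> to \<open>\<rho> + h\<close> Nash's inequality is used, from \<open>\<rho> + h\<close> to \<open>\<rho> + 2 h\<close> the energy
  inequality; the product \<open>|\<partial>\<^sub>i u| |u|\<close> is split by a weight \<open>t\<close> left to the iteration.
\<close>

lemma tail_vanishes:
  assumes \<kappa>: "0 < \<kappa>"
    and en: "\<And>\<rho> h. \<rho> > r0 \<Longrightarrow> 0 < h \<Longrightarrow>
      \<kappa> * ((\<Sum>j<n. L2w n (hcut s i \<rho> h) (G j)) + L2w n (hcut s i \<rho> h) u
          + L1w n (hcut s i \<rho> h) u)
      \<le> 2 * exp 1 / h * (\<integral>x. hind s i \<rho> x * (norm (G i x) * norm (u x)) \<partial>leb n)"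
  shows "\<exists>R. AE x in leb n. R < s * x i \<longrightarrow> u x = 0"
proof -
  define C where "C = 2 * exp 1 / \<kappa> + nash_const"
  have c1: "0 < 2 * exp 1 / \<kappa>" using \<kappa> by simp
  have c2: "0 \<le> nash_const" unfolding nash_const_def by simp
  have C: "2 * exp 1 / \<kappa> \<le> C" "nash_const \<le> C" "0 < C" using c1 c2 by (auto simp: C_def)
  have "\<exists>R. E R = 0"
  proof (rule de_giorgi[OF tail_nonneg tail_antimono tail_small C(3), where n = n])
    fix \<rho> h t l :: real
    assume r: "r0 < \<rho>" and h: "0 < h" "h \<le> 1" and t: "0 < t" and l: "0 < l"
    let ?Z = "(1 / l) ^ n * (E \<rho>)\<^sup>2 + l\<^sup>2 / h\<^sup>2 * E \<rho>"
    have Z: "0 \<le> ?Z" using l tail_nonneg[of \<rho>] by simp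
    have hc: "integrable (leb n) (\<lambda>x. hcut s i (\<rho> + h) h x * g x)" if "integrable (leb n) g" for g
      by (rule integrable_bounded_mult[OF that hcut_measurable[OF i], where C = "exp 1"])
         (use hcut_bounds in auto)
    have le: "(\<integral>x. hind s i (\<rho> + 2 * h) x * g x \<partial>leb n) \<le> (\<integral>x. hcut s i (\<rho> + h) h x * g x \<partial>leb n)"
      if "integrable (leb n) g" "\<And>x. 0 \<le> g x" for g
    proof (rule integral_mono[OF hind_integrable[OF i that(1)] hc[OF that(1)]])
      fix x
      have "hind s i (\<rho> + 2 * h) x \<le> hcut s i (\<rho> + h) h x"
        using hind_le_hcut[where s = s and i = i and \<rho> = "\<rho> + h" and x = x, OF h(1)] by (simp add: add.assoc)
      then show "hind s i (\<rho> + 2 * h) x * g x \<le> hcut s i (\<rho> + h) h x * g x" using that(2) by (rule mult_right_mono)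
    qed
    have "E (\<rho> + 2 * h) \<le> (\<Sum>j<n. L2w n (hcut s i (\<rho> + h) h) (G j))
        + L2w n (hcut s i (\<rho> + h) h) u + L1w n (hcut s i (\<rho> + h) h) u"
      unfolding tail_def using iG iu1 iu2 by (intro add_mono sum_mono le) auto
    then have "\<kappa> * E (\<rho> + 2 * h) \<le> \<kappa> * ((\<Sum>j<n. L2w n (hcut s i (\<rho> + h) h) (G j))
        + L2w n (hcut s i (\<rho> + h) h) u + L1w n (hcut s i (\<rho> + h) h) u)"
      using \<kappa> by (intro mult_left_mono) auto
    also have "\<dots> \<le> 2 * exp 1 / h * (\<integral>x. hind s i (\<rho> + h) x * (norm (G i x) * norm (u x)) \<partial>leb n)"
      using r h by (intro en) auto
    also have "\<dots> \<le> 2 * exp 1 / h * (t * E \<rho> + 1 / t * (nash_const * ?Z))"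
    proof (rule mult_left_mono)
      have "(\<integral>x. hind s i (\<rho> + h) x * (norm (G i x) * norm (u x)) \<partial>leb n)
          \<le> (\<integral>x. t * (hind s i (\<rho> + h) x * (norm (G i x))\<^sup>2) + 1 / t * (hind s i (\<rho> + h) x * (norm (u x))\<^sup>2) \<partial>leb n)"
      proof (rule integral_mono)
        have "integrable (leb n) (\<lambda>x. norm (G i x) * norm (u x))"
          using integrable_norm[OF L2_prod_integrable[OF sob_L2(2)[OF uG i] sob_L2(1)[OF uG]]] by (simp add: norm_mult)
        then show "integrable (leb n) (\<lambda>x. hind s i (\<rho> + h) x * (norm (G i x) * norm (u x)))" by (rule hind_integrable[OF i])
        show "integrable (leb n) (\<lambda>x. t * (hind s i (\<rho> + h) x * (norm (G i x))\<^sup>2) + 1 / t * (hind s i (\<rho> + h) x * (norm (u x))\<^sup>2))"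
          by (intro Bochner_Integration.integrable_add integrable_mult_right hind_integrable i iG iu2)
        show "hind s i (\<rho> + h) x * (norm (G i x) * norm (u x))
            \<le> t * (hind s i (\<rho> + h) x * (norm (G i x))\<^sup>2) + 1 / t * (hind s i (\<rho> + h) x * (norm (u x))\<^sup>2)" for x
          using mult_le_weighted_sq[OF t, of "norm (G i x)" "norm (u x)"] by (simp add: indicator_def)
      qed
      also have "\<dots> = t * L2w n (hind s i (\<rho> + h)) (G i) + 1 / t * L2w n (hind s i (\<rho> + h)) u"
        using hind_integrable[OF i iG[OF i]] hind_integrable[OF i iu2]
        by (subst Bochner_Integration.integral_add) simp_all
      also have "\<dots> \<le> t * E \<rho> + 1 / t * (nash_const * ?Z)"
      proof (intro add_mono mult_left_mono)
        show "L2w n (hind s i (\<rho> + h)) (G i) \<le> E \<rho>"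
          using parts_le_tail(4)[where \<rho> = "\<rho> + h", OF i] tail_antimono[of \<rho> "\<rho> + h"] h(1) by linarith
        show "L2w n (hind s i (\<rho> + h)) u \<le> nash_const * ?Z"
          by (rule nash_half_space[OF h l])
      qed (use t in auto)
      finally show "(\<integral>x. hind s i (\<rho> + h) x * (norm (G i x) * norm (u x)) \<partial>leb n) \<le> t * E \<rho> + 1 / t * (nash_const * ?Z)" .
    qed (use h in auto)
    finally have Y: "\<kappa> * E (\<rho> + 2 * h) \<le> 2 * exp 1 / h * (t * E \<rho> + 1 / t * (nash_const * ?Z))" .
    have "E (\<rho> + 2 * h) \<le> 2 * exp 1 / h * (t * E \<rho> + 1 / t * (nash_const * ?Z)) / \<kappa>"
      by (simp only: pos_le_divide_eq[OF \<kappa>] mult.commute[of _ \<kappa>] Y)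
    also have "\<dots> = (2 * exp 1 / \<kappa>) / h * (t * E \<rho> + nash_const / t * ?Z)" by simp
    also have "\<dots> \<le> C / h * (t * E \<rho> + C / t * ?Z)"
      using C c2 h t Z tail_nonneg[of \<rho>]
      by (intro mult_mono divide_right_mono add_mono mult_right_mono) (auto intro!: add_nonneg_nonneg mult_nonneg_nonneg divide_nonneg_pos)
    finally show "E (\<rho> + 2 * h) \<le> C / h * (t * E \<rho> + C / t * ?Z)" .
  qed
  then obtain R where R: "E R = 0" by blast
  have "L1w n (hind s i R) u = 0"
    using parts_le_tail(3)[of R] parts_nonneg(2)[of R u] R by linarith
  then have "AE x in leb n. hind s i R x * norm (u x) = 0"
    using integral_nonneg_eq_0_iff_AE[OF hind_integrable[OF i iu1]] by simp
  then have "AE x in leb n. R < s * x i \<longrightarrow> u x = 0"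
    by (rule AE_mp) (auto intro!: AE_I2 simp: indicator_def)
  then show ?thesis by blast
qed

end

lemma vanishes_in_half_space:
  assumes gws: "global_weak_solution n a b \<phi> F u" and \<phi>: "AE x in leb n. 0 \<le> \<phi> x"
    and F: "F \<in> H_minus1 n" and co: "coincides_on n (Rn n - K) F f" and K: "compact K" "K \<subseteq> Rn n"
    and fm: "AE x in restrict_space (leb n) (Rn n - K). norm (f x) \<le> \<kappa>"
    and l: "norm l \<le> 1" "\<kappa> \<le> Re l" "2 * \<kappa> \<le> Re (l * a)" "\<kappa> \<le> Re (l * b)" "0 < \<kappa>"
    and i: "i < n" and s: "s = 1 \<or> s = - 1"
  shows "\<exists>R. AE x in leb n. R < s * x i \<longrightarrow> u x = 0"
proof -
  have uX: "u \<in> H1 n" and u1: "integrable (leb n) u"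
    using gws by (auto simp: global_weak_solution_def X_space_def L1_iff)
  interpret half_space n s i u "weak_grad n u"
    by standard (use H1_weak_grad[OF uX] u1 i s in auto)
  obtain R0 where R0: "K \<subseteq> box_n n R0" using compact_subset_box[OF K] by blast
  have Kr: "s * x i \<le> R0" if "x \<in> K" for x
  proof -
    have "\<bar>x i\<bar> \<le> R0" using R0 that i unfolding subset_iff box_n_iff by blast
    then show ?thesis using s by auto
  qed
  show ?thesis
  proof (rule tail_vanishes[OF l(5), where ?r0.0 = R0])
    fix \<rho> h :: real assume r: "R0 < \<rho>" and h: "0 < h"
    have Fb: "F v \<le> \<kappa> * L1norm n v"
      if "sob n v H" "integrable (leb n) v" "AE x in leb n. s * x i < \<rho> \<longrightarrow> v x = 0" for v H
      by (rule functional_bound[OF F co K fm less_imp_le[OF l(5)] i s _ r that]) (rule Kr)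
    show "\<kappa> * ((\<Sum>j<n. L2w n (hcut s i \<rho> h) (weak_grad n u j)) + L2w n (hcut s i \<rho> h) u
          + L1w n (hcut s i \<rho> h) u)
      \<le> 2 * exp 1 / h * (\<integral>x. hind s i \<rho> x * (norm (weak_grad n u i x) * norm (u x)) \<partial>leb n)"
      by (rule half_space_energy[OF gws \<phi> i s h less_imp_le[OF l(5)] _ l(1-4) order_refl l(5)]) (rule Fb)
  qed
qed

section \<open>Compact support\<close>

lemma compact_supp:
  assumes "AE x in leb n. (\<exists>i<n. R < \<bar>x i\<bar>) \<longrightarrow> u x = 0"
  shows "compact (supp n u)"
proof -
  let ?\<V> = "{V. openin (top_of_set (Rn n)) V \<and> (AE x in leb n. x \<in> V \<longrightarrow> u x = 0)}"
  let ?V = "Rn n \<inter> - box_n n R"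
  have "open (- box_n n R)" using compact_imp_closed[OF compact_box_n] by (simp only: open_Compl)
  then have "openin (top_of_set (Rn n)) ?V" by (rule openin_open_Int)
  moreover have "AE x in leb n. x \<in> ?V \<longrightarrow> u x = 0"
    using assms
  proof (rule AE_mp, intro AE_I2 impI)
    fix x assume x: "(\<exists>i<n. R < \<bar>x i\<bar>) \<longrightarrow> u x = 0" "x \<in> ?V"
    then have "x \<in> Rn n" "x \<notin> box_n n R" by blast+
    then have "\<exists>i<n. R < \<bar>x i\<bar>" unfolding box_n_iff by (meson not_le)
    with x(1) show "u x = 0" by blast
  qed
  ultimately have "?V \<in> ?\<V>" by blast
  then have sub: "supp n u \<subseteq> box_n n R" unfolding supp_def by blast
  have "openin (top_of_set (Rn n)) (\<Union>?\<V>)" by (rule openin_Union) blast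
  then obtain T where T: "open T" "\<Union>?\<V> = Rn n \<inter> T" unfolding openin_open by blast
  have "box_n n R \<subseteq> Rn n" unfolding subset_iff box_n_iff by blast
  with sub T(2) have "supp n u = box_n n R - T" unfolding supp_def by blast
  then show ?thesis using compact_diff[OF compact_box_n T(1)] by simp
qed

section \<open>The half-plane of an admissible pair\<close>

definition margin_at :: "complex \<times> complex \<Rightarrow> complex \<Rightarrow> real" where
  "margin_at p l = min (Re l) (min (Re (l * fst p)) (Re (l * snd p)))"

text \<open>
  How deep \<open>1\<close>, \<open>a\<close>, \<open>b\<close> can be moved into the right half-plane by a common factor from the unit
  disc. A supremum over a bounded set of factors is Lipschitz in the pair, so that no continuous choice of
  \<open>l\<close> is needed.
\<close>

definition rot_margin :: "complex \<times> complex \<Rightarrow> real" where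
  "rot_margin p = (SUP l\<in>cball 0 1. margin_at p l)"

lemma margin_bdd: "bdd_above (margin_at p ` cball 0 1)"
proof (rule bdd_aboveI2)
  fix l :: complex assume "l \<in> cball 0 1"
  then have "Re l \<le> 1" using complex_Re_le_cmod[of l] by simp
  then show "margin_at p l \<le> 1" by (simp add: margin_at_def)
qed

lemma rot_margin_le: "rot_margin p \<le> rot_margin q + dist p q"
  unfolding rot_margin_def
proof (rule cSUP_least)
  fix l :: complex assume l: "l \<in> cball 0 1"
  have Re_le: "Re (l * z) \<le> Re (l * w) + dist z w" for z w
  proof -
    have "Re (l * z) - Re (l * w) = Re (l * (z - w))" by (simp add: algebra_simps)
    also have "\<dots> \<le> norm (l * (z - w))" by (rule complex_Re_le_cmod)
    also have "\<dots> \<le> dist z w" using l by (simp add: norm_mult dist_norm mult_left_le_one_le)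
    finally show ?thesis by linarith
  qed
  have "margin_at p l \<le> margin_at q l + dist p q"
    using Re_le[of "fst p" "fst q"] Re_le[of "snd p" "snd q"] dist_fst_le[of p q] dist_snd_le[of p q] zero_le_dist[of p q]
    unfolding margin_at_def by linarith
  also have "margin_at q l \<le> (SUP l\<in>cball 0 1. margin_at q l)" by (rule cSUP_upper[OF l margin_bdd])
  finally show "margin_at p l \<le> (SUP l\<in>cball 0 1. margin_at q l) + dist p q" by simp
qed simp

lemma continuous_on_rot_margin: "continuous_on S rot_margin"
  unfolding continuous_on_iff
proof (intro ballI allI impI)
  fix p and e :: real assume "0 < e"
  then show "\<exists>d>0. \<forall>q\<in>S. dist q p < d \<longrightarrow> dist (rot_margin q) (rot_margin p) < e"
  proof (intro exI[of _ e] conjI ballI impI)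
    fix q assume "dist q p < e"
    then show "dist (rot_margin q) (rot_margin p) < e"
      using rot_margin_le[of p q] rot_margin_le[of q p] by (simp add: dist_real_def dist_commute abs_less_iff)
  qed
qed

text \<open>
  With \<open>l = 1 - i q\<close> the real parts of \<open>l a\<close> and \<open>l b\<close> are \<open>Re a + q Im a\<close> and \<open>Re b + q Im b\<close>. If
  the imaginary parts do not have opposite signs, every \<open>q\<close> of their sign and large modulus works; otherwise \<open>q\<close> has to lie
  between two bounds, and the second condition of admissibility says that the interval is nonempty.
\<close>

lemma rotation_exists:
  assumes "(a, b) \<in> admissible_pairs"
  shows "\<exists>q::real. 0 < Re a + q * Im a \<and> 0 < Re b + q * Im b"
proof -
  have pos: "\<exists>Q. \<forall>q\<ge>Q. 0 < Re z + q * Im z" if "z \<in> \<A>" "Im z \<ge> 0" for z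
  proof (cases "Im z = 0")
    case True
    then have "Re z > 0" using that by (auto simp: \<A>_def)
    then show ?thesis using True by auto
  next
    case False
    then have iz: "Im z > 0" using that by simp
    show ?thesis
    proof (intro exI allI impI)
      fix q assume "(1 - Re z) / Im z \<le> q"
      then have "1 - Re z \<le> q * Im z" using iz by (simp add: divide_le_eq)
      then show "0 < Re z + q * Im z" by linarith
    qed
  qed
  have neg: "\<exists>Q. \<forall>q\<ge>Q. 0 < Re z - q * Im z" if "z \<in> \<A>" "Im z \<le> 0" for z
    using pos[of "cnj z"] that by (simp add: \<A>_def)
  have mixed: "\<exists>q. 0 < Re z + q * Im z \<and> 0 < Re w + q * Im w"
    if "Im z > 0" "Im w < 0" "Re z / Im z > Re w / Im w" for z w :: complex
  proof -
    define q where "q = - (Re z / Im z + Re w / Im w) / 2"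
    have "- Re z / Im z < q" "q < - Re w / Im w" using that(3) by (auto simp: q_def)
    then have "- Re z < q * Im z" "- Re w < q * Im w"
      using that(1,2) by (simp_all only: pos_divide_less_eq neg_less_divide_eq)
    then show ?thesis by (intro exI[of _ q]) auto
  qed
  have ab: "a \<in> \<A>" "b \<in> \<A>"
    and adm: "Im a * Im b \<ge> 0 \<or> (Im a * Im b < 0 \<and> Re b > Im b / Im a * Re a)"
    using assms by (auto simp: admissible_pairs_def)
  consider "Im a \<ge> 0" "Im b \<ge> 0" | "Im a \<le> 0" "Im b \<le> 0"
    | "Im a > 0" "Im b < 0" "Re b > Im b / Im a * Re a" | "Im a < 0" "Im b > 0" "Re b > Im b / Im a * Re a"
    using adm by (auto simp: zero_le_mult_iff mult_less_0_iff)
  then show ?thesis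
  proof cases
    case 1
    then obtain P Q where "\<forall>q\<ge>P. 0 < Re a + q * Im a" "\<forall>q\<ge>Q. 0 < Re b + q * Im b" using pos ab by metis
    then show ?thesis by (intro exI[of _ "max P Q"]) auto
  next
    case 2
    then obtain P Q where PQ: "\<forall>q\<ge>P. 0 < Re a - q * Im a" "\<forall>q\<ge>Q. 0 < Re b - q * Im b" using neg ab by metis
    then have "0 < Re a - max P Q * Im a" "0 < Re b - max P Q * Im b" by auto
    then show ?thesis by (intro exI[of _ "- max P Q"]) auto
  next
    case 3
    then have "Re a / Im a > Re b / Im b" by (simp add: field_simps)
    with 3 show ?thesis by (intro mixed)
  next
    case 4
    then have "Re b / Im b > Re a / Im a" by (simp add: field_simps)
    with 4 mixed[of b a] show ?thesis by blast
  qed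
qed

lemma rot_margin_pos:
  assumes "(a, b) \<in> admissible_pairs"
  shows "0 < rot_margin (a, b)"
proof -
  obtain q where q: "0 < Re a + q * Im a" "0 < Re b + q * Im b" using rotation_exists[OF assms] by blast
  define z where "z = Complex 1 (- q)"
  have nz: "norm z > 0" by (simp add: z_def complex_eq_iff)
  define l where "l = z / complex_of_real (norm z)"
  have l: "l \<in> cball 0 1" using nz by (simp add: l_def norm_divide)
  have lz: "Re (l * w) = Re (z * w) / norm z" for w by (simp add: l_def)
  have "0 < margin_at (a, b) l"
    unfolding margin_at_def using lz[of 1] lz[of a] lz[of b] q nz by (simp add: z_def)
  also have "\<dots> \<le> rot_margin (a, b)" unfolding rot_margin_def by (rule cSUP_upper[OF l margin_bdd])
  finally show ?thesis .
qed

lemma rot_margin_attained: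
  assumes "m < rot_margin (a, b)"
  obtains l where "norm l \<le> 1" "m < Re l" "m < Re (l * a)" "m < Re (l * b)"
proof -
  have "\<exists>l\<in>cball 0 1. m < margin_at (a, b) l"
    using assms less_cSUP_iff[of "cball 0 1" "margin_at (a, b)" m] margin_bdd[of "(a, b)"]
    unfolding rot_margin_def by simp
  then show ?thesis using that by (auto simp: margin_at_def)
qed

lemma AE_le_if_Linf_norm_less:
  assumes "f \<in> Linf M" "Linf_norm M f < c"
  shows "AE x in M. norm (f x) \<le> c"
proof -
  let ?S = "{C. 0 \<le> C \<and> (AE x in M. norm (f x) \<le> C)}"
  obtain C where C: "AE x in M. norm (f x) \<le> C" using assms(1) by (auto simp: Linf_def)
  have "AE x in M. norm (f x) \<le> max C 0" using C by (rule AE_mp) (simp add: max.coboundedI1)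
  then have "max C 0 \<in> ?S" by simp
  then have "?S \<noteq> {}" by blast
  then obtain D where D: "D \<in> ?S" "D < c" using cInf_lessD[of ?S c] assms(2) unfolding Linf_norm_def by blast
  then have "AE x in M. norm (f x) \<le> D" by simp
  then show ?thesis by (rule AE_mp) (use D(2) in simp)
qed

section \<open>Compactness of the support of weak solutions\<close>

theorem theorem5p1:
  shows "\<exists>M :: complex \<times> complex \<Rightarrow> real.
    continuous_on admissible_pairs M \<and>
    (\<forall>(a, b)\<in>admissible_pairs. M (a, b) > 0 \<and>
      (\<forall>n\<ge>1. \<forall>\<phi> F u.
        admissible_potential n \<phi> \<longrightarrow> F \<in> H_minus1 n \<longrightarrow> global_weak_solution n a b \<phi> F u \<longrightarrow>
        (\<exists>K. compact K \<and> K \<subseteq> Rn n \<and>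
          (\<exists>f\<in>Linf (restrict_space (leb n) (Rn n - K)).
             coincides_on n (Rn n - K) F f \<and>
             Linf_norm (restrict_space (leb n) (Rn n - K)) f \<le> 1 / M (a, b))) \<longrightarrow>
        compact (supp n u)))"
proof (intro exI conjI ballI)
  let ?M = "\<lambda>p. 8 / rot_margin p"
  have "\<forall>p\<in>admissible_pairs. rot_margin p \<noteq> 0" using rot_margin_pos by fastforce
  then show "continuous_on admissible_pairs ?M"
    by (intro continuous_on_divide continuous_on_const continuous_on_rot_margin)
  fix p :: "complex \<times> complex" assume p: "p \<in> admissible_pairs"
  obtain a b where ab: "p = (a, b)" by (cases p)
  have m0: "0 < rot_margin (a, b)" using rot_margin_pos p ab by blast
  have "compact (supp n u)"
    if \<phi>: "admissible_potential n \<phi>" and F: "F \<in> H_minus1 n" and gws: "global_weak_solution n a b \<phi> F u"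
      and K: "compact K" "K \<subseteq> Rn n" and f: "f \<in> Linf (restrict_space (leb n) (Rn n - K))"
      and co: "coincides_on n (Rn n - K) F f"
      and small: "Linf_norm (restrict_space (leb n) (Rn n - K)) f \<le> 1 / ?M (a, b)" for n \<phi> F u K f
  proof -
    \<comment> \<open>Half of the margin is kept by \<open>l\<close>, half of that is left for the datum; \<open>M\<close> has the factor \<open>8\<close> and not
      \<open>4\<close> so that the essential bound on \<open>f\<close> follows from a strict inequality between norms.\<close>
    let ?\<kappa> = "rot_margin (a, b) / 4"
    have "rot_margin (a, b) / 2 < rot_margin (a, b)" using m0 by simp
    then obtain l where l: "norm l \<le> 1" "rot_margin (a, b) / 2 < Re l" "rot_margin (a, b) / 2 < Re (l * a)"
      "rot_margin (a, b) / 2 < Re (l * b)" by (rule rot_margin_attained)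
    have \<kappa>: "?\<kappa> \<le> Re l" "2 * ?\<kappa> \<le> Re (l * a)" "?\<kappa> \<le> Re (l * b)" "0 < ?\<kappa>" using l m0 by linarith+
    have "Linf_norm (restrict_space (leb n) (Rn n - K)) f < ?\<kappa>" using small m0 by simp
    then have fm: "AE x in restrict_space (leb n) (Rn n - K). norm (f x) \<le> ?\<kappa>"
      by (rule AE_le_if_Linf_norm_less[OF f])
    have \<phi>0: "AE x in leb n. 0 \<le> \<phi> x" using \<phi> by (simp add: admissible_potential_def)
    note van = vanishes_in_half_space[OF gws \<phi>0 F co K fm l(1) \<kappa>]
    have "\<forall>i. \<exists>R. i < n \<longrightarrow> (AE x in leb n. R < \<bar>x i\<bar> \<longrightarrow> u x = 0)"
    proof
      fix i show "\<exists>R. i < n \<longrightarrow> (AE x in leb n. R < \<bar>x i\<bar> \<longrightarrow> u x = 0)"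
      proof (cases "i < n")
        case True
        obtain P where P: "AE x in leb n. P < 1 * x i \<longrightarrow> u x = 0" using van[OF True, of 1] by auto
        obtain Q where Q: "AE x in leb n. Q < - 1 * x i \<longrightarrow> u x = 0" using van[OF True, of "- 1"] by auto
        have "AE x in leb n. max P Q < \<bar>x i\<bar> \<longrightarrow> u x = 0"
          using P Q by eventually_elim (auto simp: abs_if split: if_splits)
        then show ?thesis by blast
      qed simp
    qed
    from choice[OF this] obtain R where "\<forall>i. i < n \<longrightarrow> (AE x in leb n. R i < \<bar>x i\<bar> \<longrightarrow> u x = 0)"
      by (elim exE)
    then have R: "AE x in leb n. R i < \<bar>x i\<bar> \<longrightarrow> u x = 0" if "i < n" for i using that by (elim allE impE)
    obtain Q where Q: "\<forall>i<n. \<bar>R i\<bar> \<le> Q" using bound_finite[of n R] by (elim exE)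
    have "AE x in leb n. \<forall>i\<in>{..<n}. R i < \<bar>x i\<bar> \<longrightarrow> u x = 0"
    proof (rule AE_finite_allI)
      fix i assume "i \<in> {..<n}"
      then show "AE x in leb n. R i < \<bar>x i\<bar> \<longrightarrow> u x = 0" by (intro R) simp
    qed simp
    then have "AE x in leb n. (\<exists>i<n. Q < \<bar>x i\<bar>) \<longrightarrow> u x = 0"
    proof (rule AE_mp, intro AE_I2 impI)
      fix x assume x: "\<forall>i\<in>{..<n}. R i < \<bar>x i\<bar> \<longrightarrow> u x = 0" "\<exists>i<n. Q < \<bar>x i\<bar>"
      then obtain i where i: "i < n" "Q < \<bar>x i\<bar>" by blast
      then have "R i < \<bar>x i\<bar>" using Q abs_ge_self[of "R i"] by (meson le_less_trans)
      with x(1) i(1) show "u x = 0" by blast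
    qed
    then show ?thesis by (rule compact_supp)
  qed
  then show "case p of (a, b) \<Rightarrow> ?M (a, b) > 0 \<and>
      (\<forall>n\<ge>1. \<forall>\<phi> F u.
        admissible_potential n \<phi> \<longrightarrow> F \<in> H_minus1 n \<longrightarrow> global_weak_solution n a b \<phi> F u \<longrightarrow>
        (\<exists>K. compact K \<and> K \<subseteq> Rn n \<and>
          (\<exists>f\<in>Linf (restrict_space (leb n) (Rn n - K)).
             coincides_on n (Rn n - K) F f \<and>
             Linf_norm (restrict_space (leb n) (Rn n - K)) f \<le> 1 / ?M (a, b))) \<longrightarrow>
        compact (supp n u))"
    unfolding ab prod.case using m0 by (intro conjI allI impI) (simp, blast)
qed

end
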